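(* Let $\Omega\subset\mathbb{R}^2$ be an open and bounded domain. Let $q\in\mathcal{C}^{0,\beta}(\bar\Omega)$ for some $\beta\in(0,1)$ and fix $\epsilon>0$. Then for every exponent $\alpha$ in the range $0<\alpha<\min\{\frac17,\frac\beta2\}$, there exist sequences $\{u_n\in\mathcal{C}^{0,\alpha}(\bar\Omega,\mathbb{R}^2)\}_{n=1}^\infty$ and $\{g_n\in\mathcal{C}^{0,\alpha}(\bar\Omega)\}_{n=1}^\infty$ solving in $\Omega$ the system $$\mathrm{div}(u_n\otimes u_n)-\nabla q=\nabla^\perp g_n,\qquad \mathrm{div}\,u_n=0,$$ and such that $u_n=\nabla^\perp v_n$ and $g_n=\mathrm{curl}\,w_n$, where each $v_n\in\mathcal{C}^{1,\alpha}(\bar\Omega)$ and $w_n\in\mathcal{C}^1(\bar\Omega,\mathbb{R}^2)$, while the sequence $\{v_n\}_{n=1}^\infty$ is dense in $\mathcal{C}^0(\bar\Omega)$ and $\|w_n\|_0<\epsilon$ for every $n\ge1$.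
   Context: The system is understood in the sense of distributions in $\Omega$; the divergence of a matrix field is taken row-wise. Notation: $\nabla^\perp g=(-\partial_2 g,\partial_1 g)$ and $\mathrm{curl}\,w=\partial_1 w_2-\partial_2 w_1$. The space $\mathcal{C}^{k,\alpha}(\bar\Omega)$ (and likewise $\mathcal{C}^k(\bar\Omega)$) consists of restrictions to $\Omega$ of functions in $\mathcal{C}^{k,\alpha}(\mathbb{R}^2)$ (respectively $\mathcal{C}^k(\mathbb{R}^2)$); $\|\cdot\|_0$ is the supremum norm on $\bar\Omega$. *)

theory Defs
  imports "HOL-Analysis.Analysis"
begin

definition pderiv_at :: "'n::finite \<Rightarrow> (real^'n \<Rightarrow> 'b::real_normed_vector) \<Rightarrow> real^'n \<Rightarrow> 'b"
  where "pderiv_at i f x = frechet_derivative f (at x) (axis i 1)"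

text \<open>Function spaces on the whole space. Hoelder regularity is the usual one, finiteness of the
  global Hoelder norm: all derivatives up to order \<open>k\<close> are bounded and those of order \<open>k\<close> are
  Hoelder continuous with exponent \<open>\<alpha>\<close>.\<close>

primrec C_space :: "nat \<Rightarrow> (real^'n::finite \<Rightarrow> 'b::real_normed_vector) set" where
  "C_space 0 = {f. continuous_on UNIV f}"
| "C_space (Suc k) = {f. f differentiable_on UNIV \<and> (\<forall>i. pderiv_at i f \<in> C_space k)}"

primrec C_holder_space :: "nat \<Rightarrow> real \<Rightarrow> (real^'n::finite \<Rightarrow> 'b::real_normed_vector) set" where
  "C_holder_space 0 \<alpha> =
     {f. bounded (range f) \<and> (\<exists>C. \<forall>x y. norm (f x - f y) \<le> C * norm (x - y) powr \<alpha>)}"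
| "C_holder_space (Suc k) \<alpha> =
     {f. bounded (range f) \<and> f differentiable_on UNIV \<and> (\<forall>i. pderiv_at i f \<in> C_holder_space k \<alpha>)}"

text \<open>Spaces up to the boundary, as restrictions of functions on the whole space. A restriction to
  \<open>\<Omega>\<close> is identified with its (unique) continuous extension to \<open>closure \<Omega>\<close>, so that the supremum
  norm over \<open>closure \<Omega>\<close> makes sense; values outside \<open>closure \<Omega>\<close> are irrelevant.\<close>

definition C_bar :: "nat \<Rightarrow> (real^'n::finite) set \<Rightarrow> (real^'n \<Rightarrow> 'b::real_normed_vector) set"
  where "C_bar k \<Omega> = {f. \<exists>F\<in>C_space k. \<forall>x\<in>closure \<Omega>. f x = F x}"

definition C_holder_bar ::
    "nat \<Rightarrow> real \<Rightarrow> (real^'n::finite) set \<Rightarrow> (real^'n \<Rightarrow> 'b::real_normed_vector) set"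
  where "C_holder_bar k \<alpha> \<Omega> = {f. \<exists>F\<in>C_holder_space k \<alpha>. \<forall>x\<in>closure \<Omega>. f x = F x}"

definition norm0 :: "(real^'n::finite) set \<Rightarrow> (real^'n \<Rightarrow> 'b::real_normed_vector) \<Rightarrow> real"
  where "norm0 \<Omega> f = (SUP x\<in>closure \<Omega>. norm (f x))"

definition dense_in_C0_bar :: "(real^'n::finite) set \<Rightarrow> (real^'n \<Rightarrow> real) set \<Rightarrow> bool"
  where "dense_in_C0_bar \<Omega> S \<longleftrightarrow>
    S \<subseteq> C_bar 0 \<Omega> \<and> (\<forall>f\<in>C_bar 0 \<Omega>. \<forall>\<delta>>0. \<exists>h\<in>S. norm0 \<Omega> (\<lambda>x. f x - h x) < \<delta>)"

definition perp_grad :: "(real^2 \<Rightarrow> real) \<Rightarrow> real^2 \<Rightarrow> real^2"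
  where "perp_grad f x = vector [- pderiv_at 2 f x, pderiv_at 1 f x]"

definition curl :: "(real^2 \<Rightarrow> real^2) \<Rightarrow> real^2 \<Rightarrow> real"
  where "curl w x = pderiv_at 1 (\<lambda>y. w y $ 2) x - pderiv_at 2 (\<lambda>y. w y $ 1) x"

definition test_functions :: "(real^'n::finite) set \<Rightarrow> (real^'n \<Rightarrow> real) set"
  where "test_functions \<Omega> = {\<phi>. (\<forall>k. \<phi> \<in> C_space k) \<and>
    compact (closure {x. \<phi> x \<noteq> 0}) \<and> closure {x. \<phi> x \<noteq> 0} \<subseteq> \<Omega>}"

text \<open>Distributions are represented by functionals; only their values on \<open>test_functions \<Omega>\<close> matter.
  Below, \<open>distr \<Omega> f\<close> is the regular distribution given by \<open>f\<close>.\<close>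

type_synonym 'n distribution = "(real^'n \<Rightarrow> real) \<Rightarrow> real"

definition distr :: "(real^'n::finite) set \<Rightarrow> (real^'n \<Rightarrow> real) \<Rightarrow> 'n distribution"
  where "distr \<Omega> f \<phi> = (LINT x:\<Omega>|lborel. f x * \<phi> x)"

definition D_pderiv :: "'n::finite \<Rightarrow> 'n distribution \<Rightarrow> 'n distribution"
  where "D_pderiv i T \<phi> = - T (pderiv_at i \<phi>)"

definition D_div :: "('n::finite \<Rightarrow> 'n distribution) \<Rightarrow> 'n distribution"
  where "D_div T \<phi> = (\<Sum>j\<in>UNIV. D_pderiv j (T j) \<phi>)"

definition D_perp_grad :: "2 distribution \<Rightarrow> 2 \<Rightarrow> 2 distribution"
  where "D_perp_grad T i \<phi> = (if i = 1 then - D_pderiv 2 T \<phi> else D_pderiv 1 T \<phi>)"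

text \<open>The system \<open>div (u \<otimes> u) - \<nabla> q = \<nabla>\<^sup>\<bottom> g\<close>, \<open>div u = 0\<close> in the sense of distributions in \<open>\<Omega>\<close>.
  The index \<open>i\<close> is the component of the first equation, i.e. the row of \<open>u \<otimes> u\<close>.\<close>

definition solves_system ::
    "(real^2) set \<Rightarrow> (real^2 \<Rightarrow> real) \<Rightarrow> (real^2 \<Rightarrow> real^2) \<Rightarrow> (real^2 \<Rightarrow> real) \<Rightarrow> bool"
  where "solves_system \<Omega> q u g \<longleftrightarrow>
    (\<forall>\<phi>\<in>test_functions \<Omega>.
      (\<forall>i. D_div (\<lambda>j. distr \<Omega> (\<lambda>x. u x $ i * u x $ j)) \<phi> - D_pderiv i (distr \<Omega> q) \<phi>
           = D_perp_grad (distr \<Omega> g) i \<phi>) \<and>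
      D_div (\<lambda>j. distr \<Omega> (\<lambda>x. u x $ j)) \<phi> = 0)"

end

theory Submission
  imports Defs "HOL-Computational_Algebra.Polynomial"
begin

text \<open>Write \<open>u = \<nabla>\<^sup>\<bottom> v\<close> and \<open>g = curl w\<close>. The system holds as soon as
  \<open>\<nabla>v \<otimes> \<nabla>v + 2 sym \<nabla>w = q Id + const\<close>, and this equation is solved by convex integration: corrugations
  of rapidly increasing frequencies in the directions \<open>e\<^sub>1, e\<^sub>2, e\<^sub>1 + e\<^sub>2\<close> remove the defect step by step.
  The loss of derivatives is usually treated by mollification. Here all fields stay trigonometric
  polynomials: their degrees add under products, and Bernstein's inequality bounds derivatives by the
  sup norm. The pressure \<open>q\<close> is replaced by Jackson approximations after extending it periodically,
  and square roots of the defect by polynomials in it. A constant multiple of a definite matrix is added to the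
  defect, so any trigonometric polynomial is an admissible starting point, and a countable set of
  these is dense.\<close>

section \<open>Trigonometric polynomials\<close>

text \<open>Why the matrix equation suffices: \<open>u \<otimes> u\<close> is the cofactor matrix of
  \<open>\<nabla>v \<otimes> \<nabla>v\<close>. In dimension 2 taking cofactors is linear, fixes
  \<open>q Id\<close>, and sends \<open>2 sym \<nabla>w\<close> to a field with divergence
  \<open>- \<nabla>\<^sup>\<bottom> (curl w)\<close>. The exponents are a frequency budget. One
  stage divides the amplitude \<open>r\<close> by \<open>m ^ k\<close>, hence the defect by
  \<open>m ^ (2 * k)\<close>. A corrugation of frequency \<open>l\<close> on top of an earlier
  frequency \<open>l'\<close> leaves an error of order \<open>r\<^sup>2 * l' / l\<close>, so each of
  the three needs a gain of \<open>m ^ (2 * k)\<close>. The second derivatives present at the start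
  still carry the amplitude of the preceding stage, which costs another \<open>m ^ k\<close>.
  Amplitudes \<open>m ^ (- k)\<close> against frequencies \<open>m ^ (7 * k)\<close> converge in the
  Hoelder norm for \<alpha> < 1/7. The Jackson error, frequency to the power -\<beta>, must also
  decay like the defect; for small \<beta> the frequencies are made to grow faster, whence \<alpha>
  < \<beta>/2. The base \<open>m\<close> is fixed. Constants and the degree of the square root
  polynomial are paid by a few extra powers of \<open>m\<close>, negligible for large
  \<open>k\<close>.\<close>

inductive tp :: "real \<Rightarrow> (real^'n::finite \<Rightarrow> real) \<Rightarrow> bool" for \<Lambda> where
  tp_cos: "(\<And>i. k $ i \<in> \<int> \<and> \<bar>k $ i\<bar> \<le> \<Lambda>) \<Longrightarrow> tp \<Lambda> (\<lambda>x. cos (k \<bullet> x + c))"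
| tp_add: "tp \<Lambda> f \<Longrightarrow> tp \<Lambda> g \<Longrightarrow> tp \<Lambda> (\<lambda>x. f x + g x)"
| tp_cmult: "tp \<Lambda> f \<Longrightarrow> tp \<Lambda> (\<lambda>x. c * f x)"

lemma tp_mono: "tp L f \<Longrightarrow> L \<le> M \<Longrightarrow> tp M f"
proof (induction rule: tp.induct)
  case (tp_cos k c) then show ?case by (intro tp.tp_cos) (meson order_trans)
qed (auto intro: tp.intros)

lemma tp_const: assumes "0 \<le> L" shows "tp L (\<lambda>x. c)"
  using tp_cmult[OF tp_cos[of "0::real^'n" L 0], of c] assms by simp

lemma tp_uminus: "tp L f \<Longrightarrow> tp L (\<lambda>x. - f x)"
  using tp_cmult[of L f "-1"] by simp

lemma tp_diff: "tp L f \<Longrightarrow> tp L g \<Longrightarrow> tp L (\<lambda>x. f x - g x)"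
  using tp_add[OF _ tp_uminus, of L f g] by simp

lemma tp_sum: assumes "finite I" "\<And>i. i \<in> I \<Longrightarrow> tp L (f i)" "0 \<le> L"
  shows "tp L (\<lambda>x. \<Sum>i\<in>I. f i x)"
  using assms by (induction) (auto intro: tp_const tp_add)

lemma tp_sin: "(\<And>i. k $ i \<in> \<int> \<and> \<bar>k $ i\<bar> \<le> L) \<Longrightarrow> tp L (\<lambda>x. sin (k \<bullet> x + c))"
  using tp_cos[of k L "c - pi/2"] by (simp add: cos_diff add_diff_eq)

lemma tp_cong: "tp L f \<Longrightarrow> (\<And>x. f x = g x) \<Longrightarrow> tp L g"
  by (metis ext)

text \<open>By product-to-sum, frequencies \<open>k\<close> and \<open>k'\<close> produce only
  \<open>k + k'\<close> and \<open>k - k'\<close>, again integral. The nested induction carries this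
  from two cosines to both factors.\<close>

lemma tp_mult: assumes "tp L f" "tp M g" shows "tp (L + M) (\<lambda>x. f x * g x)"
  using assms(1)
proof induction
  case (tp_cos k c) note K = this
  show ?case using assms(2)
  proof induction
    case (tp_cos k' c')
    have a: "tp (L+M) (\<lambda>x. (1/2) * cos ((k + k') \<bullet> x + (c + c')) + (1/2) * cos ((k - k') \<bullet> x + (c - c')))"
      using K tp_cos by (intro tp.intros) (auto, (smt (verit) abs_diff_le_iff)+)
    have "(k + k') \<bullet> x + (c + c') = (k \<bullet> x + c) + (k' \<bullet> x + c')"
      "(k - k') \<bullet> x + (c - c') = (k \<bullet> x + c) - (k' \<bullet> x + c')" for x
      by (simp_all add: inner_add_left inner_diff_left)
    moreover have "1/2 * cos (A + B) + 1/2 * cos (A - B) = cos A * cos B" for A B :: real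
      by (simp add: cos_add cos_diff field_simps)
    ultimately show ?case by (intro tp_cong[OF a]) (simp only:)
  next
    case (tp_add f g)
    then show ?case using tp.tp_add by (fastforce simp: algebra_simps)
  next
    case (tp_cmult f d)
    then show ?case using tp.tp_cmult[OF tp_cmult(2), of d] by (simp add: algebra_simps)
  qed
next
  case (tp_add f g)
  then show ?case using tp.tp_add by (fastforce simp: algebra_simps)
next
  case (tp_cmult f d)
  then show ?case using tp.tp_cmult[OF tp_cmult(2), of d] by (simp add: algebra_simps)
qed

lemma tp_poly: assumes "tp L f" "0 \<le> L" shows "tp (real (degree p) * L) (\<lambda>x. poly p (f x))"
proof (induction p)
  case 0 then show ?case by (simp add: tp_const)
next
  case (pCons a p)
  show ?case
  proof (cases "p = 0")
    case False
    have "tp (L + real (degree p) * L) (\<lambda>x. a + f x * poly p (f x))"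
      using assms pCons by (intro tp_add tp_const tp_mult) auto
    then show ?thesis using False by (simp add: algebra_simps)
  qed (use assms in \<open>simp add: tp_const\<close>)
qed

section \<open>Partial derivatives\<close>

lemma pderiv_atI: "(f has_derivative f') (at x) \<Longrightarrow> pderiv_at i f x = f' (axis i 1)"
  unfolding pderiv_at_def by (metis frechet_derivative_at)

lemma pderiv_at_cos:
  "pderiv_at i (\<lambda>x. cos (k \<bullet> x + c)) x = - k $ i * sin (k \<bullet> x + c)"
proof -
  have "((\<lambda>x. cos (k \<bullet> x + c)) has_derivative (\<lambda>h. - sin (k \<bullet> x + c) * (k \<bullet> h))) (at x)"
    by (auto intro!: derivative_eq_intros simp: algebra_simps)
  from pderiv_atI[OF this] show ?thesis by (simp add: inner_axis)
qed

lemma pderiv_at_sin: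
  "pderiv_at i (\<lambda>x. sin (k \<bullet> x + c)) x = k $ i * cos (k \<bullet> x + c)"
proof -
  have "((\<lambda>x. sin (k \<bullet> x + c)) has_derivative (\<lambda>h. cos (k \<bullet> x + c) * (k \<bullet> h))) (at x)"
    by (auto intro!: derivative_eq_intros simp: algebra_simps)
  from pderiv_atI[OF this] show ?thesis by (simp add: inner_axis)
qed

lemma diff_has_frechet: "f differentiable (at x) \<Longrightarrow> (f has_derivative frechet_derivative f (at x)) (at x)"
  by (simp add: frechet_derivative_works)

lemma pderiv_at_add:
  "f differentiable (at x) \<Longrightarrow> g differentiable (at x) \<Longrightarrow>
   pderiv_at i (\<lambda>x. f x + g x) x = pderiv_at i f x + pderiv_at i g x"
  by (drule diff_has_frechet, drule diff_has_frechet)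
    (subst pderiv_atI[OF has_derivative_add], auto simp: pderiv_at_def)

lemma pderiv_at_diff:
  "f differentiable (at x) \<Longrightarrow> g differentiable (at x) \<Longrightarrow>
   pderiv_at i (\<lambda>x. f x - g x) x = pderiv_at i f x - pderiv_at i g x"
  by (drule diff_has_frechet, drule diff_has_frechet)
    (subst pderiv_atI[OF has_derivative_diff], auto simp: pderiv_at_def)

lemma pderiv_at_mult:
  fixes f g :: "real^'n::finite \<Rightarrow> real"
  shows "f differentiable (at x) \<Longrightarrow> g differentiable (at x) \<Longrightarrow>
   pderiv_at i (\<lambda>x. f x * g x) x = f x * pderiv_at i g x + pderiv_at i f x * g x"
  by (drule diff_has_frechet, drule diff_has_frechet)
    (subst pderiv_atI[OF has_derivative_mult], auto simp: pderiv_at_def)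

lemma pderiv_at_const: "pderiv_at i (\<lambda>x. c) x = 0"
  by (subst pderiv_atI[OF has_derivative_const]) auto

lemma pderiv_at_cmult:
  fixes f :: "real^'n::finite \<Rightarrow> real"
  shows "f differentiable (at x) \<Longrightarrow> pderiv_at i (\<lambda>x. c * f x) x = c * pderiv_at i f x"
  by (simp add: pderiv_at_mult pderiv_at_const)

lemma tp_differentiable: "tp L f \<Longrightarrow> f differentiable (at x)"
proof (induction rule: tp.induct)
  case (tp_cos k c)
  have "((\<lambda>x. cos (k \<bullet> x + c)) has_derivative (\<lambda>h. - sin (k \<bullet> x + c) * (k \<bullet> h))) (at x)"
    by (auto intro!: derivative_eq_intros simp: algebra_simps)
  then show ?case unfolding differentiable_def by blast
qed auto

lemma tp_pderiv: "tp L f \<Longrightarrow> tp L (pderiv_at i f)"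
proof (induction rule: tp.induct)
  case (tp_cos k c)
  show ?case using tp_cmult[OF tp_sin, of k L "- k $ i" c] tp_cos by (simp add: pderiv_at_cos[abs_def])
next
  case (tp_add f g)
  then have "pderiv_at i (\<lambda>x. f x + g x) = (\<lambda>x. pderiv_at i f x + pderiv_at i g x)"
    by (auto intro!: pderiv_at_add tp_differentiable)
  with tp_add show ?case by (simp add: tp.tp_add)
next
  case (tp_cmult f c)
  then have "pderiv_at i (\<lambda>x. c * f x) = (\<lambda>x. c * pderiv_at i f x)"
    by (auto intro!: pderiv_at_cmult tp_differentiable)
  with tp_cmult show ?case by (simp add: tp.tp_cmult)
qed

text \<open>Explicit on a cosine, where the factors \<open>k $ i\<close> and \<open>k $ j\<close>
  commute; linearity does the rest.\<close>

lemma tp_pderiv_commute: "tp L f \<Longrightarrow> pderiv_at i (pderiv_at j f) x = pderiv_at j (pderiv_at i f) x"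
proof (induction arbitrary: x rule: tp.induct)
  case (tp_cos k c)
  have d: "(\<lambda>x. sin (k \<bullet> x + c)) differentiable (at x)" for x
    by (rule tp_differentiable, rule tp_sin[of k L]) (use tp_cos in auto)
  have "pderiv_at i (\<lambda>x. - k $ j * sin (k \<bullet> x + c)) x = - k $ j * (k $ i * cos (k \<bullet> x + c))" for i j
    using pderiv_at_cmult[OF d, of i "- k $ j"] by (simp only: pderiv_at_sin)
  note e = this
  show ?case unfolding pderiv_at_cos[abs_def] e by simp
next
  case (tp_add f g)
  then have "pderiv_at i (\<lambda>x. f x + g x) = (\<lambda>x. pderiv_at i f x + pderiv_at i g x)" for i
    by (auto intro!: pderiv_at_add tp_differentiable)
  with tp_add show ?case by (simp add: pderiv_at_add tp_differentiable[OF tp_pderiv])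
next
  case (tp_cmult f c)
  then have "pderiv_at i (\<lambda>x. c * f x) = (\<lambda>x. c * pderiv_at i f x)" for i
    by (auto intro!: pderiv_at_cmult tp_differentiable)
  with tp_cmult show ?case by (simp add: pderiv_at_cmult tp_differentiable[OF tp_pderiv])
qed

lemma frechet_pderiv: assumes "f differentiable (at x)"
  shows "(f has_derivative (\<lambda>h. \<Sum>i\<in>UNIV. h $ i *\<^sub>R pderiv_at i f x)) (at x)"
proof -
  let ?D = "frechet_derivative f (at x)"
  have D: "(f has_derivative ?D) (at x)" using assms by (simp add: frechet_derivative_works)
  then have l: "linear ?D" by (simp add: has_derivative_linear)
  have "?D h = (\<Sum>i\<in>UNIV. h $ i *\<^sub>R pderiv_at i f x)" for h
  proof -
    have "?D h = ?D (\<Sum>i\<in>UNIV. h $ i *\<^sub>R axis i 1)" by (simp add: basis_expansion flip: scalar_mult_eq_scaleR)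
    also have "\<dots> = (\<Sum>i\<in>UNIV. h $ i *\<^sub>R ?D (axis i 1))" using l by (simp add: linear_sum linear_scale)
    finally show ?thesis by (simp add: pderiv_at_def)
  qed
  then have "?D = (\<lambda>h. \<Sum>i\<in>UNIV. h $ i *\<^sub>R pderiv_at i f x)" by auto
  with D show ?thesis by simp
qed

section \<open>Bernstein's inequality\<close>

text \<open>Orthogonality of characters: the sum is the real part of a geometric sum of powers of
  \<open>cis (2 * pi * m / N)\<close>, an N-th root of unity that differs from 1 for
  \<open>0 < \<bar>m\<bar> < N\<close>.\<close>

lemma sum_cos_equidistant:
  assumes N: "0 < N" and m: "\<bar>m\<bar> < int N"
  shows "(\<Sum>j<N. cos (of_int m * (2 * pi * real j / real N) + \<theta>)) = (if m = 0 then real N * cos \<theta> else 0)"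
proof (cases "m = 0")
  case False
  define w where "w = cis (of_int m * (2 * pi / real N))"
  have "w \<noteq> 1"
  proof
    assume "w = 1"
    then have "cos (of_int m * (2 * pi / real N)) = 1" by (simp add: w_def complex_eq_iff)
    then obtain n :: int where "of_int m * (2 * pi / real N) = of_int n * 2 * pi"
      by (auto simp: cos_one_2pi_int)
    then have "real_of_int m = of_int (n * int N)" using N by (simp add: field_simps)
    then have "m = n * int N" by linarith
    then have "int N dvd m" by simp
    with False m show False using dvd_imp_le_int[of m "int N"] by simp
  qed
  have "real N * (of_int m * (2 * pi / real N)) = 2 * pi * of_int m" using N by simp
  then have "w ^ N = cis (2 * pi * of_int m)" unfolding w_def Complex.DeMoivre by (simp only:)
  then have "w ^ N = 1" by (simp add: cis_multiple_2pi)
  then have "(\<Sum>j<N. w ^ j) = 0" using \<open>w \<noteq> 1\<close> by (simp add: sum_gp_strict)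
  then have "Re (\<Sum>j<N. w ^ j * cis \<theta>) = 0" by (simp flip: sum_distrib_right)
  moreover have "Re (w ^ j * cis \<theta>) = cos (of_int m * (2 * pi * real j / real N) + \<theta>)" for j
    by (simp add: w_def Complex.DeMoivre cis_mult algebra_simps)
  ultimately show ?thesis using False by simp
qed simp

lemma sum_sin_equidistant:
  assumes "0 < N" "\<bar>m\<bar> < int N"
  shows "(\<Sum>j<N. sin (of_int m * (2 * pi * real j / real N) + \<theta>)) = (if m = 0 then real N * sin \<theta> else 0)"
  using sum_cos_equidistant[OF assms, of "\<theta> - pi / 2"] by (simp add: cos_diff add_diff_eq)

text \<open>The kernel \<open>2 sin (n t) fejer n t\<close> reproduces the derivative on frequencies up to \<open>n\<close>, and its
  mass is at most \<open>2 n\<close>; sampling at \<open>3 n\<close> points is exact.\<close>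

definition fejer :: "nat \<Rightarrow> real \<Rightarrow> real"
  where "fejer n t = (\<Sum>a<n. \<Sum>b<n. cos ((real a - real b) * t))"

text \<open>The double sum is the squared modulus of the sum of \<open>s a * cis (a * t)\<close>,
  split into real and imaginary part. It makes both kernels below nonnegative.\<close>

lemma sum_sum_cos_diff:
  "(\<Sum>a<(n::nat). \<Sum>b<n. s a * s b * cos ((real a - real b) * t)) =
   (\<Sum>a<n. s a * cos (real a * t))\<^sup>2 + (\<Sum>a<n. s a * sin (real a * t))\<^sup>2"
  by (simp add: power2_eq_square sum_product left_diff_distrib cos_diff distrib_left
      algebra_simps sum.distrib)

lemma fejer_nonneg: "0 \<le> fejer n t"
  using sum_sum_cos_diff[of "\<lambda>_. 1" t n] by (simp add: fejer_def)

text \<open>These counts are the Fourier coefficients of the Fejer kernel, a triangle of height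
  \<open>n\<close>.\<close>

lemma count_diff:
  fixes j :: int assumes "0 \<le> j"
  shows "(\<Sum>a<n. \<Sum>b<n. if int b - int a = j then 1 else 0 :: real) = max 0 (real n - of_int j)"
proof -
  obtain i where i: "j = int i" using assms nonneg_int_cases by blast
  have "(\<Sum>b<n. if int b - int a = j then 1 else 0 :: real) = (if a + i < n then 1 else 0)" for a
  proof -
    have "(int b - int a = j) = (b = a + i)" for b using i by auto
    then show ?thesis by simp
  qed
  then have "(\<Sum>a<n. \<Sum>b<n. if int b - int a = j then 1 else 0 :: real) = (\<Sum>a<n. if a + i < n then 1 else 0)"
    by simp
  also have "\<dots> = real (card {a. a < n \<and> a + i < n})" by (simp flip: sum.inter_filter)
  also have "{a. a < n \<and> a + i < n} = {..<n - i}" by auto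
  finally show ?thesis using i by (simp add: of_nat_diff max_def)
qed

definition bernstein_weight :: "nat \<Rightarrow> nat \<Rightarrow> real"
  where "bernstein_weight n j =
    2 * sin (real n * (2 * pi * real j / real (3*n))) * fejer n (2 * pi * real j / real (3*n)) / real (3*n)"

lemma sum_swap3:
  "(\<Sum>j\<in>J. \<Sum>a\<in>A. \<Sum>b\<in>B. g j a b) = (\<Sum>a\<in>A. \<Sum>b\<in>B. \<Sum>j\<in>J. g j a b)"
  by (subst sum.swap) (intro sum.cong refl sum.swap)

lemma sum_fejer_equidistant:
  assumes "0 < n" shows "(\<Sum>j<3*n. fejer n (2 * pi * real j / real (3*n))) = real (3*n) * real n"
proof -
  have "(\<Sum>j<3*n. cos ((real a - real b) * (2 * pi * real j / real (3*n)))) = (if a = b then real (3*n) else 0)"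
    if "a < n" "b < n" for a b
    using sum_cos_equidistant[of "3*n" "int a - int b" 0] assms that by simp
  then have "(\<Sum>a<n. \<Sum>b<n. \<Sum>j<3*n. cos ((real a - real b) * (2 * pi * real j / real (3*n)))) =
    (\<Sum>a<n. \<Sum>b<n. if a = b then real (3*n) else 0)"
    by (intro sum.cong) auto
  also have "\<dots> = real (3*n) * real n" by simp
  finally show ?thesis
    unfolding fejer_def by (subst sum_swap3)
qed

lemma sum_bernstein_weight: assumes "0 < n" shows "(\<Sum>j<3*n. \<bar>bernstein_weight n j\<bar>) \<le> 2 * real n"
proof -
  have "\<bar>bernstein_weight n j\<bar> \<le> 2 * fejer n (2 * pi * real j / real (3*n)) / real (3*n)" for j
  proof -
    have "\<bar>bernstein_weight n j\<bar> = 2 * (\<bar>sin (real n * (2 * pi * real j / real (3*n)))\<bar> * fejer n (2 * pi * real j / real (3*n))) / real (3*n)"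
      unfolding bernstein_weight_def abs_divide abs_mult using fejer_nonneg[of n] by simp
    also have "\<dots> \<le> 2 * (1 * fejer n (2 * pi * real j / real (3*n))) / real (3*n)"
      by (intro divide_right_mono mult_left_mono mult_right_mono abs_sin_le_one fejer_nonneg) auto
    finally show ?thesis by simp
  qed
  then have "(\<Sum>j<3*n. \<bar>bernstein_weight n j\<bar>) \<le> (\<Sum>j<3*n. 2 * fejer n (2 * pi * real j / real (3*n)) / real (3*n))"
    by (intro sum_mono) auto
  also have "\<dots> = 2 * (\<Sum>j<3*n. fejer n (2 * pi * real j / real (3*n))) / real (3*n)"
    by (simp add: sum_distrib_left sum_divide_distrib)
  also have "\<dots> = 2 * real n" using assms by (subst sum_fejer_equidistant) auto
  finally show ?thesis .
qed

text \<open>The right-hand side is the derivative of \<open>cos (k * t + \<theta>)\<close> at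
  \<open>t = 0\<close>. The factor \<open>2 * sin (n * t)\<close> moves the triangular spectrum of
  the Fejer kernel to the centres \<open>n\<close> and \<open>-n\<close>; at frequency
  \<open>k\<close> the two triangles contribute \<open>max 0 (- k) - max 0 k = - k\<close>.\<close>

lemma bernstein_weight_cos:
  assumes n: "0 < n" and k: "\<bar>k\<bar> \<le> int n"
  shows "(\<Sum>j<3*n. bernstein_weight n j * cos (of_int k * (2 * pi * real j / real (3*n)) + \<theta>)) = - of_int k * sin \<theta>"
proof -
  define N where "N = 3 * n"
  define t where "t j = 2 * pi * real j / real N" for j
  have N: "0 < N" using n by (simp add: N_def)
  let ?T = "\<lambda>a b j. 2 * sin (real n * t j) * cos ((real a - real b) * t j) * cos (of_int k * t j + \<theta>)"
  let ?I = "\<lambda>a b. ((if int b - int a = int n + k then 1 else 0) + (if int a - int b = int n + k then 1 else 0)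
      - (if int b - int a = int n - k then 1 else 0) - (if int a - int b = int n - k then 1 else 0))"
  let ?S = "\<lambda>m \<theta>. (\<Sum>j<N. sin (of_int m * t j + \<theta>))"
  have S: "?S m \<theta> = (if m = 0 then real N * sin \<theta> else 0)" if "\<bar>m\<bar> < int N" for m \<theta>
    using sum_sin_equidistant[OF N that, of \<theta>] by (simp add: t_def)
  have tri: "2 * sin A * cos D * cos C = (sin (A + D + C) + sin (A - D + C) + sin (A + D - C) + sin (A - D - C)) / 2"
    for A D C :: real
    by (simp add: sin_add sin_diff cos_add cos_diff field_simps)
  have avg: "(\<Sum>j<N. ?T a b j) =
     real N * sin \<theta> / 2 * ?I a b"
    if ab: "a < n" "b < n" for a b
  proof -
    let ?d = "int a - int b"
    have "?T a b j =
      (sin (of_int (int n + ?d + k) * t j + \<theta>) + sin (of_int (int n - ?d + k) * t j + \<theta>)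
      + sin (of_int (int n + ?d - k) * t j + - \<theta>) + sin (of_int (int n - ?d - k) * t j + - \<theta>)) / 2" for j
      unfolding tri by (simp add: algebra_simps)
    then have "(\<Sum>j<N. ?T a b j) =
      (?S (int n + ?d + k) \<theta> + ?S (int n - ?d + k) \<theta> + ?S (int n + ?d - k) (- \<theta>) + ?S (int n - ?d - k) (-\<theta>)) / 2"
      by (simp add: sum.distrib sum_divide_distrib add_divide_distrib)
    also have "\<dots> = (((if int n + ?d + k = 0 then real N * sin \<theta> else 0)) + (if int n - ?d + k = 0 then real N * sin \<theta> else 0)
      + (if int n + ?d - k = 0 then real N * sin (-\<theta>) else 0) + (if int n - ?d - k = 0 then real N * sin (-\<theta>) else 0)) / 2"
    proof -
      \<comment> \<open>The frequencies add up to at most \<open>n + (n - 1) + n\<close>, just below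
        the number \<open>3 * n\<close> of nodes.\<close>
      have "\<bar>int n + ?d + k\<bar> < int N" "\<bar>int n - ?d + k\<bar> < int N" "\<bar>int n + ?d - k\<bar> < int N" "\<bar>int n - ?d - k\<bar> < int N"
        using ab k by (auto simp: N_def)
      then show ?thesis by (simp only: S)
    qed
    also have "\<dots> = real N * sin \<theta> / 2 * ?I a b"
    proof -
      have e: "(int n + ?d + k = 0) = (int b - int a = int n + k)" "(int n - ?d + k = 0) = (int a - int b = int n + k)"
        "(int n + ?d - k = 0) = (int b - int a = int n - k)" "(int n - ?d - k = 0) = (int a - int b = int n - k)"
        by linarith+
      show ?thesis unfolding e by (simp add: algebra_simps)
    qed
    finally show ?thesis .
  qed
  let ?c = "\<lambda>j. (\<Sum>a<n. \<Sum>b<n. if int b - int a = j then 1 else 0 :: real)"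
  have sw: "(\<Sum>a<n. \<Sum>b<n. if int a - int b = j then 1 else 0 :: real) = ?c j" for j
    by (rule sum.swap)
  have "(\<Sum>j<N. bernstein_weight n j * cos (of_int k * t j + \<theta>)) =
    (\<Sum>j<N. \<Sum>a<n. \<Sum>b<n. ?T a b j) / real N"
    unfolding sum_divide_distrib bernstein_weight_def fejer_def N_def[symmetric] t_def[symmetric]
    by (simp add: sum_distrib_left sum_distrib_right sum_divide_distrib)
  also have "(\<Sum>j<N. \<Sum>a<n. \<Sum>b<n. ?T a b j) =
    (\<Sum>a<n. \<Sum>b<n. \<Sum>j<N. ?T a b j)"
    by (rule sum_swap3)
  also have "\<dots> = (\<Sum>a<n. \<Sum>b<n. real N * sin \<theta> / 2 * ?I a b)"
    using avg by (intro sum.cong) auto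
  also have "\<dots> = real N * sin \<theta> / 2 * (?c (int n + k) + ?c (int n + k) - ?c (int n - k) - ?c (int n - k))"
    unfolding sum_distrib_left[symmetric] sum_subtractf sum.distrib sw ..
  also have "\<dots> = real N * sin \<theta> * (?c (int n + k) - ?c (int n - k))" by simp
  also have "?c (int n + k) - ?c (int n - k) = - of_int k"
    using k by (subst (1 2) count_diff) auto
  finally show ?thesis using N by (simp add: N_def t_def)
qed

text \<open>On degree at most \<open>n\<close> the derivative is a fixed finite combination of
  translates, so its sup norm is controlled by the sum of the absolute weights.\<close>

lemma pderiv_at_bernstein:
  assumes "tp (real n) f" and n: "0 < n"
  shows "pderiv_at i f x =
    (\<Sum>j<3*n. bernstein_weight n j * f (x + (2 * pi * real j / real (3*n)) *\<^sub>R axis i 1))"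
  using assms(1)
proof induction
  case (tp_cos k c)
  from tp_cos[of i] obtain m where m: "k $ i = of_int m" by (auto elim: Ints_cases)
  then have "\<bar>m\<bar> \<le> int n" using tp_cos[of i] by auto
  from bernstein_weight_cos[OF n this, of "k \<bullet> x + c"] show ?case
    unfolding pderiv_at_cos by (simp add: inner_add_right inner_axis m algebra_simps)
next
  case (tp_add f g)
  then show ?case by (simp add: pderiv_at_add tp_differentiable sum.distrib algebra_simps)
next
  case (tp_cmult f c)
  then show ?case by (simp add: pderiv_at_cmult tp_differentiable sum_distrib_left algebra_simps)
qed

text \<open>Degree bounds are real numbers because they arise as products such as
  \<open>Md * N\<close>; the Bernstein kernel has a natural index. Integrality of the frequencies
  allows rounding down.\<close>

lemma tp_floor: "tp L f \<Longrightarrow> tp (of_int \<lfloor>L\<rfloor>) f"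
proof (induction rule: tp.induct)
  case (tp_cos k c)
  show ?case
  proof (rule tp.tp_cos)
    fix i
    from tp_cos[of i] obtain m where m: "k $ i = of_int m" by (auto elim: Ints_cases)
    with tp_cos[of i] have "\<bar>m\<bar> \<le> \<lfloor>L\<rfloor>" by (simp add: le_floor_iff)
    with m show "k $ i \<in> \<int> \<and> \<bar>k $ i\<bar> \<le> of_int \<lfloor>L\<rfloor>" by (metis Ints_of_int of_int_abs of_int_le_iff)
  qed
qed (auto intro: tp.intros)

theorem bernstein:
  assumes f: "tp L f" and L: "1 \<le> L" and B: "\<And>x. \<bar>f x\<bar> \<le> B"
  shows "\<bar>pderiv_at i f x\<bar> \<le> 2 * L * B"
proof -
  define n where "n = nat \<lfloor>L\<rfloor>"
  have n: "0 < n" "real n \<le> L" using L by (auto simp: n_def le_floor_iff)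
  have t: "tp (real n) f" using tp_floor[OF f] L by (simp add: n_def)
  have B0: "0 \<le> B" using B[of 0] by linarith
  have "\<bar>pderiv_at i f x\<bar> \<le> (\<Sum>j<3*n. \<bar>bernstein_weight n j * f (x + (2 * pi * real j / real (3*n)) *\<^sub>R axis i 1)\<bar>)"
    unfolding pderiv_at_bernstein[OF t n(1)] by (rule sum_abs)
  also have "\<dots> \<le> (\<Sum>j<3*n. \<bar>bernstein_weight n j\<bar> * B)"
    by (intro sum_mono) (auto simp: abs_mult intro!: mult_left_mono B)
  also have "\<dots> \<le> 2 * real n * B"
    unfolding sum_distrib_right[symmetric] using sum_bernstein_weight[OF n(1)] B0 by (rule mult_right_mono)
  also have "\<dots> \<le> 2 * L * B" using n(2) B0 by (intro mult_right_mono) auto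
  finally show ?thesis .
qed

section \<open>Jackson approximation\<close>

lemma one_minus_cos_le: "1 - cos (x::real) \<le> x\<^sup>2 / 2"
proof -
  have "(sin (x/2))\<^sup>2 \<le> (x/2)\<^sup>2" using abs_sin_x_le_abs_x[of "x/2"] by (metis abs_le_square_iff)
  moreover have "cos x = 1 - 2 * (sin (x/2))\<^sup>2" using cos_double_sin[of "x/2"] by simp
  ultimately show ?thesis by (simp add: power_divide)
qed

text \<open>The Fejer-Korovkin weights: \<open>s\<^sub>a\<^sub>+\<^sub>1 + s\<^sub>a\<^sub>-\<^sub>1 = 2 cos h s\<^sub>a\<close> makes the first Fourier coefficient of the
  kernel equal to \<open>cos h\<close>, hence its second moment of order \<open>1/n\<^sup>2\<close>.\<close>

definition fk_angle :: "nat \<Rightarrow> real" where "fk_angle n = pi / real (n + 1)"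

definition fk_coeff :: "nat \<Rightarrow> nat \<Rightarrow> real" where "fk_coeff n a = sin (real (a + 1) * fk_angle n)"

definition fk_kernel :: "nat \<Rightarrow> real \<Rightarrow> real" where
  "fk_kernel n t = (\<Sum>a<n. \<Sum>b<n. fk_coeff n a * fk_coeff n b * cos ((real a - real b) * t)) / (\<Sum>a<n. (fk_coeff n a)\<^sup>2)"

definition fk_node :: "nat \<Rightarrow> nat \<Rightarrow> real" where "fk_node n j = 2 * pi * real j / real (2 * n)"

lemma fk_coeff_sum_pos: assumes "0 < n" shows "0 < (\<Sum>a<n. (fk_coeff n a)\<^sup>2)"
proof -
  have "0 < fk_coeff n 0" unfolding fk_coeff_def fk_angle_def
    by (rule sin_gt_zero) (use assms in \<open>auto simp: field_simps\<close>)
  then have "0 < (fk_coeff n 0)\<^sup>2" by simp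
  also have "\<dots> \<le> (\<Sum>a<n. (fk_coeff n a)\<^sup>2)" using assms by (intro member_le_sum) auto
  finally show ?thesis .
qed

lemma fk_kernel_nonneg: "0 \<le> fk_kernel n t"
  unfolding fk_kernel_def sum_sum_cos_diff by (intro divide_nonneg_nonneg sum_nonneg) auto

text \<open>Only differences below \<open>n\<close> occur as frequencies, so averaging over
  \<open>2 * n\<close> nodes is exact and leaves the diagonal \<open>a = b\<close>, which the
  normalization cancels. The point \<open>x\<close> enters only as a phase.\<close>

lemma fk_kernel_mean:
  assumes n: "0 < n" shows "(\<Sum>j<2*n. fk_kernel n (x - fk_node n j)) = real (2*n)"
proof -
  let ?A = "\<Sum>a<n. (fk_coeff n a)\<^sup>2"
  have "(\<Sum>j<2*n. cos ((real a - real b) * (x - fk_node n j))) = (if b = a then real (2*n) else 0)"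
    if "a < n" "b < n" for a b
  proof -
    have "(real a - real b) * (x - fk_node n j) =
       of_int (int b - int a) * (2 * pi * real j / real (2*n)) + (real a - real b) * x" for j
      by (simp add: fk_node_def algebra_simps add_divide_distrib diff_divide_distrib)
    then show ?thesis
      using sum_cos_equidistant[of "2*n" "int b - int a" "(real a - real b) * x"] n that by simp
  qed
  then have "(\<Sum>a<n. \<Sum>b<n. fk_coeff n a * fk_coeff n b * (\<Sum>j<2*n. cos ((real a - real b) * (x - fk_node n j)))) =
    (\<Sum>a<n. \<Sum>b<n. if b = a then fk_coeff n a * fk_coeff n b * real (2*n) else 0)"
    by (intro sum.cong refl) auto
  also have "\<dots> = ?A * real (2*n)"
    by (simp add: power2_eq_square sum_distrib_right)
  finally have *: "(\<Sum>a<n. \<Sum>b<n. fk_coeff n a * fk_coeff n b * (\<Sum>j<2*n. cos ((real a - real b) * (x - fk_node n j)))) = ?A * real (2*n)" .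
  have "(\<Sum>j<2*n. fk_kernel n (x - fk_node n j)) = (?A * real (2*n)) / ?A"
    unfolding fk_kernel_def sum_divide_distrib[symmetric] sum_swap3[of _ _ _ "{..<2*n}"] *[symmetric] sum_distrib_left ..
  then show ?thesis using fk_coeff_sum_pos[OF n] by simp
qed

lemma fk_kernel_mean_cos:
  assumes n: "0 < n"
  shows "(\<Sum>j<2*n. fk_kernel n (x - fk_node n j) * cos (x - fk_node n j)) = real (2*n) * cos (fk_angle n)"
proof -
  let ?A = "\<Sum>a<n. (fk_coeff n a)\<^sup>2"
  let ?h = "fk_angle n"
  let ?T = "\<lambda>a b j. cos ((real a - real b) * (x - fk_node n j)) * cos (x - fk_node n j)"
  let ?\<delta> = "\<lambda>a b. ((if b = a + 1 then 1 else 0) + (if a = b + 1 then 1 else 0))"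
  let ?d = "\<lambda>a b. fk_coeff n a * fk_coeff n b"
  have avg: "(\<Sum>j<2*n. ?T a b j) =
     real (2*n) / 2 * ?\<delta> a b"
    if ab: "a < n" "b < n" for a b
  proof -
    let ?m1 = "int b - int a - 1" and ?m2 = "int b - int a + 1"
    have "?T a b j =
       (cos (of_int ?m1 * (2 * pi * real j / real (2*n)) + (real a - real b + 1) * x) +
        cos (of_int ?m2 * (2 * pi * real j / real (2*n)) + (real a - real b - 1) * x)) / 2" for j
    proof -
      have "of_int ?m1 * (2 * pi * real j / real (2*n)) + (real a - real b + 1) * x = (real a - real b) * (x - fk_node n j) + (x - fk_node n j)"
        "of_int ?m2 * (2 * pi * real j / real (2*n)) + (real a - real b - 1) * x = (real a - real b) * (x - fk_node n j) - (x - fk_node n j)"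
        by (simp_all add: fk_node_def algebra_simps add_divide_distrib diff_divide_distrib)
      then show ?thesis by (simp only: cos_add[of _ "x - fk_node n j"] cos_diff[of _ "x - fk_node n j"]) simp
    qed
    then have "(\<Sum>j<2*n. ?T a b j) =
      ((\<Sum>j<2*n. cos (of_int ?m1 * (2 * pi * real j / real (2*n)) + (real a - real b + 1) * x)) +
      (\<Sum>j<2*n. cos (of_int ?m2 * (2 * pi * real j / real (2*n)) + (real a - real b - 1) * x))) / 2"
      by (simp only: sum.distrib sum_divide_distrib[symmetric])
    also have "\<dots> = ((if ?m1 = 0 then real (2*n) * cos ((real a - real b + 1) * x) else 0) +
       (if ?m2 = 0 then real (2*n) * cos ((real a - real b - 1) * x) else 0)) / 2"
      using ab n by (subst (1 2) sum_cos_equidistant) auto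
    also have "\<dots> = real (2*n) / 2 * ?\<delta> a b"
    proof -
      have "(?m1 = 0) = (b = a + 1)" "(?m2 = 0) = (a = b + 1)" by auto
      then show ?thesis by auto
    qed
    finally show ?thesis .
  qed
  \<comment> \<open>\<open>fk_coeff n\<close> is an eigenvector, for the eigenvalue
    \<open>2 * cos h\<close>, of the adjacency matrix of the path with \<open>n\<close> vertices.
    The missing neighbours at both ends would have the values \<open>sin 0\<close> and
    \<open>sin pi\<close>, so they do no harm.\<close>
  have row: "(\<Sum>b<n. fk_coeff n b * ?\<delta> a b) =
     2 * cos ?h * fk_coeff n a" if "a < n" for a
  proof -
    have 1: "(\<Sum>b<n. fk_coeff n b * (if b = a + 1 then 1 else 0)) = fk_coeff n (a + 1)"
    proof (cases "a + 1 < n")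
      case False
      with that have "a + 1 = n" by simp
      then have "real (a + 1 + 1) * ?h = pi" by (simp add: fk_angle_def)
      then have "fk_coeff n (a + 1) = 0" unfolding fk_coeff_def by simp
      then show ?thesis using False by (simp add: if_distrib cong: if_cong)
    qed (simp add: if_distrib cong: if_cong)
    have 2: "(\<Sum>b<n. fk_coeff n b * (if a = b + 1 then 1 else 0)) = sin (real a * ?h)"
    proof (cases a)
      case (Suc a')
      then have "(a = b + 1) = (b = a')" for b by auto
      then show ?thesis using Suc that by (simp add: if_distrib fk_coeff_def cong: if_cong)
    qed simp
    have "sin (real (a + 1 + 1) * ?h) + sin (real a * ?h) = 2 * cos ?h * sin (real (a + 1) * ?h)"
    proof -
      have "real (a + 1 + 1) * ?h = real (a + 1) * ?h + ?h" "real a * ?h = real (a + 1) * ?h - ?h"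
        by (simp_all add: algebra_simps)
      then show ?thesis by (simp only: sin_add[of _ ?h] sin_diff[of _ ?h]) simp
    qed
    with 1 2 show ?thesis by (simp only: distrib_left sum.distrib fk_coeff_def)
  qed
  have "(\<Sum>a<n. \<Sum>b<n. ?d a b * (\<Sum>j<2*n. ?T a b j)) =
    (\<Sum>a<n. \<Sum>b<n. ?d a b * (real (2*n) / 2 * ?\<delta> a b))"
    using avg by (intro sum.cong refl) simp
  also have "\<dots> = real (2*n) / 2 * (\<Sum>a<n. fk_coeff n a * (\<Sum>b<n. fk_coeff n b * ?\<delta> a b))"
    unfolding sum_distrib_left by (intro sum.cong refl) (simp only: mult_ac)
  also have "\<dots> = real (2*n) / 2 * (\<Sum>a<n. fk_coeff n a * (2 * cos ?h * fk_coeff n a))"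
    using row by simp
  also have "\<dots> = ?A * (real (2*n) * cos ?h)"
    unfolding sum_distrib_left sum_distrib_right by (intro sum.cong refl) (simp add: power2_eq_square)
  finally have *: "(\<Sum>a<n. \<Sum>b<n. ?d a b * (\<Sum>j<2*n. ?T a b j))
     = ?A * (real (2*n) * cos ?h)" .
  have "(\<Sum>j<2*n. fk_kernel n (x - fk_node n j) * cos (x - fk_node n j)) =
    (\<Sum>j<2*n. \<Sum>a<n. \<Sum>b<n. ?d a b * (?T a b j)) / ?A"
    unfolding fk_kernel_def times_divide_eq_left sum_divide_distrib[symmetric] sum_distrib_right mult.assoc ..
  also have "(\<Sum>j<2*n. \<Sum>a<n. \<Sum>b<n. ?d a b * (?T a b j)) =
    ?A * (real (2*n) * cos ?h)"
    unfolding sum_swap3[of _ _ _ "{..<2*n}"] *[symmetric] sum_distrib_left ..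
  finally have "(\<Sum>j<2*n. fk_kernel n (x - fk_node n j) * cos (x - fk_node n j)) = (?A * (real (2*n) * cos ?h)) / ?A" .
  then show ?thesis using fk_coeff_sum_pos[OF n] by simp
qed

section \<open>Jackson operators on the two-dimensional torus\<close>

definition fk_grid :: "nat \<Rightarrow> (nat \<times> nat) set" where "fk_grid n = {..<2*n} \<times> {..<2*n}"

definition fk_point :: "nat \<Rightarrow> nat \<times> nat \<Rightarrow> real^2" where
  "fk_point n p = vector [fk_node n (fst p), fk_node n (snd p)]"

definition fk_weight :: "nat \<Rightarrow> nat \<times> nat \<Rightarrow> real^2 \<Rightarrow> real" where
  "fk_weight n p x = fk_kernel n (x $ 1 - fk_node n (fst p)) * fk_kernel n (x $ 2 - fk_node n (snd p)) / (real (2*n))\<^sup>2"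

text \<open>The coefficients are free instead of being the node values of a function. This lets
  rational coefficients be inserted later to obtain a countable family.\<close>

definition jackson :: "nat \<Rightarrow> (nat \<times> nat \<Rightarrow> real) \<Rightarrow> real^2 \<Rightarrow> real" where
  "jackson n c x = (\<Sum>p\<in>fk_grid n. c p * fk_weight n p x)"

text \<open>The squared chordal distance of the points \<open>(cis x1, cis x2)\<close> and
  \<open>(cis y1, cis y2)\<close>. It is periodic, and being a trigonometric polynomial itself it
  can be averaged exactly against the kernel.\<close>

definition chord2 :: "real^2 \<Rightarrow> real^2 \<Rightarrow> real" where
  "chord2 x y = (2 - 2 * cos (x $ 1 - y $ 1)) + (2 - 2 * cos (x $ 2 - y $ 2))"

lemma fk_weight_nonneg: "0 \<le> fk_weight n p x"
  by (simp add: fk_weight_def fk_kernel_nonneg)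

lemma fk_weight_product:
  assumes "0 < n"
  shows "(\<Sum>p\<in>fk_grid n. fk_weight n p x * (f (fst p) * g (snd p))) =
    ((\<Sum>j<2*n. fk_kernel n (x $ 1 - fk_node n j) * f j) / real (2*n)) *
    ((\<Sum>j<2*n. fk_kernel n (x $ 2 - fk_node n j) * g j) / real (2*n))"
proof -
  have "(\<Sum>p\<in>fk_grid n. fk_weight n p x * (f (fst p) * g (snd p))) =
    (\<Sum>(i,j)\<in>{..<2*n} \<times> {..<2*n}. (fk_kernel n (x $ 1 - fk_node n i) * f i / real (2*n)) * (fk_kernel n (x $ 2 - fk_node n j) * g j / real (2*n)))"
    unfolding fk_grid_def fk_weight_def by (intro sum.cong refl) (auto simp: power2_eq_square)
  then show ?thesis
    unfolding sum.cartesian_product[symmetric] sum_product[symmetric] sum_divide_distrib[symmetric] .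
qed

lemma fk_weight_sum: "0 < n \<Longrightarrow> (\<Sum>p\<in>fk_grid n. fk_weight n p x) = 1"
  using fk_weight_product[of n x "\<lambda>_. 1" "\<lambda>_. 1"] by (simp add: fk_kernel_mean)

text \<open>The mean of \<open>chord2\<close> is \<open>4 * (1 - cos h)\<close>, at most
  \<open>2 * h\<^sup>2\<close> with \<open>h = pi / (n + 1)\<close>; then
  \<open>pi \<le> 3.15\<close> and \<open>3.15\<^sup>2 < 10\<close>.\<close>

lemma fk_weight_chord2:
  assumes n: "0 < n"
  shows "(\<Sum>p\<in>fk_grid n. fk_weight n p x * chord2 x (fk_point n p)) \<le> 20 / (real n)\<^sup>2"
proof -
  let ?h = "fk_angle n"
  have 1: "(\<Sum>p\<in>fk_grid n. fk_weight n p x * (cos (x $ 1 - fk_node n (fst p)) * 1)) = cos ?h"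
    using fk_weight_product[OF n, of x "\<lambda>j. cos (x $ 1 - fk_node n j)" "\<lambda>_. 1"] n
    by (simp add: fk_kernel_mean fk_kernel_mean_cos)
  have 2: "(\<Sum>p\<in>fk_grid n. fk_weight n p x * (1 * cos (x $ 2 - fk_node n (snd p)))) = cos ?h"
    using fk_weight_product[OF n, of x "\<lambda>_. 1" "\<lambda>j. cos (x $ 2 - fk_node n j)"] n
    by (simp add: fk_kernel_mean fk_kernel_mean_cos)
  have "(\<Sum>p\<in>fk_grid n. fk_weight n p x * chord2 x (fk_point n p)) =
     4 * (\<Sum>p\<in>fk_grid n. fk_weight n p x) - 2 * (\<Sum>p\<in>fk_grid n. fk_weight n p x * (cos (x $ 1 - fk_node n (fst p)) * 1))
     - 2 * (\<Sum>p\<in>fk_grid n. fk_weight n p x * (1 * cos (x $ 2 - fk_node n (snd p))))"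
    unfolding sum_distrib_left sum_subtractf[symmetric]
    by (intro sum.cong refl) (simp add: chord2_def fk_point_def algebra_simps)
  also have "\<dots> = 4 * (1 - cos ?h)" unfolding 1 2 fk_weight_sum[OF n] by simp
  also have "\<dots> \<le> 2 * ?h\<^sup>2" using one_minus_cos_le[of ?h] by simp
  also have "\<dots> \<le> 20 / (real n)\<^sup>2"
  proof -
    have "?h \<le> 3.15 / real n"
      unfolding fk_angle_def using n pi_less_4 pi_approx by (intro frac_le) auto
    then have "?h\<^sup>2 \<le> (3.15 / real n)\<^sup>2" by (intro power_mono) (auto simp: fk_angle_def)
    also have "\<dots> = 9.9225 / (real n)\<^sup>2" by (simp add: power_divide power2_eq_square)
    also have "\<dots> \<le> 10 / (real n)\<^sup>2" by (intro divide_right_mono) auto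
    finally show ?thesis by simp
  qed
  finally show ?thesis .
qed

text \<open>A concave power lies below an affine function adapted to the scale
  \<open>\<tau>\<close>. In place of Jensen's inequality, it reduces a Hoelder modulus to the second
  moment of the kernel.\<close>

lemma powr_le_linear:
  assumes "0 \<le> z" "0 < \<tau>" "0 \<le> p" "p \<le> 1"
  shows "z powr p \<le> \<tau> powr p * (1 + z / (\<tau>::real))"
proof -
  have "z powr p = \<tau> powr p * (z / \<tau>) powr p" using assms by (simp add: powr_divide)
  also have "(z / \<tau>) powr p \<le> 1 + z / \<tau>"
  proof (cases "z / \<tau> \<le> 1")
    case True
    then have "(z / \<tau>) powr p \<le> 1" using assms by (intro powr_le1) auto
    then show ?thesis using assms by (simp add: add_increasing2)
  next
    case False
    then have "(z / \<tau>) powr p \<le> (z / \<tau>) powr 1" using assms by (intro powr_mono) auto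
    then show ?thesis using False assms by simp
  qed
  finally show ?thesis by (simp add: mult_left_mono)
qed

lemma chord2_nonneg: "0 \<le> chord2 x y"
  using cos_le_one[of "x $ 1 - y $ 1"] cos_le_one[of "x $ 2 - y $ 2"] unfolding chord2_def by linarith

text \<open>The weights form a partition of unity with second moment at most
  \<open>20 / n\<^sup>2\<close>; the affine majorant at scale \<open>1 / n\<^sup>2\<close> gives 21
  = 1 + 20. The pressure uses \<open>p = \<beta> / 2\<close> and \<open>\<eta> = 0\<close>; merely
  continuous functions use \<open>p = 1\<close> and \<open>\<eta> > 0\<close>. The slack
  \<open>\<theta>\<close> is for rounded coefficients.\<close>

theorem jackson_estimate:
  assumes n: "0 < n" and p: "0 \<le> p" "p \<le> 1" and L: "0 \<le> L"
    and f: "\<And>x y. \<bar>f x - f y\<bar> \<le> \<eta> + L * chord2 x y powr p"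
    and c: "\<And>q. q \<in> fk_grid n \<Longrightarrow> \<bar>c q - f (fk_point n q)\<bar> \<le> \<theta>"
  shows "\<bar>jackson n c x - f x\<bar> \<le> \<theta> + \<eta> + 21 * L * real n powr (- 2 * p)"
proof -
  let ?W = "\<lambda>q. fk_weight n q x" and ?z = "\<lambda>q. chord2 x (fk_point n q)"
  define \<tau> where "\<tau> = 1 / (real n)\<^sup>2"
  have \<tau>: "0 < \<tau>" using n by (simp add: \<tau>_def)
  have "jackson n c x - f x = (\<Sum>q\<in>fk_grid n. (c q - f x) * ?W q)"
    using fk_weight_sum[OF n, of x] by (simp add: jackson_def left_diff_distrib sum_subtractf flip: sum_distrib_left)
  then have "\<bar>jackson n c x - f x\<bar> \<le> (\<Sum>q\<in>fk_grid n. \<bar>(c q - f x) * ?W q\<bar>)" by (simp add: sum_abs)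
  also have "\<dots> \<le> (\<Sum>q\<in>fk_grid n. (\<theta> + \<eta> + L * (\<tau> powr p * (1 + ?z q / \<tau>))) * ?W q)"
  proof (intro sum_mono)
    fix q assume q: "q \<in> fk_grid n"
    have "\<bar>c q - f x\<bar> \<le> \<theta> + (\<eta> + L * ?z q powr p)"
      using c[OF q] f[of x "fk_point n q"] by linarith
    also have "\<dots> \<le> \<theta> + \<eta> + L * (\<tau> powr p * (1 + ?z q / \<tau>))"
      using mult_left_mono[OF powr_le_linear[OF chord2_nonneg \<tau> p] L] by simp
    finally show "\<bar>(c q - f x) * ?W q\<bar> \<le> (\<theta> + \<eta> + L * (\<tau> powr p * (1 + ?z q / \<tau>))) * ?W q"
      by (simp add: abs_mult fk_weight_nonneg mult_right_mono)
  qed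
  also have "\<dots> = (\<theta> + \<eta> + L * \<tau> powr p) * (\<Sum>q\<in>fk_grid n. ?W q) + L * \<tau> powr p / \<tau> * (\<Sum>q\<in>fk_grid n. ?W q * ?z q)"
    unfolding sum_distrib_left sum.distrib[symmetric] by (intro sum.cong refl) (simp add: algebra_simps)
  also have "\<dots> \<le> (\<theta> + \<eta> + L * \<tau> powr p) * 1 + L * \<tau> powr p / \<tau> * (20 * \<tau>)"
    unfolding fk_weight_sum[OF n] using fk_weight_chord2[OF n, of x] \<tau> L
    by (intro add_left_mono mult_left_mono) (auto simp: \<tau>_def)
  also have "\<dots> = \<theta> + \<eta> + 21 * L * \<tau> powr p" using \<tau> by simp
  also have "\<tau> powr p = real n powr (- 2 * p)"
  proof -
    have "\<tau> = real n powr (- 2)" using n by (simp add: \<tau>_def powr_minus_divide flip: powr_numeral)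
    then show ?thesis by (simp add: powr_powr)
  qed
  finally show ?thesis .
qed

lemma jackson_bound:
  assumes "0 < n" "\<And>q. q \<in> fk_grid n \<Longrightarrow> \<bar>c q\<bar> \<le> B"
  shows "\<bar>jackson n c x\<bar> \<le> B"
proof -
  have "\<bar>jackson n c x\<bar> \<le> (\<Sum>q\<in>fk_grid n. \<bar>c q * fk_weight n q x\<bar>)" unfolding jackson_def by (rule sum_abs)
  also have "\<dots> \<le> (\<Sum>q\<in>fk_grid n. B * fk_weight n q x)"
    using assms by (intro sum_mono) (auto simp: abs_mult fk_weight_nonneg intro: mult_right_mono)
  also have "\<dots> = B" using fk_weight_sum[OF assms(1), of x] by (simp flip: sum_distrib_left)
  finally show ?thesis .
qed

lemma tp_fk_kernel:
  fixes i :: "'n::finite" shows "tp (real n) (\<lambda>x. fk_kernel n (x $ i - t))"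
proof -
  have "tp (real n) (\<lambda>x. cos ((axis i (real a - real b) :: real^'n) \<bullet> x + (real b - real a) * t))" if "a < n" "b < n" for a b
    using that by (intro tp_cos) (auto simp: axis_def)
  then have "tp (real n) (\<lambda>x::real^'n. \<Sum>a<n. \<Sum>b<n. fk_coeff n a * fk_coeff n b *
     cos ((axis i (real a - real b)) \<bullet> x + (real b - real a) * t))"
    by (intro tp_sum tp_cmult) auto
  from tp_cmult[OF this, of "1 / (\<Sum>a<n. (fk_coeff n a)\<^sup>2)"] show ?thesis
    by (rule tp_cong) (simp add: fk_kernel_def inner_axis' algebra_simps)
qed

lemma tp_jackson: "tp (2 * real n) (jackson n c)"
proof -
  have "tp (real n + real n) (\<lambda>x. fk_kernel n (x $ 1 - fk_node n (fst p)) * fk_kernel n (x $ 2 - fk_node n (snd p)))" for p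
    by (intro tp_mult tp_fk_kernel)
  from tp_cmult[OF this, of "1 / (real (2*n))\<^sup>2"] have "tp (2 * real n) (fk_weight n p)" for p
    unfolding fk_weight_def[abs_def] by (simp add: algebra_simps)
  then have "tp (2 * real n) (\<lambda>x. \<Sum>p\<in>fk_grid n. c p * fk_weight n p x)"
    by (intro tp_sum tp_cmult) (auto simp: fk_grid_def)
  then show ?thesis by (simp add: jackson_def[abs_def])
qed

section \<open>The convex integration step\<close>

text \<open>Taylor polynomials of \<open>sqrt (1 + x)\<close>, built one coefficient at a time, with
  the remainder of the square kept as an exact polynomial multiple of
  \<open>x ^ Suc M\<close>.\<close>

lemma poly_sqrt_approx_exact:
  "\<exists>P R :: real poly. poly P 0 = 1 \<and> (\<forall>x. (poly P x)\<^sup>2 = 1 + x + x ^ Suc M * poly R x)"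
proof (induction M)
  case 0
  have "poly 1 0 = (1::real) \<and> (\<forall>x. (poly 1 x)\<^sup>2 = 1 + x + x ^ Suc 0 * poly [:-1::real:] x)" by simp
  then show ?case by blast
next
  case (Suc M)
  then obtain P R :: "real poly" where P: "poly P 0 = 1" "\<And>x. (poly P x)\<^sup>2 = 1 + x + x ^ Suc M * poly R x"
    by blast
  \<comment> \<open>Adding \<open>c * x ^ Suc M\<close> to \<open>P\<close> changes the coefficient
    of \<open>x ^ Suc M\<close> in the square by \<open>2 * c * poly P 0 = 2 * c\<close>; this
    choice cancels it.\<close>
  define c where "c = - poly R 0 / 2"
  have "poly (R + smult (2 * c) P) 0 = 0" by (simp add: c_def P)
  then obtain S where S: "R + smult (2 * c) P = [:0, 1:] * S"
    unfolding poly_eq_0_iff_dvd by (auto elim: dvdE)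
  have S': "poly R x + 2 * c * poly P x = x * poly S x" for x
    using arg_cong[OF S, of "\<lambda>p. poly p x"] by simp
  let ?P = "P + monom c (Suc M)" and ?R = "S + monom (c\<^sup>2) M"
  have "(poly ?P x)\<^sup>2 = 1 + x + x ^ Suc (Suc M) * poly ?R x" for x
  proof -
    have "(poly ?P x)\<^sup>2 = (poly P x)\<^sup>2 + 2 * c * poly P x * x ^ Suc M + c\<^sup>2 * x ^ Suc M * x ^ Suc M"
      by (simp add: poly_monom power2_eq_square algebra_simps)
    also have "\<dots> = 1 + x + x ^ Suc M * (poly R x + 2 * c * poly P x) + c\<^sup>2 * x ^ Suc M * x ^ Suc M"
      unfolding P(2) by (simp add: algebra_simps)
    also have "\<dots> = 1 + x + x ^ Suc (Suc M) * poly ?R x"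
      unfolding S' by (simp add: poly_monom algebra_simps)
    finally show ?thesis .
  qed
  moreover have "poly ?P 0 = 1" using P(1) by (simp add: poly_monom)
  ultimately show ?case by blast
qed

lemma poly_sqrt_approx:
  "\<exists>(P :: real poly) C. 0 < C \<and> (\<forall>x. \<bar>x\<bar> \<le> 1 \<longrightarrow> \<bar>(poly P x)\<^sup>2 - (1 + x)\<bar> \<le> C * \<bar>x\<bar> ^ Suc M)"
proof -
  obtain P R :: "real poly" where P: "\<And>x. (poly P x)\<^sup>2 = 1 + x + x ^ Suc M * poly R x"
    using poly_sqrt_approx_exact by blast
  have "bounded ((\<lambda>x. poly R x) ` {-1..1})"
    by (intro compact_imp_bounded compact_continuous_image continuous_intros) auto
  then obtain C where C: "0 < C" "\<And>x. x \<in> {-1..1} \<Longrightarrow> \<bar>poly R x\<bar> \<le> C" unfolding bounded_pos by auto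
  have "\<bar>(poly P x)\<^sup>2 - (1 + x)\<bar> \<le> C * \<bar>x\<bar> ^ Suc M" if "\<bar>x\<bar> \<le> 1" for x
  proof -
    have "\<bar>(poly P x)\<^sup>2 - (1 + x)\<bar> = \<bar>poly R x\<bar> * \<bar>x\<bar> ^ Suc M"
      unfolding P by (simp add: abs_mult power_abs)
    also have "\<dots> \<le> C * \<bar>x\<bar> ^ Suc M" using that by (intro mult_right_mono C) auto
    finally show ?thesis .
  qed
  with C(1) show ?thesis by blast
qed

text \<open>The convex integration step adds a single corrugation in direction \<open>\<xi>\<close> to \<open>V\<close>; the
  oscillating part of \<open>\<nabla>V \<otimes> \<nabla>V\<close> is absorbed by \<open>W\<close>, up to the error \<open>step_err\<close>.\<close>

definition mixed_form :: "(real^2 \<Rightarrow> real) \<Rightarrow> (2 \<Rightarrow> real^2 \<Rightarrow> real) \<Rightarrow> 2 \<Rightarrow> 2 \<Rightarrow> real^2 \<Rightarrow> real" where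
  "mixed_form V W i j x = pderiv_at i V x * pderiv_at j V x + pderiv_at i (W j) x + pderiv_at j (W i) x"

definition step_fun :: "real \<Rightarrow> real^2 \<Rightarrow> (real^2 \<Rightarrow> real) \<Rightarrow> real^2 \<Rightarrow> real" where
  "step_fun l \<xi> b x = 1 / l * (b x * sin ((l *\<^sub>R \<xi>) \<bullet> x + 0))"

definition step_field :: "real \<Rightarrow> real^2 \<Rightarrow> (real^2 \<Rightarrow> real) \<Rightarrow> (real^2 \<Rightarrow> real) \<Rightarrow> 2 \<Rightarrow> real^2 \<Rightarrow> real" where
  "step_field l \<xi> b V i x = - (\<xi> $ i / (8 * l)) * ((b x * b x) * sin ((2 * l) *\<^sub>R \<xi> \<bullet> x + 0))
     - 1 / l * ((b x * sin ((l *\<^sub>R \<xi>) \<bullet> x + 0)) * pderiv_at i V x)"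

definition step_err :: "real \<Rightarrow> real^2 \<Rightarrow> (real^2 \<Rightarrow> real) \<Rightarrow> (real^2 \<Rightarrow> real) \<Rightarrow> 2 \<Rightarrow> 2 \<Rightarrow> real^2 \<Rightarrow> real" where
  "step_err l \<xi> b V i j x = - (2 / l) * ((b x * sin ((l *\<^sub>R \<xi>) \<bullet> x + 0)) * pderiv_at i (pderiv_at j V) x)
     + 1 / (4 * l) * ((b x * sin ((2 * l) *\<^sub>R \<xi> \<bullet> x + 0)) * (\<xi> $ j * pderiv_at i b x + \<xi> $ i * pderiv_at j b x))
     + 1 / l\<^sup>2 * ((sin ((l *\<^sub>R \<xi>) \<bullet> x + 0) * sin ((l *\<^sub>R \<xi>) \<bullet> x + 0)) * (pderiv_at i b x * pderiv_at j b x))"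

text \<open>Here \<open>S\<close> and \<open>K\<close> are sine and cosine of the phase, and
  \<open>m\<close> is \<open>1 / l\<close>. Of \<open>b\<^sup>2 * K\<^sup>2\<close>, the mean
  \<open>b\<^sup>2 / 2\<close> remains, while the double-angle part is cancelled by the first term
  of \<open>step_field\<close>. Its second term cancels the products of the corrugation with the old
  gradient. What is left has a factor \<open>m\<close>.\<close>

lemma step_algebra:
  fixes S K l m :: real
  assumes "K * K = 1 - S * S" "l * m = 1"
  shows "(Vi + m * (b * (l * xi * K) + bi * S)) * (Vj + m * (b * (l * xj * K) + bj * S))
    + (Wij + (- (xj * m / 8) * ((b * b) * (2 * l * xi * (1 - 2 * S * S)) + (b * bi + bi * b) * (2 * S * K))
        - m * ((b * S) * Vij + (b * (l * xi * K) + bi * S) * Vj)))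
    + (Wji + (- (xi * m / 8) * ((b * b) * (2 * l * xj * (1 - 2 * S * S)) + (b * bj + bj * b) * (2 * S * K))
        - m * ((b * S) * Vij + (b * (l * xj * K) + bj * S) * Vi)))
   = Vi * Vj + Wij + Wji + b * b / 2 * (xi * xj)
    + (- (2 * m) * ((b * S) * Vij) + m / 4 * ((b * (2 * S * K)) * (xj * bi + xi * bj)) + m * m * ((S * S) * (bi * bj)))"
  using assms by algebra

lemma step_identity:
  assumes V: "tp A V" and b: "tp B b" and W: "\<And>i. tp D (W i)" and l: "0 < l"
    and k: "\<And>i. l * \<xi> $ i \<in> \<int>"
  shows "mixed_form (\<lambda>x. V x + step_fun l \<xi> b x) (\<lambda>i x. W i x + step_field l \<xi> b V i x) i j x
   = mixed_form V W i j x + (b x)\<^sup>2 / 2 * (\<xi> $ i * \<xi> $ j) + step_err l \<xi> b V i j x"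
proof -
  define s where "s x = sin ((l *\<^sub>R \<xi>) \<bullet> x + 0)" for x
  define s2 where "s2 x = sin (((2 * l) *\<^sub>R \<xi>) \<bullet> x + 0)" for x
  define K where "K = cos ((l *\<^sub>R \<xi>) \<bullet> x + 0)"
  have K2: "K * K = 1 - s x * s x" using sin_cos_squared_add[of "(l *\<^sub>R \<xi>) \<bullet> x + 0"]
    by (simp add: K_def s_def power2_eq_square)
  have lm: "l * (1 / l) = 1" using l by simp
  have double: "((2 * l) *\<^sub>R \<xi>) \<bullet> x + 0 = 2 * ((l *\<^sub>R \<xi>) \<bullet> x + 0)" for x by simp
  have d: "V differentiable (at x)" "b differentiable (at x)" "W i differentiable (at x)"
    "pderiv_at i V differentiable (at x)" for i x
    using assms by (auto intro: tp_differentiable tp_pderiv)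
  have ds: "s differentiable (at x)" "s2 differentiable (at x)" for x
    unfolding s_def s2_def by (auto intro!: derivative_intros simp: differentiable_def) 
     (auto intro!: derivative_eq_intros exI)
  note diffs = differentiable_add differentiable_diff differentiable_mult differentiable_const d ds
  have s': "pderiv_at i s x = l * \<xi> $ i * K" for i
    using pderiv_at_sin[of i "l *\<^sub>R \<xi>" 0 x] unfolding s_def K_def by simp
  have s2': "pderiv_at i s2 x = 2 * l * \<xi> $ i * (1 - 2 * s x * s x)" for i
    using pderiv_at_sin[of i "(2 * l) *\<^sub>R \<xi>" 0 x] cos_double_sin[of "(l *\<^sub>R \<xi>) \<bullet> x + 0"]
    unfolding s2_def s_def double by (simp add: power2_eq_square)
  have s2: "s2 x = 2 * s x * K" unfolding s2_def s_def K_def double by (rule sin_double)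
  have V': "pderiv_at i (\<lambda>x. V x + 1 / l * (b x * s x)) x =
     pderiv_at i V x + 1 / l * (b x * (l * \<xi> $ i * K) + pderiv_at i b x * s x)" for i
  proof -
    have "pderiv_at i (\<lambda>x. V x + 1 / l * (b x * s x)) x = pderiv_at i V x + pderiv_at i (\<lambda>x. 1 / l * (b x * s x)) x"
      by (intro pderiv_at_add diffs)
    also have "pderiv_at i (\<lambda>x. 1 / l * (b x * s x)) x = 1 / l * pderiv_at i (\<lambda>x. b x * s x) x"
      by (intro pderiv_at_cmult diffs)
    also have "pderiv_at i (\<lambda>x. b x * s x) x = b x * pderiv_at i s x + pderiv_at i b x * s x"
      by (intro pderiv_at_mult diffs)
    finally show ?thesis unfolding s' .
  qed
  have W': "pderiv_at i (\<lambda>x. W j x + (- (\<xi> $ j / (8 * l)) * ((b x * b x) * s2 x) - 1 / l * ((b x * s x) * pderiv_at j V x))) x =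
     pderiv_at i (W j) x + (- (\<xi> $ j * (1 / l) / 8) * ((b x * b x) * (2 * l * \<xi> $ i * (1 - 2 * s x * s x)) + (b x * pderiv_at i b x + pderiv_at i b x * b x) * (2 * s x * K))
        - 1 / l * ((b x * s x) * pderiv_at i (pderiv_at j V) x + (b x * (l * \<xi> $ i * K) + pderiv_at i b x * s x) * pderiv_at j V x))" for i j
  proof -
    have "pderiv_at i (\<lambda>x. W j x + (- (\<xi> $ j / (8 * l)) * ((b x * b x) * s2 x) - 1 / l * ((b x * s x) * pderiv_at j V x))) x
      = pderiv_at i (W j) x + (pderiv_at i (\<lambda>x. - (\<xi> $ j / (8 * l)) * ((b x * b x) * s2 x)) x - pderiv_at i (\<lambda>x. 1 / l * ((b x * s x) * pderiv_at j V x)) x)"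
      by (subst pderiv_at_add, (intro diffs)+)
        (subst pderiv_at_diff, (intro diffs refl)+)
    also have "pderiv_at i (\<lambda>x. - (\<xi> $ j / (8 * l)) * ((b x * b x) * s2 x)) x = - (\<xi> $ j / (8 * l)) * pderiv_at i (\<lambda>x. (b x * b x) * s2 x) x"
      by (intro pderiv_at_cmult diffs)
    also have "pderiv_at i (\<lambda>x. (b x * b x) * s2 x) x = (b x * b x) * pderiv_at i s2 x + pderiv_at i (\<lambda>x. b x * b x) x * s2 x"
      by (intro pderiv_at_mult diffs)
    also have "pderiv_at i (\<lambda>x. b x * b x) x = b x * pderiv_at i b x + pderiv_at i b x * b x"
      by (intro pderiv_at_mult diffs)
    also have "pderiv_at i (\<lambda>x. 1 / l * ((b x * s x) * pderiv_at j V x)) x = 1 / l * pderiv_at i (\<lambda>x. (b x * s x) * pderiv_at j V x) x"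
      by (intro pderiv_at_cmult diffs)
    also have "pderiv_at i (\<lambda>x. (b x * s x) * pderiv_at j V x) x = (b x * s x) * pderiv_at i (pderiv_at j V) x + pderiv_at i (\<lambda>x. b x * s x) x * pderiv_at j V x"
      by (intro pderiv_at_mult diffs)
    also have "pderiv_at i (\<lambda>x. b x * s x) x = b x * pderiv_at i s x + pderiv_at i b x * s x"
      by (intro pderiv_at_mult diffs)
    finally show ?thesis unfolding s' s2' s2 by simp
  qed
  have comm: "pderiv_at j (pderiv_at i V) x = pderiv_at i (pderiv_at j V) x"
    by (rule tp_pderiv_commute[OF V])
  show ?thesis
    unfolding mixed_form_def step_fun_def step_field_def step_err_def s_def[symmetric] s2_def[symmetric] V' W' comm s2
    using step_algebra[OF K2 lm, of "pderiv_at i V x" "b x" "\<xi> $ i" "pderiv_at i b x" "pderiv_at j V x" "\<xi> $ j" "pderiv_at j b x"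
        "pderiv_at i (W j) x" "pderiv_at i (pderiv_at j V) x" "pderiv_at j (W i) x"]
    by (simp add: power2_eq_square)
qed

section \<open>Joint bookkeeping of degree and sup norm\<close>

definition btp :: "real \<Rightarrow> real \<Rightarrow> (real^'n::finite \<Rightarrow> real) \<Rightarrow> bool" where
  "btp L B f \<longleftrightarrow> tp L f \<and> (\<forall>x. \<bar>f x\<bar> \<le> B)"

lemma btp_tp: "btp L B f \<Longrightarrow> tp L f" and btp_bound: "btp L B f \<Longrightarrow> \<bar>f x\<bar> \<le> B"
  by (auto simp: btp_def)

lemma btp_nonneg: "btp L B f \<Longrightarrow> 0 \<le> B"
  using btp_bound[of L B f 0] by linarith

lemma btp_mono: "btp L B f \<Longrightarrow> L \<le> L' \<Longrightarrow> B \<le> B' \<Longrightarrow> btp L' B' f"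
  unfolding btp_def by (meson order_trans tp_mono)

lemma btp_add: "btp L B f \<Longrightarrow> btp L B' g \<Longrightarrow> btp L (B + B') (\<lambda>x. f x + g x)"
  unfolding btp_def by (auto intro!: tp_add order_trans[OF abs_triangle_ineq] add_mono)

lemma btp_diff: "btp L B f \<Longrightarrow> btp L B' g \<Longrightarrow> btp L (B + B') (\<lambda>x. f x - g x)"
  unfolding btp_def by (auto intro!: tp_diff order_trans[OF abs_triangle_ineq4] add_mono)

lemma btp_mult: "btp L B f \<Longrightarrow> btp L' B' g \<Longrightarrow> btp (L + L') (B * B') (\<lambda>x. f x * g x)"
  using btp_nonneg[of L B f] unfolding btp_def by (auto intro: tp_mult mult_mono simp: abs_mult)

lemma btp_cmult: "btp L B f \<Longrightarrow> \<bar>c\<bar> \<le> C \<Longrightarrow> btp L (C * B) (\<lambda>x. c * f x)"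
  unfolding btp_def by (auto intro: tp_cmult simp: abs_mult intro!: mult_mono)

lemma btp_pderiv: "btp L B f \<Longrightarrow> 1 \<le> L \<Longrightarrow> btp L (2 * L * B) (pderiv_at i f)"
  unfolding btp_def by (auto intro: tp_pderiv bernstein)

lemma btp_sin:
  assumes "\<And>i. l * \<xi> $ i \<in> \<int>" "\<And>i. \<bar>\<xi> $ i\<bar> \<le> 1" "0 \<le> l"
  shows "btp l 1 (\<lambda>x. sin ((l *\<^sub>R \<xi>) \<bullet> x + 0))"
  unfolding btp_def
proof
  show "tp l (\<lambda>x. sin ((l *\<^sub>R \<xi>) \<bullet> x + 0))"
    using assms by (intro tp_sin) (auto simp: abs_mult mult_left_le)
qed simp

text \<open>One factor \<open>1 / l\<close> survives in the error: \<open>B2\<close> comes from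
  differentiating the old gradient, \<open>Nb\<close> from differentiating the amplitude by
  Bernstein. The term quadratic in the derivatives of the amplitude has size
  \<open>4 * \<beta>\<^sup>2 * Nb\<^sup>2 / l\<^sup>2\<close> and is of the same order because
  \<open>Nb \<le> l\<close>.\<close>

lemma step_estimates:
  assumes V: "tp N V" and b: "btp Nb \<beta> b" and Nb: "1 \<le> Nb" "Nb \<le> l" "N \<le> l"
    and int: "\<And>i. l * \<xi> $ i \<in> \<int>" and xi: "\<And>i. \<bar>\<xi> $ i\<bar> \<le> 1"
    and G: "\<And>i x. \<bar>pderiv_at i V x\<bar> \<le> G" and B2: "\<And>i j x. \<bar>pderiv_at i (pderiv_at j V) x\<bar> \<le> B2"
  shows step_fun_estimate: "btp (2 * l) (\<beta> / l) (step_fun l \<xi> b)"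
    and step_field_estimate: "btp (4 * l) ((\<beta>\<^sup>2 / 8 + \<beta> * G) / l) (step_field l \<xi> b V i)"
    and step_err_estimate: "btp (4 * l) ((2 * \<beta> * B2 + 5 * \<beta>\<^sup>2 * Nb) / l) (step_err l \<xi> b V i j)"
proof -
  let ?s = "\<lambda>x. sin ((l *\<^sub>R \<xi>) \<bullet> x + 0)"
  let ?s2 = "\<lambda>x. sin (((2 * l) *\<^sub>R \<xi>) \<bullet> x + 0)"
  let ?b = "1 / l\<^sup>2 * (1 * 1 * ((2 * Nb * \<beta>) * (2 * Nb * \<beta>)))"
  let ?a = "1 / (4 * l) * (\<beta> * 1 * (1 * (2 * Nb * \<beta>) + 1 * (2 * Nb * \<beta>)))"
  have l: "1 \<le> l" using Nb by linarith
  have \<beta>: "0 \<le> \<beta>" using btp_nonneg[OF b] .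
  have s: "btp l 1 (\<lambda>x. ?s x)" using l by (intro btp_sin int xi) auto
  have "2 * l * \<xi> $ i \<in> \<int>" for i using Ints_mult[OF _ int[of i], of 2] by (simp add: mult.assoc)
  then have s2: "btp (2 * l) 1 (\<lambda>x. ?s2 x)" using l by (intro btp_sin xi) auto
  have dV: "btp N G (pderiv_at i V)" for i using V G by (auto simp: btp_def tp_pderiv)
  have ddV: "btp N B2 (pderiv_at i (pderiv_at j V))" for i j using V B2 by (auto simp: btp_def tp_pderiv)
  have db: "btp Nb (2 * Nb * \<beta>) (pderiv_at i b)" for i using b Nb by (intro btp_pderiv)
  have bs: "btp (Nb + l) (\<beta> * 1) (\<lambda>x. b x * ?s x)" by (intro btp_mult b s)
  show "btp (2 * l) (\<beta> / l) (step_fun l \<xi> b)"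
    unfolding step_fun_def[abs_def]
    by (rule btp_mono[OF btp_cmult[OF bs, of "1 / l" "1 / l"]]) (use Nb l in auto)
  have "btp (max (Nb + Nb + 2 * l) (Nb + l + N)) (1 / (8 * l) * (\<beta> * \<beta> * 1) + 1 / l * (\<beta> * 1 * G)) (step_field l \<xi> b V i)"
    unfolding step_field_def[abs_def]
  proof (intro btp_diff)
    have "\<bar>- (\<xi> $ i / (8 * l))\<bar> \<le> 1 / (8 * l)" using xi[of i] l by (simp add: divide_le_cancel)
    from btp_cmult[OF btp_mult[OF btp_mult[OF b b] s2] this]
    show "btp (max (Nb + Nb + 2 * l) (Nb + l + N)) (1 / (8 * l) * (\<beta> * \<beta> * 1))
      (\<lambda>x. - (\<xi> $ i / (8 * l)) * ((b x * b x) * ?s2 x))"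
      by (rule btp_mono) auto
    have "\<bar>1 / l\<bar> \<le> 1 / l" using l by simp
    from btp_cmult[OF btp_mult[OF bs dV] this]
    show "btp (max (Nb + Nb + 2 * l) (Nb + l + N)) (1 / l * (\<beta> * 1 * G))
      (\<lambda>x. 1 / l * (b x * ?s x * pderiv_at i V x))"
      by (rule btp_mono) auto
  qed
  then show "btp (4 * l) ((\<beta>\<^sup>2 / 8 + \<beta> * G) / l) (step_field l \<xi> b V i)"
    by (rule btp_mono) (use Nb l in \<open>auto simp: power2_eq_square field_simps\<close>)
  let ?A = "max (Nb + l + N) (max (Nb + 2 * l + Nb) (l + l + (Nb + Nb)))"
  have "btp ?A (2 / l * (\<beta> * 1 * B2) + ?a
       + ?b) (step_err l \<xi> b V i j)"
    unfolding step_err_def[abs_def]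
  proof (intro btp_add)
    have "\<bar>- (2 / l)\<bar> \<le> 2 / l" using l by simp
    from btp_cmult[OF btp_mult[OF bs ddV] this]
    show "btp ?A (2 / l * (\<beta> * 1 * B2)) (\<lambda>x. - (2 / l) * (b x * ?s x * pderiv_at i (pderiv_at j V) x))"
      by (rule btp_mono) auto
    have "\<bar>1 / (4 * l)\<bar> \<le> 1 / (4 * l)" using l by simp
    from btp_cmult[OF btp_mult[OF btp_mult[OF b s2] btp_add[OF btp_cmult[OF db xi] btp_cmult[OF db xi]]] this]
    show "btp ?A ?a
     (\<lambda>x. 1 / (4 * l) * (b x * ?s2 x * (\<xi> $ j * pderiv_at i b x + \<xi> $ i * pderiv_at j b x)))"
      by (rule btp_mono) auto
    have "\<bar>1 / l\<^sup>2\<bar> \<le> 1 / l\<^sup>2" by simp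
    from btp_cmult[OF btp_mult[OF btp_mult[OF s s] btp_mult[OF db db]] this]
    show "btp ?A ?b
     (\<lambda>x. 1 / l\<^sup>2 * (?s x * ?s x * (pderiv_at i b x * pderiv_at j b x)))"
      by (rule btp_mono) auto
  qed
  then show "btp (4 * l) ((2 * \<beta> * B2 + 5 * \<beta>\<^sup>2 * Nb) / l) (step_err l \<xi> b V i j)"
  proof (rule btp_mono)
    have "?b = 4 * (\<beta>\<^sup>2 * Nb) / l * (Nb / l)"
      by (simp add: power2_eq_square)
    also have "\<dots> \<le> 4 * (\<beta>\<^sup>2 * Nb) / l * 1" using Nb l by (intro mult_left_mono) auto
    finally have "?b \<le> 4 * (\<beta>\<^sup>2 * Nb) / l" by simp
    moreover have "?a = (\<beta>\<^sup>2 * Nb) / l"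
      by (simp add: power2_eq_square)
    moreover have "(2 * \<beta> * B2 + 5 * \<beta>\<^sup>2 * Nb) / l = 2 / l * (\<beta> * 1 * B2) + (\<beta>\<^sup>2 * Nb) / l + 4 * (\<beta>\<^sup>2 * Nb) / l"
      by (simp add: add_divide_distrib[symmetric])
    ultimately show "2 / l * (\<beta> * 1 * B2) + ?a
       + ?b \<le> (2 * \<beta> * B2 + 5 * \<beta>\<^sup>2 * Nb) / l"
      by linarith
  qed (use Nb l in auto)
qed

text \<open>The bounds an increment needs for the limit: the Hoelder seminorm of the gradient is
  interpolated between \<open>A1\<close> and \<open>A2\<close>.\<close>

definition incr :: "real \<Rightarrow> real \<Rightarrow> real \<Rightarrow> real \<Rightarrow> (real^'n::finite \<Rightarrow> real) \<Rightarrow> bool" where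
  "incr L A0 A1 A2 u \<longleftrightarrow> tp L u \<and> (\<forall>x. \<bar>u x\<bar> \<le> A0) \<and> (\<forall>i x. \<bar>pderiv_at i u x\<bar> \<le> A1) \<and>
     (\<forall>i j x. \<bar>pderiv_at i (pderiv_at j u) x\<bar> \<le> A2)"

lemma incr_mono: "incr L A0 A1 A2 u \<Longrightarrow> L \<le> L' \<Longrightarrow> A0 \<le> B0 \<Longrightarrow> A1 \<le> B1 \<Longrightarrow> A2 \<le> B2 \<Longrightarrow> incr L' B0 B1 B2 u"
  unfolding incr_def by (meson order_trans tp_mono)

lemma incr_btp: assumes "btp L B u" "1 \<le> L" shows "incr L B (2 * L * B) (2 * L * (2 * L * B)) u"
  using assms btp_pderiv[OF assms] btp_pderiv[OF btp_pderiv[OF assms] assms(2)]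
  unfolding incr_def btp_def by blast

lemma tp_pderiv_add: "tp L u \<Longrightarrow> tp L' v \<Longrightarrow> pderiv_at i (\<lambda>x. u x + v x) = (\<lambda>x. pderiv_at i u x + pderiv_at i v x)"
  by (auto intro!: pderiv_at_add tp_differentiable)

lemma incr_add:
  assumes "incr L A0 A1 A2 u" "incr L' B0 B1 B2 v"
  shows "incr (max L L') (A0 + B0) (A1 + B1) (A2 + B2) (\<lambda>x. u x + v x)"
proof -
  have t: "tp L u" "tp L' v" using assms by (auto simp: incr_def)
  have "tp (max L L') (\<lambda>x. u x + v x)" by (intro tp_add tp_mono[OF t(1)] tp_mono[OF t(2)]) auto
  then show ?thesis
    using assms unfolding incr_def tp_pderiv_add[OF t] tp_pderiv_add[OF tp_pderiv[OF t(1)] tp_pderiv[OF t(2)]]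
    by (auto intro!: order_trans[OF abs_triangle_ineq] add_mono)
qed

section \<open>Choice of parameters and amplitudes\<close>

locale ci_params =
  fixes P :: "real poly" and Cp m :: real and k j0 :: nat
    \<comment> \<open>In one stage the defect shrinks by the factor \<open>m ^ (2 * k)\<close> while the frequency grows by
      \<open>m ^ (7 * k + 7 + j0)\<close>, whence the threshold \<open>1 / 7\<close>. The defect is kept within relative
      distance \<open>1 / m\<close> of its model, so that the polynomial \<open>P\<close> can replace the square root.\<close>
  assumes P_sqrt: "\<And>x. \<bar>x\<bar> \<le> 1 \<Longrightarrow> \<bar>(poly P x)\<^sup>2 - (1 + x)\<bar> \<le> Cp * \<bar>x\<bar> ^ (2 * k + 2)"
    and Cp_pos: "0 < Cp" and k_pos: "1 \<le> k" and m_nat: "m \<in> \<nat>"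
    and m_ge: "12 * (260 + 20 * (real (degree P) + 1)) \<le> m" and m_ge': "4 * Cp * 2 ^ (2 * k + 2) \<le> m"
begin

definition Md :: real where "Md = real (degree P) + 1"

lemma Md: "1 \<le> Md" "0 < Md" "20 * Md \<le> m" "12 * (260 + 20 * Md) \<le> m"
  using m_ge by (auto simp: Md_def)

lemma m: "3360 \<le> m" "1 \<le> m" "0 < m" "m \<noteq> 0"
  using m_ge by auto

lemma m_power_ge: "1 \<le> m ^ n" "0 < m ^ n" using m by (simp_all add: one_le_power)

lemma m_le_power: "0 < n \<Longrightarrow> m \<le> m ^ n"
  using m by (simp add: self_le_power)

text \<open>The square root of \<open>2 * (c - (r / m ^ k)\<^sup>2)\<close>, with \<open>P\<close>
  in place of the root. The 2 compensates the mean 1/2 of a squared cosine. Subtracting the next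
  squared amplitude leaves a positive defect for the next stage. The argument of \<open>P\<close> is
  small since \<open>c\<close> is close to \<open>r\<^sup>2\<close>.\<close>

definition amp :: "real \<Rightarrow> (real^2 \<Rightarrow> real) \<Rightarrow> real^2 \<Rightarrow> real" where
  "amp r c x = sqrt 2 * r * poly P ((c x - (r / m ^ k)\<^sup>2) / r\<^sup>2 - 1)"

lemma amp:
  assumes c: "tp N c" and N: "0 \<le> N" and r: "0 < r" and cr: "\<And>x. \<bar>c x - r\<^sup>2\<bar> \<le> r\<^sup>2 / m"
  shows amp_btp: "btp (Md * N) (2 * r) (amp r c)"
    and amp_square: "\<bar>c x - (amp r c x)\<^sup>2 / 2 - (r / m ^ k)\<^sup>2\<bar> \<le> (r / m ^ k)\<^sup>2 / (4 * m)"
proof -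
  define s where "s x = (c x - (r / m ^ k)\<^sup>2) / r\<^sup>2 - 1" for x
  have s_eq: "s x = (c x - r\<^sup>2) / r\<^sup>2 - 1 / m ^ (2 * k)" for x
    using r by (simp add: s_def diff_divide_distrib power_divide power_mult mult.commute)
  have s: "\<bar>s x\<bar> \<le> 2 / m" for x
  proof -
    have "\<bar>(c x - r\<^sup>2) / r\<^sup>2\<bar> \<le> 1 / m"
      using cr[of x] r by (simp add: abs_divide divide_le_eq)
    moreover have "0 \<le> 1 / m ^ (2 * k)" "1 / m ^ (2 * k) \<le> 1 / m"
      using m_le_power[of "2 * k"] k_pos m by (auto intro!: divide_left_mono)
    moreover have "2 / m = 1 / m + 1 / m" by simp
    ultimately show ?thesis unfolding s_eq by linarith
  qed
  have m2: "2 / m \<le> 1" using m by simp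
  have err: "\<bar>(poly P (s x))\<^sup>2 - (1 + s x)\<bar> \<le> 1 / m ^ (2 * k) / (4 * m)" for x
  proof -
    have "\<bar>(poly P (s x))\<^sup>2 - (1 + s x)\<bar> \<le> Cp * \<bar>s x\<bar> ^ (2 * k + 2)"
      using s[of x] m2 by (intro P_sqrt) linarith
    also have "\<dots> \<le> Cp * (2 / m) ^ (2 * k + 2)"
      using Cp_pos s[of x] by (intro mult_left_mono power_mono) auto
    \<comment> \<open>Of the two surplus powers of \<open>1 / m\<close>, one absorbs the constants
      through \<open>m_ge'\<close>, the other provides the relative accuracy of order
      \<open>1 / m\<close>.\<close>
    also have "\<dots> = (4 * Cp * 2 ^ (2 * k + 2)) * (1 / m ^ (2 * k) / (4 * m * m))"
      using m by (simp add: power_divide power_add power2_eq_square)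
    also have "\<dots> \<le> m * (1 / m ^ (2 * k) / (4 * m * m))"
      using m_ge' m by (intro mult_right_mono) auto
    also have "\<dots> = 1 / m ^ (2 * k) / (4 * m)" using m by simp
    finally show ?thesis .
  qed
  have P2: "\<bar>poly P (s x)\<bar> \<le> sqrt 2" for x
  proof -
    have "1 / m ^ (2 * k) / (4 * m) \<le> 1 / (4 * m)" using m m_power_ge[of "2 * k"] by (simp add: divide_le_eq field_simps)
    moreover have "1 / (4 * m) \<le> 1 / 4" "2 / m \<le> 1 / 4" using m by (auto simp: field_simps)
    ultimately have "(poly P (s x))\<^sup>2 \<le> 2" using err[of x] s[of x] by linarith
    then show ?thesis by (metis real_sqrt_abs real_sqrt_le_mono)
  qed
  have amp_s: "amp r c x = (sqrt 2 * r) * poly P (s x)" for x by (simp add: amp_def s_def)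
  have "tp N (\<lambda>x. (1 / r\<^sup>2) * c x - (r / m ^ k)\<^sup>2 / r\<^sup>2 - 1)"
    using N by (intro tp_diff tp_cmult c tp_const)
  then have "tp N s" by (rule tp_cong) (simp add: s_def diff_divide_distrib)
  then have "tp (real (degree P) * N) (\<lambda>x. poly P (s x))" using N by (rule tp_poly)
  from tp_cmult[OF this, of "sqrt 2 * r"] have "tp (real (degree P) * N) (amp r c)" by (simp add: amp_s[abs_def])
  then have "tp (Md * N) (amp r c)" by (rule tp_mono) (use N in \<open>auto simp: Md_def mult_right_mono\<close>)
  moreover have "\<bar>amp r c x\<bar> \<le> 2 * r" for x
  proof -
    have "\<bar>amp r c x\<bar> = sqrt 2 * r * \<bar>poly P (s x)\<bar>" using r by (simp add: amp_s abs_mult)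
    also have "\<dots> \<le> sqrt 2 * r * sqrt 2" using P2[of x] r by (intro mult_left_mono) auto
    also have "\<dots> = 2 * r" by (simp add: mult.commute mult.left_commute)
    finally show ?thesis .
  qed
  ultimately show "btp (Md * N) (2 * r) (amp r c)" by (simp add: btp_def)
  have "c x - (amp r c x)\<^sup>2 / 2 - (r / m ^ k)\<^sup>2 = r\<^sup>2 * ((1 + s x) - (poly P (s x))\<^sup>2)"
    unfolding amp_s by (simp add: power_mult_distrib s_def algebra_simps) (use r in \<open>simp add: field_simps\<close>)
  then have "\<bar>c x - (amp r c x)\<^sup>2 / 2 - (r / m ^ k)\<^sup>2\<bar> = r\<^sup>2 * \<bar>(poly P (s x))\<^sup>2 - (1 + s x)\<bar>"
    by (simp add: abs_mult abs_minus_commute)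
  also have "\<dots> \<le> r\<^sup>2 * (1 / m ^ (2 * k) / (4 * m))" using err[of x] by (intro mult_left_mono) auto
  also have "\<dots> = (r / m ^ k)\<^sup>2 / (4 * m)" by (simp add: power_divide power_mult mult.commute)
  finally show "\<bar>c x - (amp r c x)\<^sup>2 / 2 - (r / m ^ k)\<^sup>2\<bar> \<le> (r / m ^ k)\<^sup>2 / (4 * m)" .
qed

text \<open>The balance that fixes the frequency ratio \<open>m ^ (2 * k + 2)\<close>:
  \<open>2 * k\<close> powers for the shrinking defect, one for the relative accuracy
  \<open>1 / m\<close>, one to absorb \<open>260 + 20 * Md\<close>, where 260 = 4 * 65. The 12 lets
  three errors add up to a quarter.\<close>

lemma err_small:
  assumes r: "0 < r" and lp: "0 < lp" "N \<le> lp" and B2: "B2 \<le> 65 * r * lp" and l: "lp * m ^ (2 * k + 2) \<le> l"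
  shows "(2 * (2 * r) * B2 + 5 * (2 * r)\<^sup>2 * (Md * N)) / l \<le> (r / m ^ k)\<^sup>2 / (12 * m)"
proof -
  have pos: "0 < lp * m ^ (2 * k + 2)" by (intro mult_pos_pos lp m_power_ge)
  have "2 * (2 * r) * B2 + 5 * (2 * r)\<^sup>2 * (Md * N) \<le> 2 * (2 * r) * (65 * r * lp) + 5 * (2 * r)\<^sup>2 * (Md * lp)"
    using r B2 lp Md by (intro add_mono mult_left_mono) auto
  also have "\<dots> = (260 + 20 * Md) * r\<^sup>2 * lp" by (simp add: power2_eq_square algebra_simps)
  also have "\<dots> \<le> (m / 12) * r\<^sup>2 * lp" using Md lp by (intro mult_right_mono) auto
  finally have "(2 * (2 * r) * B2 + 5 * (2 * r)\<^sup>2 * (Md * N)) / l \<le> (m / 12) * r\<^sup>2 * lp / l"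
    using l pos by (intro divide_right_mono) auto
  also have "\<dots> \<le> (m / 12) * r\<^sup>2 * lp / (lp * m ^ (2 * k + 2))"
    using l pos lp m by (intro divide_left_mono mult_pos_pos[OF less_le_trans[OF pos l] pos]) auto
  also have "\<dots> = (r / m ^ k)\<^sup>2 / (12 * m)"
    using lp m by (simp add: power_add power2_eq_square power_divide power_mult field_simps)
  finally show ?thesis .
qed

end

section \<open>The stage\<close>

context ci_params begin

text \<open>At frequency \<open>N\<close>, the defect \<open>q Id + C H - (\<nabla>V \<otimes> \<nabla>V + 2 sym \<nabla>W)\<close> has the coefficients \<open>c 1, c 2, c 3\<close>
  with respect to the squares of the directions \<open>e\<^sub>1, e\<^sub>2, e\<^sub>1 + e\<^sub>2\<close>, where \<open>H\<close> is the sum of these squares.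
  All three are close to \<open>r\<^sup>2\<close>. The multiple of \<open>H\<close> makes the defect positive at the start; being constant,
  it does not change the divergence.\<close>

definition stage :: "real \<Rightarrow> real \<Rightarrow> real \<Rightarrow> (real^2 \<Rightarrow> real) \<Rightarrow> (real^2 \<Rightarrow> real) \<Rightarrow> (2 \<Rightarrow> real^2 \<Rightarrow> real) \<Rightarrow>
    (nat \<Rightarrow> real^2 \<Rightarrow> real) \<Rightarrow> bool" where
  "stage C N r q V W c \<longleftrightarrow> tp N V \<and> (\<forall>l. tp N (c l)) \<and> (\<forall>i. tp N (W i)) \<and>
     (\<forall>l x. \<bar>c l x - r\<^sup>2\<bar> \<le> r\<^sup>2 / m) \<and>
     (\<forall>i j x. \<bar>pderiv_at i (pderiv_at j V) x\<bar> \<le> m ^ k * r * N) \<and>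
     (\<forall>x. mixed_form V W 1 1 x + c 1 x + c 3 x = q x + 2 * C) \<and>
     (\<forall>x. mixed_form V W 2 2 x + c 2 x + c 3 x = q x + 2 * C) \<and>
     (\<forall>x. mixed_form V W 1 2 x + c 3 x = C)"

text \<open>Two degrees are kept apart: that of \<open>V\<close>, which grows with each corrugation,
  and that of the amplitude, which stays \<open>Md * N0\<close> because all three amplitudes are
  computed from the coefficients at the start of the stage. \<open>lp\<close> is the preceding
  frequency.\<close>

lemma step_properties:
  assumes V: "tp N V" and W: "\<And>i. tp L (W i)" and b: "btp (Md * N0) (2 * r) b"
    and N0: "1 \<le> N0" and l: "Md * N0 \<le> l" "N \<le> l" "l \<in> \<nat>" and r: "0 < r"
    and xi: "\<And>i. \<xi> $ i \<in> {0, 1}"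
    and G: "\<And>i x. \<bar>pderiv_at i V x\<bar> \<le> G" and B2: "\<And>i j x. \<bar>pderiv_at i (pderiv_at j V) x\<bar> \<le> B2"
    and lp: "0 < lp" "N0 \<le> lp" "B2 \<le> 65 * r * lp" "lp * m ^ (2 * k + 2) \<le> l"
    and V': "V' = (\<lambda>x. V x + step_fun l \<xi> b x)" and W': "W' = (\<lambda>i x. W i x + step_field l \<xi> b V i x)"
  shows "incr (2 * l) (2 * r / l) (8 * r) (32 * r * l) (step_fun l \<xi> b)"
    and "incr (4 * l) ((r\<^sup>2 / 2 + 2 * r * G) / l) (8 * (r\<^sup>2 / 2 + 2 * r * G)) (64 * l * (r\<^sup>2 / 2 + 2 * r * G)) (step_field l \<xi> b V i)"
    and "btp (4 * l) ((r / m ^ k)\<^sup>2 / (12 * m)) (step_err l \<xi> b V i j)"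
    and "tp (2 * l) V'" and "\<bar>pderiv_at i V' x\<bar> \<le> G + 8 * r"
    and "\<bar>pderiv_at i (pderiv_at j V') x\<bar> \<le> B2 + 32 * r * l"
    and "mixed_form V' W' i j x = mixed_form V W i j x + (b x)\<^sup>2 / 2 * (\<xi> $ i * \<xi> $ j) + step_err l \<xi> b V i j x"
    and "tp (max L (4 * l)) (W' i)"
proof -
  have "1 * 1 \<le> Md * N0" using N0 Md by (intro mult_mono) auto
  then have MN: "1 \<le> Md * N0" by simp
  have l1: "1 \<le> l" using MN l by linarith
  have int: "l * \<xi> $ i \<in> \<int>" for i
    using xi[of i] l(3) Nats_subset_Ints by auto
  have xi1: "\<bar>\<xi> $ i\<bar> \<le> 1" for i using xi[of i] by auto
  note est = step_estimates[OF V b MN l(1,2) int xi1 G B2]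
  have l0: "l \<noteq> 0" using l1 by simp
  show u: "incr (2 * l) (2 * r / l) (8 * r) (32 * r * l) (step_fun l \<xi> b)"
    by (rule incr_mono[OF incr_btp[OF est(1)]]) (use l1 in auto)
  have e1: "(2 * r)\<^sup>2 / 8 + 2 * r * G = r\<^sup>2 / 2 + 2 * r * G" by (simp add: power2_eq_square)
  show w: "incr (4 * l) ((r\<^sup>2 / 2 + 2 * r * G) / l) (8 * (r\<^sup>2 / 2 + 2 * r * G)) (64 * l * (r\<^sup>2 / 2 + 2 * r * G)) (step_field l \<xi> b V i)" for i
    by (rule incr_mono[OF incr_btp[OF est(2)[unfolded e1]]]) (use l1 in auto)
  show "btp (4 * l) ((r / m ^ k)\<^sup>2 / (12 * m)) (step_err l \<xi> b V i j)"
    by (rule btp_mono[OF est(3)]) (use err_small[OF r lp] in auto)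
  have tu: "tp (2 * l) (step_fun l \<xi> b)" using u by (simp add: incr_def)
  show "tp (2 * l) V'" unfolding V' by (rule tp_add[OF tp_mono[OF V] tu]) (use l l1 in auto)
  show "\<bar>pderiv_at i V' x\<bar> \<le> G + 8 * r"
    unfolding V' tp_pderiv_add[OF V tu]
    using u G by (auto simp: incr_def intro!: order_trans[OF abs_triangle_ineq] add_mono)
  show "\<bar>pderiv_at i (pderiv_at j V') x\<bar> \<le> B2 + 32 * r * l"
    unfolding V' tp_pderiv_add[OF V tu] tp_pderiv_add[OF tp_pderiv[OF V] tp_pderiv[OF tu]]
    using u B2 by (auto simp: incr_def intro!: order_trans[OF abs_triangle_ineq] add_mono)
  show "mixed_form V' W' i j x = mixed_form V W i j x + (b x)\<^sup>2 / 2 * (\<xi> $ i * \<xi> $ j) + step_err l \<xi> b V i j x"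
    unfolding V' W' by (rule step_identity[OF V btp_tp[OF b] W]) (use l1 int in auto)
  have tw: "tp (4 * l) (step_field l \<xi> b V i)" using w by (simp add: incr_def)
  show "tp (max L (4 * l)) (W' i)" unfolding W'
    by (rule tp_add[OF tp_mono[OF W] tp_mono[OF tw]]) auto
qed

text \<open>The three corrugations interact only through \<open>step_err\<close>, so each can use
  its initial coefficient. The frequency exponent is \<open>k + 3 * (2 * k + 2) + j0 + 1\<close>;
  the last power of \<open>m\<close> gives room for degrees like \<open>4 * l3\<close> and for
  numerical constants.\<close>

lemma stage_step:
  assumes S: "stage C N r q V W c" and N: "1 \<le> N" "N \<in> \<nat>" and r: "0 < r"
    and G: "r \<le> G" "\<And>i x. \<bar>pderiv_at i V x\<bar> \<le> G"
    and N': "N' = N * m ^ (7 * k + 7 + j0)" and r': "r' = r / m ^ k"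
    and q': "btp N' (r'\<^sup>2 / (4 * m)) (\<lambda>x. q' x - q x)"
  obtains u w c' where "stage C N' r' q' (\<lambda>x. V x + u x) (\<lambda>i x. W i x + w i x) c'"
    "incr N' (6 * r / N) (24 * r) (r * N') u"
    "\<And>i. incr N' (153 * G * r / N) (1224 * G * r) (3 * G * r * N') (w i)"
proof -
  have V: "tp N V" and c: "tp N (c l)" and W: "tp N (W i)" and cr: "\<bar>c l x - r\<^sup>2\<bar> \<le> r\<^sup>2 / m"
    and B2: "\<bar>pderiv_at i (pderiv_at j V) x\<bar> \<le> m ^ k * r * N"
    and eqs: "mixed_form V W 1 1 x + c 1 x + c 3 x = q x + 2 * C" "mixed_form V W 2 2 x + c 2 x + c 3 x = q x + 2 * C"
     "mixed_form V W 1 2 x + c 3 x = C" for i j l x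
    using S unfolding stage_def by auto
  \<comment> \<open>No corrugation has frequency \<open>l0\<close>. It is defined by
    \<open>r * l0\<close> being the bound on the second derivatives of \<open>V\<close>, and serves
    as the preceding frequency for the first corrugation.\<close>
  define l0 where "l0 = N * m ^ k"
  define l1 where "l1 = l0 * m ^ (2 * k + 2 + j0)"
  define l2 where "l2 = l1 * m ^ (2 * k + 2)"
  define l3 where "l3 = l2 * m ^ (2 * k + 2)"
  have N'_l3: "N' = l3 * m"
  proof -
    have e: "7 * k + 7 + j0 = k + (2 * k + 2 + j0) + (2 * k + 2) + (2 * k + 2) + 1" by simp
    show ?thesis unfolding N' e l3_def l2_def l1_def l0_def power_add by simp
  qed
  have lnat: "l1 \<in> \<nat>" "l2 \<in> \<nat>" "l3 \<in> \<nat>" "N' \<in> \<nat>"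
  proof -
    have "m ^ n \<in> \<nat>" for n using m_nat by (induction n) (auto intro: Nats_mult)
    then show "l1 \<in> \<nat>" "l2 \<in> \<nat>" "l3 \<in> \<nat>" "N' \<in> \<nat>"
      unfolding N'_l3 l3_def l2_def l1_def l0_def using N(2) m_nat by (blast intro: Nats_mult)+
  qed
  have big: "m * x \<le> x * m ^ n" if "0 < n" "0 \<le> x" for x n
    using mult_left_mono[OF m_le_power[OF that(1)] that(2)] by (simp add: mult.commute)
  have "N * 1 \<le> l0" unfolding l0_def using N m_power_ge by (intro mult_left_mono) auto
  then have l0: "N \<le> l0" "1 \<le> l0" "0 < l0" using N by auto
  have l1: "m * l0 \<le> l1" unfolding l1_def using l0 by (intro big) auto
  have "2 * l0 \<le> m * l0" using m l0 by (intro mult_right_mono) auto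
  then have l1': "l0 \<le> l1" "0 < l1" "1 \<le> l1" using l1 l0 by linarith+
  have l2: "m * l1 \<le> l2" unfolding l2_def using l1' by (intro big) auto
  have "2 * l1 \<le> m * l1" using m l1' by (intro mult_right_mono) auto
  then have l2': "2 * l1 \<le> l2" "l1 \<le> l2" "0 < l2" using l2 l1' by linarith+
  have l3: "m * l2 \<le> l3" unfolding l3_def using l2' by (intro big) auto
  have "2 * l2 \<le> m * l2" using m l2' by (intro mult_right_mono) auto
  then have l3': "2 * l2 \<le> l3" "l2 \<le> l3" "0 < l3" using l3 l2' by linarith+
  have N'3: "3360 * l3 \<le> N'" unfolding N'_l3 using m l3' by (simp add: mult.commute)
  have MdN: "Md * N \<le> l1"
  proof -
    have "Md * N \<le> m * l0" using Md l0 N by (intro mult_mono) auto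
    then show ?thesis using l1 by linarith
  qed
  have N'big: "4 * l1 \<le> N'" "4 * l2 \<le> N'" "4 * l3 \<le> N'" "2 * (Md * N) \<le> N'" "N \<le> N'"
    using N'3 l3' l2' l1' l0 MdN by linarith+
  define \<xi>1 \<xi>2 \<xi>3 :: "real^2" where "\<xi>1 = (\<chi> i. if i = 1 then 1 else 0)" and "\<xi>2 = (\<chi> i. if i = 2 then 1 else 0)"
    and "\<xi>3 = (\<chi> i. 1)"
  have xi: "\<xi>1 $ i \<in> {0,1}" "\<xi>2 $ i \<in> {0,1}" "\<xi>3 $ i \<in> {0,1}" for i
    by (auto simp: \<xi>1_def \<xi>2_def \<xi>3_def)
  have N0: "0 \<le> N" using N by simp
  define b where "b l = amp r (c l)" for l
  have b: "btp (Md * N) (2 * r) (b l)" for l unfolding b_def by (rule amp_btp[OF c N0 r cr])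
  have bsq: "\<bar>c l x - (b l x)\<^sup>2 / 2 - r'\<^sup>2\<bar> \<le> r'\<^sup>2 / (4 * m)" for l x
    unfolding b_def r' by (rule amp_square[OF c N0 r cr])
  define V1 where "V1 = (\<lambda>x. V x + step_fun l1 \<xi>1 (b 1) x)"
  define V2 where "V2 = (\<lambda>x. V1 x + step_fun l2 \<xi>2 (b 2) x)"
  define V3 where "V3 = (\<lambda>x. V2 x + step_fun l3 \<xi>3 (b 3) x)"
  define W1 where "W1 = (\<lambda>i x. W i x + step_field l1 \<xi>1 (b 1) V i x)"
  define W2 where "W2 = (\<lambda>i x. W1 i x + step_field l2 \<xi>2 (b 2) V1 i x)"
  define W3 where "W3 = (\<lambda>i x. W2 i x + step_field l3 \<xi>3 (b 3) V2 i x)"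
  have b1: "m ^ k * r * N \<le> 65 * r * l0" 
  proof -
    have "m ^ k * r * N = r * l0" by (simp add: l0_def)
    then show ?thesis using l0 r by simp
  qed
  have g1: "l0 * m ^ (2 * k + 2) \<le> l1" unfolding l1_def using l0 m by (intro mult_left_mono power_increasing) auto
  note s1 = step_properties[OF V W b N(1) MdN order_trans[OF l0(1) l1'(1)] lnat(1) r xi(1) G(2) B2 l0(3) l0(1) b1 g1 V1_def W1_def]
  have b2: "m ^ k * r * N + 32 * r * l1 \<le> 65 * r * l1"
  proof -
    have "m ^ k * r * N = r * l0" by (simp add: l0_def)
    also have "\<dots> \<le> r * l1" using r l1' by simp
    finally show ?thesis using r l1' by (simp add: algebra_simps)
  qed
  have i2: "Md * N \<le> l2" "N \<le> l1" "N \<le> l2" using MdN l2' l0 l1' by linarith+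
  note s2 = step_properties[OF s1(4) s1(8) b N(1) i2(1) l2'(1) lnat(2) r xi(2) s1(5) s1(6) l1'(2) i2(2) b2 eq_refl[OF l2_def[symmetric]] V2_def W2_def]
  \<comment> \<open>The 65 is 1 + 32 + 32: the old second derivatives and those of two corrugations,
    all measured against \<open>r * l2\<close>.\<close>
  have b3: "m ^ k * r * N + 32 * r * l1 + 32 * r * l2 \<le> 65 * r * l2"
  proof -
    have "m ^ k * r * N = r * l0" by (simp add: l0_def)
    also have "\<dots> \<le> r * l2" using r l1' l2' by simp
    finally have "m ^ k * r * N \<le> r * l2" .
    moreover have "32 * (r * l1) \<le> 32 * (r * l2)" "0 \<le> r * l2" using r l2' by auto
    ultimately show ?thesis by linarith
  qed
  have i3: "Md * N \<le> l3" using i2 l3' by linarith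
  note s3 = step_properties[OF s2(4) s2(8) b N(1) i3 l3'(1) lnat(3) r xi(3) s2(5) s2(6) l2'(3) i2(3) b3 eq_refl[OF l3_def[symmetric]] V3_def W3_def]

  define u where "u x = step_fun l1 \<xi>1 (b 1) x + (step_fun l2 \<xi>2 (b 2) x + step_fun l3 \<xi>3 (b 3) x)" for x
  define w where "w i x = step_field l1 \<xi>1 (b 1) V i x + (step_field l2 \<xi>2 (b 2) V1 i x + step_field l3 \<xi>3 (b 3) V2 i x)" for i x
  have V3: "V3 = (\<lambda>x. V x + u x)" and W3: "W3 = (\<lambda>i x. W i x + w i x)"
    by (simp only: V3_def V2_def V1_def u_def add.assoc)
      (simp only: W3_def W2_def W1_def w_def add.assoc)
  have G0: "0 < G" using r G(1) by linarith
  let ?g3 = "(r\<^sup>2 / 2 + 2 * r * (G + 8 * r + 8 * r))"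
  let ?g2 = "(r\<^sup>2 / 2 + 2 * r * (G + 8 * r))"
  let ?g1 = "(r\<^sup>2 / 2 + 2 * r * G)"
  have frac: "a / l1 \<le> a / N" "a / l2 \<le> a / N" "a / l3 \<le> a / N" if "0 \<le> a" for a
    using that N i2 l1' l2' l3' by (auto intro!: divide_left_mono)
  have u: "incr N' (6 * r / N) (24 * r) (r * N') u"
    unfolding u_def
  proof (rule incr_mono[OF incr_add[OF s1(1) incr_add[OF s2(1) s3(1)]]])
    show "max (2 * l1) (max (2 * l2) (2 * l3)) \<le> N'" using N'big l1' l2' l3' by auto
    show "2 * r / l1 + (2 * r / l2 + 2 * r / l3) \<le> 6 * r / N"
    proof -
      have "6 * r / N = 2 * r / N + (2 * r / N + 2 * r / N)" by (simp add: add_divide_distrib[symmetric])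
      then show ?thesis using frac[of "2 * r"] r by linarith
    qed
    have "32 * r * l1 + (32 * r * l2 + 32 * r * l3) = r * (32 * (l1 + l2 + l3))" by (simp add: algebra_simps)
    also have "\<dots> \<le> r * N'" using N'3 l3' l2' r by (intro mult_left_mono) auto
    finally show "32 * r * l1 + (32 * r * l2 + 32 * r * l3) \<le> r * N'" .
  qed simp
  have w: "incr N' (153 * G * r / N) (1224 * G * r) (3 * G * r * N') (w i)" for i
    unfolding w_def
  proof (rule incr_mono[OF incr_add[OF s1(2) incr_add[OF s2(2) s3(2)]]])
    have g: "r\<^sup>2 / 2 + 2 * r * (G + 8 * r + 8 * r) \<le> 51 * G * r"
       "r\<^sup>2 / 2 + 2 * r * (G + 8 * r) \<le> 51 * G * r" "r\<^sup>2 / 2 + 2 * r * G \<le> 51 * G * r"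
    proof -
      have "r * r \<le> G * r" using G(1) r by (intro mult_right_mono) auto
      then show "r\<^sup>2 / 2 + 2 * r * (G + 8 * r + 8 * r) \<le> 51 * G * r"
       "r\<^sup>2 / 2 + 2 * r * (G + 8 * r) \<le> 51 * G * r" "r\<^sup>2 / 2 + 2 * r * G \<le> 51 * G * r"
        using mult_pos_pos[OF G0 r] by (auto simp: power2_eq_square algebra_simps)
    qed
    have p: "0 \<le> 51 * G * r" using G0 r by simp
    show "max (4 * l1) (max (4 * l2) (4 * l3)) \<le> N'" using N'big by auto
    have "?g1 / l1 + (?g2 / l2 + ?g3 / l3)
       \<le> 51 * G * r / N + (51 * G * r / N + 51 * G * r / N)"
      using l1' l2' l3' by (intro add_mono order_trans[OF divide_right_mono[OF g(1)] frac(3)[OF p]]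
         order_trans[OF divide_right_mono[OF g(2)] frac(2)[OF p]] order_trans[OF divide_right_mono[OF g(3)] frac(1)[OF p]]) auto
    then show "?g1 / l1 + (?g2 / l2 + ?g3 / l3)
      \<le> 153 * G * r / N" by (simp add: add_divide_distrib[symmetric])
    show "8 * ?g1 + (8 * ?g2 + 8 * ?g3) \<le> 1224 * G * r"
    proof -
      have "8 * ?g1 + (8 * ?g2 + 8 * ?g3)
        \<le> 8 * (51 * G * r) + (8 * (51 * G * r) + 8 * (51 * G * r))"
        by (intro add_mono mult_left_mono g) auto
      then show ?thesis by simp
    qed
    have "64 * l1 * ?g1 + (64 * l2 * ?g2 + 64 * l3 * ?g3)
      \<le> 64 * l3 * (51 * G * r) + (64 * l3 * (51 * G * r) + 64 * l3 * (51 * G * r))"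
      using l1' l2' l3' g G0 r by (intro add_mono mult_mono) (auto intro!: add_nonneg_nonneg)
    \<comment> \<open>9792 = 3 * 64 * 51, which stays below 3 * 3360.\<close>
    also have "\<dots> = (G * r) * (9792 * l3)" by (simp add: algebra_simps)
    also have "\<dots> \<le> (G * r) * (3 * N')" using N'3 l3' G0 r by (intro mult_left_mono) auto
    finally show "64 * l1 * ?g1 + (64 * l2 * ?g2 + 64 * l3 * ?g3)
      \<le> 3 * G * r * N'" by (simp add: algebra_simps)
  qed
  define E where "E i j x = step_err l1 \<xi>1 (b 1) V i j x + (step_err l2 \<xi>2 (b 2) V1 i j x + step_err l3 \<xi>3 (b 3) V2 i j x)" for i j x
  have E: "btp N' (r'\<^sup>2 / (4 * m)) (E i j)" for i j
  proof -
    have "btp N' (r'\<^sup>2 / (12 * m) + (r'\<^sup>2 / (12 * m) + r'\<^sup>2 / (12 * m))) (E i j)"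
      unfolding E_def r' using N'big
      by (intro btp_add btp_mono[OF s1(3)] btp_mono[OF s2(3)] btp_mono[OF s3(3)]) auto
    then show ?thesis by (rule btp_mono) auto
  qed
  \<comment> \<open>A symmetric matrix with entries \<open>a11, a12, a22\<close> has the
    coefficients \<open>a11 - a12\<close>, \<open>a22 - a12\<close>, \<open>a12\<close> with respect
    to the squares of the three directions; hence the differences of \<open>E\<close>. The change of
    the pressure is diagonal and enters only the first two. Every index other than 1 and 3 stands
    for 2.\<close>
  define c' where "c' l = (if l = 3 then (\<lambda>x. c 3 x - b 3 x * b 3 x / 2 - E 1 2 x) else if l = 1 then (\<lambda>x. c 1 x - b 1 x * b 1 x / 2 - (E 1 1 x - E 1 2 x) + (q' x - q x))
     else (\<lambda>x. c 2 x - b 2 x * b 2 x / 2 - (E 2 2 x - E 1 2 x) + (q' x - q x)))" for l :: nat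
  have tcb: "tp N' (c l)" "tp N' (\<lambda>x. b l x * b l x / 2)" for l
  proof -
    show "tp N' (c l)" by (rule tp_mono[OF c N'big(5)])
    have "tp N' (\<lambda>x. (1/2) * (b l x * b l x))"
      by (rule tp_cmult, rule tp_mono[OF tp_mult[OF btp_tp[OF b] btp_tp[OF b]]]) (use N'big in linarith)
    then show "tp N' (\<lambda>x. b l x * b l x / 2)" by simp
  qed
  have "stage C N' r' q' V3 W3 c'"
    unfolding stage_def
  proof (intro conjI allI)
    show "tp N' V3" by (rule tp_mono[OF s3(4)]) (use N'big l3' in auto)
    show "tp N' (W3 i)" for i by (rule tp_mono[OF s3(8)]) (use N'big in auto)
    show "tp N' (c' l)" for l
      unfolding c'_def using tcb btp_tp[OF E] btp_tp[OF q'] by (auto intro!: tp_diff tp_add)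
    show "\<bar>c' l x - r'\<^sup>2\<bar> \<le> r'\<^sup>2 / m" for l x
    proof -
      \<comment> \<open>At most four deviations occur, each bounded by a quarter: the square root
        error, two entries of \<open>E\<close>, and the change of the pressure.\<close>
      have h: "r'\<^sup>2 / m = 4 * (r'\<^sup>2 / (4 * m))" by simp
      have bs: "\<bar>c l x - b l x * b l x / 2 - r'\<^sup>2\<bar> \<le> r'\<^sup>2 / (4 * m)" for l using bsq[of l x] by (simp add: power2_eq_square)
      note bd = bs[unfolded abs_le_iff] btp_bound[OF E, unfolded abs_le_iff] btp_bound[OF q', unfolded abs_le_iff]
      consider "l = 3" | "l = 1" | "l \<noteq> 3" "l \<noteq> 1" by blast
      then show ?thesis
      proof cases
        case 1
        then show ?thesis unfolding c'_def h abs_le_iff using bd(1)[of 3] bd(2)[of 1 2 x] by simp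
      next
        case 2
        then show ?thesis unfolding c'_def h abs_le_iff
          using bd(1)[of 1] bd(2)[of 1 2 x] bd(2)[of 1 1 x] bd(3)[of x] by simp
      next
        case 3
        then show ?thesis unfolding c'_def h abs_le_iff
          using bd(1)[of 2] bd(2)[of 1 2 x] bd(2)[of 2 2 x] bd(3)[of x] by simp
      qed
    qed
    show "\<bar>pderiv_at i (pderiv_at j V3) x\<bar> \<le> m ^ k * r' * N'" for i j x
    proof -
      have "\<bar>pderiv_at i (pderiv_at j V3) x\<bar> \<le> m ^ k * r * N + 32 * r * l1 + 32 * r * l2 + 32 * r * l3" by (rule s3(6))
      also have "\<dots> \<le> 65 * r * l2 + 32 * r * l3" using b3 by simp
      also have "\<dots> = r * (65 * l2 + 32 * l3)" by (simp add: algebra_simps)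
      also have "\<dots> \<le> r * N'" using N'3 l3' r by (intro mult_left_mono) auto
      also have "\<dots> = m ^ k * r' * N'" using m by (simp add: r')
      finally show ?thesis .
    qed
    have x12: "(1::2) \<noteq> 2" by simp
    have mix: "mixed_form V3 W3 i j x = mixed_form V W i j x + (b 1 x)\<^sup>2 / 2 * (\<xi>1 $ i * \<xi>1 $ j)
       + (b 2 x)\<^sup>2 / 2 * (\<xi>2 $ i * \<xi>2 $ j) + (b 3 x)\<^sup>2 / 2 * (\<xi>3 $ i * \<xi>3 $ j) + E i j x" for i j x
      unfolding s3(7) s2(7) s1(7) E_def by simp
    show "mixed_form V3 W3 1 1 x + c' 1 x + c' 3 x = q' x + 2 * C" for x
      using eqs(1)[of x] unfolding mix c'_def by (simp add: \<xi>1_def \<xi>2_def \<xi>3_def power2_eq_square)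
    show "mixed_form V3 W3 2 2 x + c' 2 x + c' 3 x = q' x + 2 * C" for x
      using eqs(2)[of x] unfolding mix c'_def by (simp add: \<xi>1_def \<xi>2_def \<xi>3_def power2_eq_square)
    show "mixed_form V3 W3 1 2 x + c' 3 x = C" for x
      using eqs(3)[of x] unfolding mix c'_def by (simp add: \<xi>1_def \<xi>2_def \<xi>3_def power2_eq_square)
  qed
  with u w that show thesis unfolding V3 W3 by blast
qed

end

section \<open>Limits\<close>

lemma tp_bounded: "tp L f \<Longrightarrow> \<exists>B. \<forall>x. \<bar>f x\<bar> \<le> B"
proof (induction rule: tp.induct)
  case (tp_cos k c)
  show ?case by (rule exI[of _ 1]) simp
next
  case (tp_add f g)
  then obtain A B where "\<forall>x. \<bar>f x\<bar> \<le> A" "\<forall>x. \<bar>g x\<bar> \<le> B" by blast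
  then have "\<forall>x. \<bar>f x + g x\<bar> \<le> A + B" by (auto intro!: order_trans[OF abs_triangle_ineq] add_mono)
  then show ?case by blast
next
  case (tp_cmult f c)
  then obtain A where "\<forall>x. \<bar>f x\<bar> \<le> A" by blast
  then have "\<forall>x. \<bar>c * f x\<bar> \<le> \<bar>c\<bar> * A" by (auto simp: abs_mult intro!: mult_left_mono)
  then show ?case by blast
qed

lemma pderiv_lipschitz:
  fixes g :: "real^'n::finite \<Rightarrow> real"
  assumes d: "\<And>x. g differentiable (at x)" and B: "\<And>i x. \<bar>pderiv_at i g x\<bar> \<le> B"
  shows "\<bar>g x - g y\<bar> \<le> real CARD('n) * B * norm (x - y)"
proof -
  let ?g' = "\<lambda>x h. \<Sum>i\<in>UNIV. h $ i *\<^sub>R pderiv_at i g x"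
  have on: "onorm (?g' x) \<le> real CARD('n) * B" for x
  proof (rule onorm_le)
    fix h :: "real^'n"
    have "norm (?g' x h) \<le> (\<Sum>i\<in>UNIV. norm (h $ i *\<^sub>R pderiv_at i g x))" by (rule norm_sum)
    also have "\<dots> \<le> (\<Sum>i\<in>(UNIV::'n set). norm h * B)"
      using B by (intro sum_mono) (auto simp: abs_mult component_le_norm_cart intro!: mult_mono)
    finally show "norm (?g' x h) \<le> real CARD('n) * B * norm h" by (simp add: mult_ac)
  qed
  have "norm (g x - g y) \<le> real CARD('n) * B * norm (x - y)"
    by (rule differentiable_bound[of UNIV g ?g']) (use on frechet_pderiv[OF d] in auto)
  then show ?thesis by simp
qed

text \<open>The interpolation inequality behind the Hoelder bound: the trivial bound and the
  Lipschitz bound are combined into a power.\<close>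

lemma min_le_powr: fixes z :: real assumes "0 \<le> z" "0 < \<alpha>" "\<alpha> \<le> 1" shows "min 1 z \<le> z powr \<alpha>"
proof (cases "z \<le> 1")
  case True
  have "z \<le> z powr \<alpha>"
  proof (cases "z = 0")
    case False
    then have "z powr 1 \<le> z powr \<alpha>" using assms True by (intro powr_mono') auto
    then show ?thesis using assms by simp
  qed simp
  then show ?thesis using assms by auto
next
  case False
  then show ?thesis using assms by (auto intro: ge_one_powr_ge_zero)
qed

text \<open>The differences telescope, and the distance to the limit is dominated by the tail of the
  geometric series.\<close>

lemma geometric_limit:
  fixes a :: "nat \<Rightarrow> real"
  assumes a: "\<And>n. \<bar>a (Suc n) - a n\<bar> \<le> A * \<rho> ^ n" and \<rho>: "0 \<le> \<rho>" "\<rho> < 1"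
  shows "\<exists>l. a \<longlonglongrightarrow> l \<and> (\<forall>n. \<bar>l - a n\<bar> \<le> A * \<rho> ^ n / (1 - \<rho>))"
proof -
  have geo: "(\<lambda>k. A * \<rho> ^ (k + n)) sums (A * \<rho> ^ n / (1 - \<rho>))" for n
    using sums_mult[OF geometric_sums[of \<rho>], of "A * \<rho> ^ n"] \<rho> by (simp add: power_add mult_ac)
  have "summable (\<lambda>n. a (Suc n) - a n)"
    by (rule summable_comparison_test[of _ "\<lambda>n. A * \<rho> ^ n"]) (use a sums_summable[OF geo[of 0]] in auto)
  then have "convergent (\<lambda>n. \<Sum>i<n. a (Suc i) - a i)" by (simp add: summable_iff_convergent)
  then obtain s where "(\<lambda>n. a n - a 0) \<longlonglongrightarrow> s" by (auto simp: sum_lessThan_telescope convergent_def)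
  from tendsto_add[OF this tendsto_const[of "a 0"]] have l: "a \<longlonglongrightarrow> s + a 0" by simp
  have "\<bar>s + a 0 - a n\<bar> \<le> A * \<rho> ^ n / (1 - \<rho>)" for n
  proof -
    have t: "(\<lambda>k. a (Suc k + n) - a (k + n)) sums (s + a 0 - a (0 + n))"
      by (rule telescope_sums) (rule LIMSEQ_ignore_initial_segment[OF l])
    have "summable (\<lambda>k. \<bar>a (Suc k + n) - a (k + n)\<bar>)"
      by (rule summable_comparison_test[of _ "\<lambda>k. A * \<rho> ^ (k + n)"]) (use a[of "_ + n"] sums_summable[OF geo[of n]] in auto)
    then have "\<bar>\<Sum>k. a (Suc k + n) - a (k + n)\<bar> \<le> (\<Sum>k. A * \<rho> ^ (k + n))"
      by (intro order_trans[OF summable_rabs] suminf_le) (use a[of "_ + n"] sums_summable[OF geo[of n]] in auto)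
    then show ?thesis using sums_unique[OF t] sums_unique[OF geo[of n]] by simp
  qed
  with l show ?thesis by blast
qed

lemma C_holder_space_1I:
  fixes f :: "real^'n::finite \<Rightarrow> 'b::real_normed_vector"
  assumes "bounded (range f)" "f differentiable_on UNIV" "\<And>i. pderiv_at i f \<in> C_holder_space 0 \<alpha>"
  shows "f \<in> C_holder_space 1 \<alpha>"
  using assms by simp

text \<open>Gradients converge uniformly at rate \<open>\<rho> ^ n\<close>, so the limit is
  differentiable. The n-th gradient increment between two points at distance \<open>z\<close> is at
  most a constant times \<open>\<rho> ^ n * min 1 (\<sigma> ^ n * z)\<close>, hence times
  \<open>(\<rho> * \<sigma> powr \<alpha>) ^ n * z powr \<alpha>\<close>, which is summable.\<close>

theorem corrugation_limit:
  fixes f :: "nat \<Rightarrow> real^'n::finite \<Rightarrow> real"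
  assumes f0: "tp L (f 0)" and f: "\<And>n x. f (Suc n) x = f n x + u n x"
    and u: "\<And>n. incr (\<Lambda> n) (A0 * \<rho> ^ n) (A1 * \<rho> ^ n) (A2 * (\<rho> * \<sigma>) ^ n) (u n)"
    and \<rho>: "0 < \<rho>" "\<rho> < 1" and \<sigma>: "0 < \<sigma>" and \<alpha>: "0 < \<alpha>" "\<alpha> \<le> 1" and \<rho>\<sigma>: "\<rho> * \<sigma> powr \<alpha> < 1"
  obtains F where "F \<in> C_holder_space 1 \<alpha>" "\<And>x. \<bar>F x - f 0 x\<bar> \<le> A0 / (1 - \<rho>)"
    "\<And>i x. (\<lambda>n. pderiv_at i (f n) x) \<longlonglongrightarrow> pderiv_at i F x"
proof -
  let ?A = "\<lambda>n. A1 * \<rho> ^ n / (1 - \<rho>)"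
  let ?n = "real CARD('n)"
  have tu: "tp (\<Lambda> n) (u n)" for n using u by (auto simp: incr_def)
  have f': "f (Suc n) = (\<lambda>x. f n x + u n x)" for n using f by auto
  have "\<exists>L. tp L (f n)" for n
  proof (induction n)
    case (Suc n)
    then obtain L where "tp L (f n)" by blast
    then have "tp (max L (\<Lambda> n)) (f n)" "tp (max L (\<Lambda> n)) (u n)"
      using tp_mono[OF _ max.cobounded1] tp_mono[OF tu max.cobounded2] by blast+
    then have "tp (max L (\<Lambda> n)) (f (Suc n))" unfolding f' by (rule tp_add)
    then show ?case by blast
  qed (use f0 in blast)
  then obtain LL where tf: "tp (LL n) (f n)" for n by metis
  have df: "pderiv_at i (f (Suc n)) x - pderiv_at i (f n) x = pderiv_at i (u n) x" for i n x
    unfolding f' tp_pderiv_add[OF tf tu] by simp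
  have c0: "\<bar>f (Suc n) x - f n x\<bar> \<le> A0 * \<rho> ^ n" for n x using u by (simp add: f incr_def)
  have c1: "\<bar>pderiv_at i (f (Suc n)) x - pderiv_at i (f n) x\<bar> \<le> A1 * \<rho> ^ n" for i n x
    using u unfolding df by (simp add: incr_def)
  have "\<bar>pderiv_at i (u 0) x\<bar> \<le> A1" "\<bar>pderiv_at i (pderiv_at i (u 0)) x\<bar> \<le> A2" for i x
    using u[of 0] by (auto simp: incr_def)
  then have A1: "0 \<le> A1" and A2: "0 \<le> A2" by (meson abs_ge_zero order_trans)+
  have "\<exists>l. (\<lambda>n. f n x) \<longlonglongrightarrow> l \<and> (\<forall>n. \<bar>l - f n x\<bar> \<le> A0 * \<rho> ^ n / (1 - \<rho>))" for x
    by (rule geometric_limit[OF c0[of _ x]]) (use \<rho> in auto)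
  then obtain F where F: "\<And>x. (\<lambda>n. f n x) \<longlonglongrightarrow> F x" "\<And>x n. \<bar>F x - f n x\<bar> \<le> A0 * \<rho> ^ n / (1 - \<rho>)" by metis
  have "\<exists>l. (\<lambda>n. pderiv_at i (f n) x) \<longlonglongrightarrow> l \<and> (\<forall>n. \<bar>l - pderiv_at i (f n) x\<bar> \<le> ?A n)" for i x
    by (rule geometric_limit[OF c1[of i _ x]]) (use \<rho> in auto)
  then obtain g where g: "\<And>i x. (\<lambda>n. pderiv_at i (f n) x) \<longlonglongrightarrow> g i x"
    "\<And>i x n. \<bar>g i x - pderiv_at i (f n) x\<bar> \<le> ?A n" by metis
  let ?g' = "\<lambda>x h. \<Sum>i\<in>UNIV. h $ i *\<^sub>R g i x" and ?f' = "\<lambda>n x h. \<Sum>i\<in>UNIV. h $ i *\<^sub>R pderiv_at i (f n) x"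
  have lim0: "(\<lambda>n. ?n * (?A n)) \<longlonglongrightarrow> 0"
    using LIMSEQ_realpow_zero[of \<rho>] \<rho> by (auto intro!: tendsto_eq_intros)
  have "\<exists>G. \<forall>x\<in>UNIV. (\<lambda>n. f n x) \<longlonglongrightarrow> G x \<and> (G has_derivative ?g' x) (at x within UNIV)"
  proof (rule has_derivative_sequence)
    show "(f n has_derivative ?f' n x) (at x within UNIV)" for n x
      using frechet_pderiv[OF tp_differentiable[OF tf]] by simp
    show "(\<lambda>n. f n 0) \<longlonglongrightarrow> F 0" by (rule F)
    fix e :: real assume "e > 0"
    from order_tendstoD(2)[OF lim0 this]
    show "\<forall>\<^sub>F n in sequentially. \<forall>x\<in>UNIV. \<forall>h. norm (?f' n x h - ?g' x h) \<le> e * norm h"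
    proof eventually_elim
      case (elim n)
      show ?case
      proof (intro ballI allI)
        fix x h :: "real^'n"
        have "norm (?f' n x h - ?g' x h) = norm (\<Sum>i\<in>UNIV. h $ i *\<^sub>R (pderiv_at i (f n) x - g i x))"
          by (simp add: sum_subtractf right_diff_distrib)
        also have "\<dots> \<le> (\<Sum>i\<in>UNIV. norm (h $ i *\<^sub>R (pderiv_at i (f n) x - g i x)))" by (rule norm_sum)
        also have "\<dots> \<le> (\<Sum>i\<in>(UNIV::'n set). norm h * (?A n))"
        proof (rule sum_mono)
          fix i
          have "\<bar>pderiv_at i (f n) x - g i x\<bar> \<le> ?A n"
            using g(2)[of i x n] by (simp only: abs_minus_commute)
          then show "norm (h $ i *\<^sub>R (pderiv_at i (f n) x - g i x)) \<le> norm h * (?A n)"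
            by (simp only: real_norm_def real_scaleR_def abs_mult) (intro mult_mono component_le_norm_cart, auto)
        qed
        also have "\<dots> = ?n * (?A n) * norm h" by simp
        also have "\<dots> \<le> e * norm h" using elim by (intro mult_right_mono) auto
        finally show "norm (?f' n x h - ?g' x h) \<le> e * norm h" .
      qed
    qed
  qed auto
  then obtain G where G: "\<And>x. (\<lambda>n. f n x) \<longlonglongrightarrow> G x" "\<And>x. (G has_derivative ?g' x) (at x)" by auto
  have "G = F" using F(1) G(1) LIMSEQ_unique by blast
  then have F': "(F has_derivative ?g' x) (at x)" for x using G by simp
  have pF: "pderiv_at i F x = g i x" for i x
  proof -
    have "pderiv_at i F x = (\<Sum>i'\<in>UNIV. axis i 1 $ i' *\<^sub>R g i' x)" by (rule pderiv_atI[OF F'])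
    also have "\<dots> = (\<Sum>i'\<in>UNIV. if i' = i then g i' x else 0)" by (intro sum.cong) (auto simp: axis_def)
    finally show ?thesis by simp
  qed
  obtain B0 where B0: "\<And>x. \<bar>f 0 x\<bar> \<le> B0" using tp_bounded[OF f0] by blast
  have Fb: "\<bar>F x - f 0 x\<bar> \<le> A0 / (1 - \<rho>)" for x using F(2)[of x 0] by simp
  have "\<bar>F x\<bar> \<le> B0 + A0 / (1 - \<rho>)" for x using Fb[of x] B0[of x] by linarith
  then have bF: "bounded (range F)" by (intro boundedI[of _ "B0 + A0 / (1 - \<rho>)"]) auto
  define \<kappa> where "\<kappa> = \<rho> * \<sigma> powr \<alpha>"
  have \<kappa>: "0 \<le> \<kappa>" "\<kappa> < 1" using \<rho> \<rho>\<sigma> by (auto simp: \<kappa>_def)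
  have "g i \<in> C_holder_space 0 \<alpha>" for i
  proof -
    obtain B1 where B1: "\<And>x. \<bar>pderiv_at i (f 0) x\<bar> \<le> B1" using tp_bounded[OF tp_pderiv[OF f0]] by blast
    have "\<exists>B. \<forall>x. \<bar>pderiv_at j (pderiv_at i (f 0)) x\<bar> \<le> B" for j
      using tp_bounded[OF tp_pderiv[OF tp_pderiv[OF f0]]] .
    then obtain B2' where B2': "\<And>j x. \<bar>pderiv_at j (pderiv_at i (f 0)) x\<bar> \<le> B2' j" by metis
    define B2 where "B2 = (\<Sum>j\<in>UNIV. B2' j)"
    have "0 \<le> B2' j" for j using B2'[of j 0] by linarith
    then have "B2' j \<le> B2" for j unfolding B2_def by (intro member_le_sum) auto
    then have B2: "\<bar>pderiv_at j (pderiv_at i (f 0)) x\<bar> \<le> B2" for j x using B2'[of j x] order_trans by blast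
    have B20: "0 \<le> B2" "0 \<le> B1" using B2 B1 by (meson abs_ge_zero order_trans)+
    have "\<bar>g i x\<bar> \<le> B1 + A1 / (1 - \<rho>)" for x using g(2)[of i x 0] B1[of x] by simp
    then have bg: "bounded (range (g i))" by (intro boundedI[of _ "B1 + A1 / (1 - \<rho>)"]) auto
    define M where "M = 2 * A1 + ?n * A2"
    define D where "D = 2 * B1 + ?n * B2"
    \<comment> \<open>Used with \<open>c0 = \<rho> ^ n\<close>, \<open>s = \<sigma> ^ n\<close> for
      the increments and with \<open>c0 = s = 1\<close> for the starting function.\<close>
    have hol: "min (2 * a) (?n * b * z) \<le> (2 * a' + ?n * b') * c"
      if "a = a' * c0" "b = b' * (c0 * s)" "0 \<le> a'" "0 \<le> b'" "0 < c0" "0 < s" "0 \<le> z" "c = c0 * (s * z) powr \<alpha>" for a b z a' b' c c0 s :: real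
    proof -
      have "min (2 * a) (?n * b * z) \<le> (2 * a' + ?n * b') * (c0 * min 1 (s * z))"
      proof (cases "s * z \<le> 1")
        case True
        have "?n * b * z = ?n * b' * (c0 * (s * z))" using that by simp
        also have "\<dots> \<le> (2 * a' + ?n * b') * (c0 * (s * z))"
          using that by (intro mult_right_mono) auto
        finally show ?thesis using True by (simp add: min_def)
      next
        case False
        have "2 * a = 2 * a' * (c0 * 1)" using that by simp
        also have "\<dots> \<le> (2 * a' + ?n * b') * (c0 * 1)"
          using that by (intro mult_right_mono) auto
        finally show ?thesis using False by (simp add: min_def)
      qed
      also have "\<dots> \<le> (2 * a' + ?n * b') * (c0 * (s * z) powr \<alpha>)"
        using that \<alpha> by (intro mult_left_mono min_le_powr) auto
      finally show ?thesis using that by simp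
    qed
    have "\<bar>g i x - g i y\<bar> \<le> (D + M / (1 - \<kappa>)) * norm (x - y) powr \<alpha>" for x y
    proof -
      define z where "z = norm (x - y)"
      define b where "b n = pderiv_at i (f n) x - pderiv_at i (f n) y" for n
      have "\<bar>b 0\<bar> \<le> min (2 * B1) (?n * B2 * z)"
        using pderiv_lipschitz[OF tp_differentiable[OF tp_pderiv[OF f0]] B2, of x y] B1[of x] B1[of y]
        unfolding b_def z_def by (auto intro: min.boundedI)
      also have "\<dots> \<le> D * z powr \<alpha>"
        unfolding D_def by (rule hol[of _ _ 1 _ _ 1]) (use B20 in \<open>auto simp: z_def\<close>)
      finally have b0: "\<bar>b 0\<bar> \<le> D * z powr \<alpha>" .
      have "\<bar>b (Suc n) - b n\<bar> \<le> (M * z powr \<alpha>) * \<kappa> ^ n" for n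
      proof -
        have e: "b (Suc n) - b n = pderiv_at i (u n) x - pderiv_at i (u n) y"
          using df[of i n x] df[of i n y] unfolding b_def by linarith
        have "\<bar>b (Suc n) - b n\<bar> \<le> min (2 * (A1 * \<rho> ^ n)) (?n * (A2 * (\<rho> * \<sigma>) ^ n) * z)"
          unfolding e z_def
        proof (intro min.boundedI)
          have h: "\<bar>pderiv_at i (u n) x\<bar> \<le> A1 * \<rho> ^ n" for x using u by (auto simp: incr_def)
          show "\<bar>pderiv_at i (u n) x - pderiv_at i (u n) y\<bar> \<le> 2 * (A1 * \<rho> ^ n)"
            using h[of x] h[of y] by linarith
          show "\<bar>pderiv_at i (u n) x - pderiv_at i (u n) y\<bar> \<le> ?n * (A2 * (\<rho> * \<sigma>) ^ n) * norm (x - y)"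
            by (rule pderiv_lipschitz[OF tp_differentiable[OF tp_pderiv[OF tu]]]) (use u in \<open>auto simp: incr_def\<close>)
        qed
        also have "\<dots> \<le> M * (\<rho> ^ n * (\<sigma> ^ n * z) powr \<alpha>)"
          unfolding M_def by (rule hol[of _ _ "\<rho> ^ n" _ _ "\<sigma> ^ n"]) (use A1 A2 \<rho> \<sigma> in \<open>auto simp: z_def power_mult_distrib\<close>)
        also have "\<rho> ^ n * (\<sigma> ^ n * z) powr \<alpha> = z powr \<alpha> * \<kappa> ^ n"
          using \<sigma> by (simp add: \<kappa>_def powr_mult power_mult_distrib powr_powr z_def flip: powr_realpow)
             (simp add: mult_ac)
        finally show ?thesis by (simp add: mult_ac)
      qed
      then obtain l where l: "b \<longlonglongrightarrow> l" "\<And>n. \<bar>l - b n\<bar> \<le> (M * z powr \<alpha>) * \<kappa> ^ n / (1 - \<kappa>)"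
        using geometric_limit[of b "M * z powr \<alpha>" \<kappa>] \<kappa> by blast
      have "b \<longlonglongrightarrow> g i x - g i y" unfolding b_def by (intro tendsto_diff g)
      with l have "l = g i x - g i y" using LIMSEQ_unique by blast
      with l(2)[of 0] b0 have "\<bar>g i x - g i y\<bar> \<le> D * z powr \<alpha> + M * z powr \<alpha> / (1 - \<kappa>)" by simp
      then show ?thesis by (simp add: z_def algebra_simps)
    qed
    then show ?thesis using bg by auto
  qed
  moreover have "pderiv_at i F = g i" for i using pF by auto
  ultimately have "F \<in> C_holder_space 1 \<alpha>"
    using differentiableI[OF F'] by (intro C_holder_space_1I bF) (auto intro: differentiable_at_imp_differentiable_on)
  then show thesis using that[of F] Fb g(1) pF by simp
qed

text \<open>The matrix equation with right-hand side \<open>Q Id + C H\<close>, where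
  \<open>H\<close> has diagonal entries 2 and off-diagonal entries 1. The remaining entry follows by
  symmetry of \<open>mixed_form\<close>.\<close>

definition mixed_solution :: "real \<Rightarrow> (real^2 \<Rightarrow> real) \<Rightarrow> real \<Rightarrow> (real^2 \<Rightarrow> real) \<Rightarrow> (2 \<Rightarrow> real^2 \<Rightarrow> real) \<Rightarrow> bool" where
  "mixed_solution \<alpha> Q C V W \<longleftrightarrow> V \<in> C_holder_space 1 \<alpha> \<and> (\<forall>i. W i \<in> C_holder_space 1 \<alpha>) \<and>
     (\<forall>x. mixed_form V W 1 1 x = Q x + 2 * C \<and> mixed_form V W 2 2 x = Q x + 2 * C \<and> mixed_form V W 1 2 x = C)"

text \<open>Stages are repeated with \<open>N n = N0 * \<sigma> ^ n\<close> and
  \<open>r n = r0 * \<rho> ^ n\<close>. Hypothesis \<open>k0\<close> is exactly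
  \<open>\<rho> * \<sigma> powr \<alpha> < 1\<close>. Increments carry the factor
  \<open>1 / N n\<close>, so the total displacement is of order \<open>1 / N0\<close>.\<close>

lemma (in ci_params) iteration:
  assumes k0: "\<alpha> * real (7 * k + 7 + j0) < real k" and \<alpha>: "0 < \<alpha>" "\<alpha> \<le> 1"
    and N0: "1 \<le> N0" "N0 \<in> \<nat>" and r0: "0 < r0"
    and S0: "stage C N0 r0 (q 0) V0 (\<lambda>i x. 0) c0" and G0: "\<And>i x. \<bar>pderiv_at i V0 x\<bar> \<le> r0"
    and q: "\<And>n. btp (N0 * (m ^ (7 * k + 7 + j0)) ^ Suc n) ((r0 * (1 / m ^ k) ^ Suc n)\<^sup>2 / (4 * m)) (\<lambda>x. q (Suc n) x - q n x)"
    and Q: "\<And>x. (\<lambda>n. q n x) \<longlonglongrightarrow> Q x"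
  obtains V W where "mixed_solution \<alpha> Q C V W"
    "\<forall>x. \<bar>V x - V0 x\<bar> \<le> 12 * r0 / N0" "\<forall>i x. \<bar>W i x\<bar> \<le> 15300 * r0\<^sup>2 / N0"
proof -
  define \<rho> where "\<rho> = 1 / m ^ k"
  define \<sigma> where "\<sigma> = m ^ (7 * k + 7 + j0)"
  define N where "N n = N0 * \<sigma> ^ n" for n
  define r where "r n = r0 * \<rho> ^ n" for n
  have \<rho>: "0 < \<rho>" "\<rho> < 1" "\<rho> \<le> 1/2"
    using m_le_power[of k] k_pos m by (auto simp: \<rho>_def divide_le_eq less_divide_eq_1 field_simps)
  have \<sigma>: "1 \<le> \<sigma>" "\<sigma> \<in> \<nat>"
  proof -
    have "m ^ n \<in> \<nat>" for n using m_nat by (induction n) (auto intro: Nats_mult)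
    then show "\<sigma> \<in> \<nat>" by (simp only: \<sigma>_def)
  qed (simp add: \<sigma>_def m_power_ge)
  have \<rho>\<sigma>: "\<rho> * \<sigma> powr \<alpha> < 1"
  proof -
    have "\<sigma> powr \<alpha> = m powr (\<alpha> * real (7 * k + 7 + j0))"
      unfolding \<sigma>_def using m by (simp add: powr_powr mult.commute flip: powr_realpow)
    also have "\<dots> < m powr real k" using k0 m by (intro powr_less_mono) auto
    also have "\<dots> = m ^ k" using m by (simp add: powr_realpow)
    finally show ?thesis using m by (simp add: \<rho>_def)
  qed
  have NS: "N (Suc n) = N n * m ^ (7 * k + 7 + j0)" and rS: "r (Suc n) = r n / m ^ k" for n
    by (simp_all add: N_def r_def \<sigma>_def \<rho>_def)
  have N: "1 \<le> N n" "N n \<in> \<nat>" for n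
  proof -
    have "1 * 1 \<le> N0 * \<sigma> ^ n" using N0 \<sigma> by (intro mult_mono one_le_power) auto
    then show "1 \<le> N n" by (simp add: N_def)
    have "\<sigma> ^ n \<in> \<nat>" using \<sigma> by (induction n) (auto intro: Nats_mult)
    then show "N n \<in> \<nat>" unfolding N_def by (rule Nats_mult[OF N0(2)])
  qed
  have r: "0 < r n" "r n \<le> r0" for n
    using r0 \<rho> mult_left_le[of "\<rho> ^ n" r0] by (auto simp: r_def power_le_one)
  have rhalf: "r (Suc n) \<le> r n / 2" for n
    using mult_left_mono[OF \<rho>(3), of "r0 * \<rho> ^ n"] r0 \<rho> by (simp add: r_def mult_ac)
  let ?J = "\<lambda>n. incr (N (Suc n)) (6 * r n / N n) (24 * r n) (r n * N (Suc n))"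
  let ?K = "\<lambda>n. incr (N (Suc n)) (153 * (50 * r0) * r n / N n) (1224 * (50 * r0) * r n) (3 * (50 * r0) * r n * N (Suc n))"
  \<comment> \<open>The gradient bound \<open>50 * r0 - 48 * r n\<close> reproduces itself: a stage
    adds at most \<open>24 * r n\<close>, and this is at most \<open>48 * (r n - r (Suc n))\<close>
    as \<open>r\<close> at least halves. The uniform bound \<open>50 * r0\<close> then serves as
    \<open>G\<close>.\<close>
  define PP where "PP n t = (case t of (V, W, c) \<Rightarrow> stage C (N n) (r n) (q n) V W c \<and>
     (\<forall>i x. \<bar>pderiv_at i V x\<bar> \<le> 50 * r0 - 48 * r n) \<and> (n = 0 \<longrightarrow> V = V0 \<and> W = (\<lambda>i x. 0)))" for n :: nat and t :: "(real^2 \<Rightarrow> real) \<times> (2 \<Rightarrow> real^2 \<Rightarrow> real) \<times> (nat \<Rightarrow> real^2 \<Rightarrow> real)"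
  define QQ where "QQ n t t' = (case t of (V, W, c) \<Rightarrow> case t' of (V', W', c') \<Rightarrow> 
     ?J n (\<lambda>x. V' x - V x) \<and>
     (\<forall>i. ?K n (\<lambda>x. W' i x - W i x)))" for n :: nat and t t' :: "(real^2 \<Rightarrow> real) \<times> (2 \<Rightarrow> real^2 \<Rightarrow> real) \<times> (nat \<Rightarrow> real^2 \<Rightarrow> real)"
  have "\<exists>f. \<forall>n. PP n (f n) \<and> QQ n (f n) (f (Suc n))"
  proof (rule dependent_nat_choice)
    have "\<bar>pderiv_at i V0 x\<bar> \<le> 50 * r0 - 48 * r 0" for i x using G0[of i x] r0 by (simp add: r_def)
    with S0 show "\<exists>t. PP 0 t" unfolding PP_def by (intro exI[of _ "(V0, (\<lambda>i x. 0), c0)"]) (simp add: N_def r_def)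
  next
    fix t n assume t: "PP n t"
    obtain V W c where [simp]: "t = (V, W, c)" by (cases t)
    from t have S: "stage C (N n) (r n) (q n) V W c" and G: "\<And>i x. \<bar>pderiv_at i V x\<bar> \<le> 50 * r0 - 48 * r n"
      by (auto simp: PP_def)
    have tV: "tp (N n) V" using S by (simp add: stage_def)
    have G': "\<bar>pderiv_at i V x\<bar> \<le> 50 * r0" for i x using G[of i x] r[of n] by linarith
    have rG: "r n \<le> 50 * r0" using r[of n] r0 by linarith
    have q': "btp (N (Suc n)) ((r (Suc n))\<^sup>2 / (4 * m)) (\<lambda>x. q (Suc n) x - q n x)"
      using q[of n] by (simp add: N_def r_def \<rho>_def \<sigma>_def)
    obtain u w c' where uwc: "stage C (N (Suc n)) (r (Suc n)) (q (Suc n)) (\<lambda>x. V x + u x) (\<lambda>i x. W i x + w i x) c'"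
      "?J n u"
      "\<And>i. ?K n (w i)"
      by (rule stage_step[OF S N r(1) rG G' NS rS q']) (rule that, assumption, assumption, simp only:)
    have tu: "tp (N (Suc n)) u" using uwc by (simp add: incr_def)
    have "\<bar>pderiv_at i (\<lambda>x. V x + u x) x\<bar> \<le> 50 * r0 - 48 * r (Suc n)" for i x
    proof -
      have "\<bar>pderiv_at i u x\<bar> \<le> 24 * r n" using uwc(2) by (simp add: incr_def)
      then show ?thesis unfolding tp_pderiv_add[OF tV tu] using G[of i x] rhalf[of n] by linarith
    qed
    with uwc show "\<exists>t'. PP (Suc n) t' \<and> QQ n t t'"
      unfolding PP_def QQ_def by (intro exI[of _ "((\<lambda>x. V x + u x), (\<lambda>i x. W i x + w i x), c')"]) auto
  qed
  then obtain f where f: "\<And>n. PP n (f n)" "\<And>n. QQ n (f n) (f (Suc n))" by blast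
  define V where "V n = fst (f n)" for n
  define W where "W n = fst (snd (f n))" for n
  define c where "c n = snd (snd (f n))" for n
  have S: "stage C (N n) (r n) (q n) (V n) (W n) (c n)" and init: "V 0 = V0" "W 0 = (\<lambda>i x. 0)" for n
    using f(1)[of n] f(1)[of 0] by (auto simp: PP_def V_def W_def c_def split: prod.splits)
  define u where "u n x = V (Suc n) x - V n x" for n x
  define w where "w n i x = W (Suc n) i x - W n i x" for n i x
  have uw: "V (Suc n) x = V n x + u n x" "W (Suc n) i x = W n i x + w n i x"
     "?J n (u n)"
     "?K n (w n i)" for n i x
    using f(2)[of n] by (simp_all add: QQ_def V_def W_def u_def[abs_def] w_def[abs_def] split: prod.splits)
  have rN: "a * r n / N n \<le> a * r0 / N0 * \<rho> ^ n" if "0 \<le> a" for a n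
  proof -
    have "a * r n / N n \<le> a * r n / N0"
    proof (rule divide_left_mono)
      have "N0 * 1 \<le> N0 * \<sigma> ^ n" using N0 \<sigma> by (intro mult_left_mono one_le_power) auto
      then show "N0 \<le> N n" by (simp add: N_def)
    qed (use that r[of n] N0 N(1)[of n] in auto)
    then show ?thesis by (simp add: r_def)
  qed
  have u': "incr (N (Suc n)) (6 * r0 / N0 * \<rho> ^ n) (24 * r0 * \<rho> ^ n) (r0 * N0 * \<sigma> * (\<rho> * \<sigma>) ^ n) (u n)" for n
    by (rule incr_mono[OF uw(3)]) (use rN[of 6 n] in \<open>auto simp: r_def N_def power_mult_distrib mult_ac\<close>)
  have w': "incr (N (Suc n)) (7650 * r0 * r0 / N0 * \<rho> ^ n) (61200 * r0 * r0 * \<rho> ^ n) (150 * r0 * r0 * N0 * \<sigma> * (\<rho> * \<sigma>) ^ n) (w n i)" for n i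
    by (rule incr_mono[OF uw(4)]) (use rN[of "153 * (50 * r0)" n] r0 in \<open>auto simp: r_def N_def power_mult_distrib mult_ac\<close>)
  have \<sigma>0: "0 < \<sigma>" using \<sigma> by linarith
  have tV0: "tp N0 (V 0)" using S0 init by (simp add: stage_def)
  obtain VV where VV: "VV \<in> C_holder_space 1 \<alpha>" "\<And>x. \<bar>VV x - V 0 x\<bar> \<le> 6 * r0 / N0 / (1 - \<rho>)"
    "\<And>i x. (\<lambda>n. pderiv_at i (V n) x) \<longlonglongrightarrow> pderiv_at i VV x"
    by (rule corrugation_limit[OF tV0 uw(1) u' \<rho>(1,2) \<sigma>0 \<alpha> \<rho>\<sigma>]) (rule that, assumption, simp only:, simp only:)
  have "\<exists>F. F \<in> C_holder_space 1 \<alpha> \<and> (\<forall>x. \<bar>F x - W 0 i x\<bar> \<le> 7650 * r0 * r0 / N0 / (1 - \<rho>)) \<and>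
    (\<forall>j x. (\<lambda>n. pderiv_at j (W n i) x) \<longlonglongrightarrow> pderiv_at j F x)" for i
  proof -
    have "tp N0 (W 0 i)" using N0 by (simp add: init tp_const)
    obtain F where "F \<in> C_holder_space 1 \<alpha>" "\<And>x. \<bar>F x - W 0 i x\<bar> \<le> 7650 * r0 * r0 / N0 / (1 - \<rho>)"
      "\<And>j x. (\<lambda>n. pderiv_at j (W n i) x) \<longlonglongrightarrow> pderiv_at j F x"
      by (rule corrugation_limit[of N0 "\<lambda>n. W n i", OF \<open>tp N0 (W 0 i)\<close> uw(2) w' \<rho>(1,2) \<sigma>0 \<alpha> \<rho>\<sigma>])
        (rule that, assumption, simp only:, simp only:)
    then show ?thesis by blast
  qed
  then obtain WW where WW: "\<And>i. WW i \<in> C_holder_space 1 \<alpha>" "\<And>i x. \<bar>WW i x - W 0 i x\<bar> \<le> 7650 * r0 * r0 / N0 / (1 - \<rho>)"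
    "\<And>i j x. (\<lambda>n. pderiv_at j (W n i) x) \<longlonglongrightarrow> pderiv_at j (WW i) x" by metis
  \<comment> \<open>From \<open>\<rho> \<le> 1/2\<close> the geometric sums cost a factor 2: 12 = 2
    * 6 and 15300 = 2 * 7650, where 7650 = 153 * 50.\<close>
  have frac: "a / N0 / (1 - \<rho>) \<le> 2 * a / N0" if "0 \<le> a" for a
  proof -
    have "a / N0 / (1 - \<rho>) \<le> a / N0 / (1 / 2)" using that N0 \<rho> by (intro divide_left_mono) auto
    then show ?thesis by (simp add: mult.commute)
  qed
  have lim: "(\<lambda>n. mixed_form (V n) (W n) i j x) \<longlonglongrightarrow> mixed_form VV WW i j x" for i j x
    unfolding mixed_form_def by (intro tendsto_intros VV WW)
  have r2: "(\<lambda>n. (r n)\<^sup>2 + (r n)\<^sup>2 / m) \<longlonglongrightarrow> 0"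
  proof -
    have "r \<longlonglongrightarrow> r0 * 0" unfolding r_def using \<rho> by (intro tendsto_intros LIMSEQ_realpow_zero) auto
    then show ?thesis using m by (auto intro!: tendsto_eq_intros)
  qed
  \<comment> \<open>The coefficients vanish in the limit because they are comparable to
    \<open>(r n)\<^sup>2\<close>; the stage identities then become the exact equation.\<close>
  have cl: "(\<lambda>n. c n l x) \<longlonglongrightarrow> 0" for l x
  proof (rule Lim_null_comparison[OF _ r2], rule always_eventually, rule allI)
    fix n
    have "\<bar>c n l x - (r n)\<^sup>2\<bar> \<le> (r n)\<^sup>2 / m" using S[of n] by (simp add: stage_def)
    then show "norm (c n l x) \<le> (r n)\<^sup>2 + (r n)\<^sup>2 / m" using zero_le_power2[of "r n"] unfolding real_norm_def by linarith
  qed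
  have eq: "mixed_form (V n) (W n) 1 1 x + c n 1 x + c n 3 x = q n x + 2 * C"
    "mixed_form (V n) (W n) 2 2 x + c n 2 x + c n 3 x = q n x + 2 * C" "mixed_form (V n) (W n) 1 2 x + c n 3 x = C" for n x
    using S[of n] unfolding stage_def by blast+
  have bV: "\<bar>VV x - V0 x\<bar> \<le> 12 * r0 / N0" for x using VV(2)[of x] frac[of "6 * r0"] r0 by (simp add: init)
  have bW: "\<bar>WW i x\<bar> \<le> 15300 * r0\<^sup>2 / N0" for i x
      using WW(2)[of i x] frac[of "7650 * r0 * r0"] r0 by (simp add: init power2_eq_square)
  have lims: "mixed_form VV WW 1 1 x = Q x + 2 * C \<and> mixed_form VV WW 2 2 x = Q x + 2 * C \<and> mixed_form VV WW 1 2 x = C" for x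
  proof (intro conjI)
    have "(\<lambda>n. mixed_form (V n) (W n) 1 1 x + c n 1 x + c n 3 x) \<longlonglongrightarrow> mixed_form VV WW 1 1 x + 0 + 0" by (intro tendsto_intros lim cl)
    moreover have "(\<lambda>n. q n x + 2 * C) \<longlonglongrightarrow> Q x + 2 * C" by (intro tendsto_intros Q)
    ultimately show "mixed_form VV WW 1 1 x = Q x + 2 * C" unfolding eq using LIMSEQ_unique by fastforce
    have "(\<lambda>n. mixed_form (V n) (W n) 2 2 x + c n 2 x + c n 3 x) \<longlonglongrightarrow> mixed_form VV WW 2 2 x + 0 + 0" by (intro tendsto_intros lim cl)
    moreover have "(\<lambda>n. q n x + 2 * C) \<longlonglongrightarrow> Q x + 2 * C" by (intro tendsto_intros Q)
    ultimately show "mixed_form VV WW 2 2 x = Q x + 2 * C" unfolding eq using LIMSEQ_unique by fastforce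
    have "(\<lambda>n. mixed_form (V n) (W n) 1 2 x + c n 3 x) \<longlonglongrightarrow> mixed_form VV WW 1 2 x + 0" by (intro tendsto_intros lim cl)
    then have "(\<lambda>n. C) \<longlonglongrightarrow> mixed_form VV WW 1 2 x" unfolding eq by simp
    then show "mixed_form VV WW 1 2 x = C" using LIMSEQ_unique tendsto_const by blast
  qed
  show thesis
    by (rule that[of VV WW]) (use bV bW lims VV(1) WW(1) in \<open>simp_all only: mixed_solution_def, simp_all\<close>)
qed

section \<open>Solutions on the torus\<close>

text \<open>For \<open>s = 7 * k + 7 + j0\<close> the requirements are
  \<open>\<alpha> * s < k\<close> and \<open>2 * k \<le> \<beta> * s\<close>. Choosing
  \<open>s\<close> close to \<open>\<mu> * k\<close> with \<open>\<mu> = max 7 (2 / \<beta>)\<close>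
  works since \<open>\<mu> * \<alpha> < 1\<close>.\<close>

lemma exponents_exist:
  fixes \<alpha> \<beta> :: real
  assumes "0 < \<alpha>" "\<alpha> < 1/7" "\<alpha> < \<beta> / 2" "0 < \<beta>"
  obtains k j0 :: nat where "1 \<le> k" "\<alpha> * real (7 * k + 7 + j0) < real k" "2 * real k \<le> \<beta> * real (7 * k + 7 + j0)"
proof -
  define \<mu> where "\<mu> = max 7 (2 / \<beta>)"
  have \<mu>: "7 \<le> \<mu>" "2 / \<beta> \<le> \<mu>" by (auto simp: \<mu>_def)
  have "\<mu> * \<alpha> < 1" using assms by (auto simp: \<mu>_def max_def field_simps)
  \<comment> \<open>The 8 is the overhead 7 in \<open>s\<close> plus 1 for rounding; a large
    \<open>k\<close> absorbs it.\<close>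
  then obtain k :: nat where k: "8 * \<alpha> / (1 - \<mu> * \<alpha>) < real k" using reals_Archimedean2 by blast
  then have k1: "8 * \<alpha> + \<mu> * \<alpha> * real k < real k" using \<open>\<mu> * \<alpha> < 1\<close> by (simp add: field_simps)
  have "0 \<le> 8 * \<alpha> / (1 - \<mu> * \<alpha>)" using assms \<open>\<mu> * \<alpha> < 1\<close> by simp
  with k have k0: "1 \<le> k" by linarith
  define s where "s = nat \<lceil>\<mu> * real k\<rceil> + 7"
  have mk: "7 * real k \<le> \<mu> * real k" using \<mu> by (intro mult_right_mono) auto
  have s: "\<mu> * real k + 7 \<le> real s" "real s \<le> \<mu> * real k + 8"
    using mk by (auto simp: s_def) linarith+
  have "7 * k + 7 \<le> s" using s mk by linarith
  then obtain j0 where j0: "s = 7 * k + 7 + j0" using le_Suc_ex by blast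
  have "\<alpha> * real s \<le> \<alpha> * (\<mu> * real k + 8)" using s assms by (intro mult_left_mono) auto
  also have "\<dots> < real k" using k1 by (simp add: algebra_simps)
  finally have a: "\<alpha> * real s < real k" .
  have "2 / \<beta> * real k \<le> \<mu> * real k" using \<mu> by (intro mult_right_mono) auto
  also have "\<dots> \<le> real s" using s by linarith
  finally have "2 * real k \<le> \<beta> * real s" using assms by (simp add: field_simps)
  with a k0 j0 that show thesis by blast
qed

text \<open>Every trigonometric polynomial \<open>V0\<close> is admissible: a large
  \<open>r0\<close> makes the initial defect nearly a multiple of \<open>H\<close>, and only
  afterwards is the base frequency chosen, so large that the corrugations move \<open>V0\<close> and
  \<open>W\<close> by at most \<open>\<eta>\<close>.\<close>

theorem torus_solution:
  fixes Q V0 :: "real^2 \<Rightarrow> real"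
  assumes \<alpha>: "0 < \<alpha>" "\<alpha> < 1/7" "\<alpha> < \<beta> / 2" and \<beta>: "\<beta> \<le> 1"
    and Q: "\<And>x y. \<bar>Q x - Q y\<bar> \<le> L * chord2 x y powr (\<beta> / 2)"
    and V0: "tp L0 V0" and \<eta>: "0 < \<eta>"
  obtains C V W where "mixed_solution \<alpha> Q C V W" "\<forall>x. \<bar>V x - V0 x\<bar> \<le> \<eta>" "\<forall>i x. \<bar>W i x\<bar> \<le> \<eta>"
proof -
  have \<beta>0: "0 < \<beta>" using \<alpha> by linarith
  obtain k j0 :: nat where k: "1 \<le> k" "\<alpha> * real (7 * k + 7 + j0) < real k" "2 * real k \<le> \<beta> * real (7 * k + 7 + j0)"
    using exponents_exist[OF \<alpha> \<beta>0] by blast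
  obtain P :: "real poly" and Cp :: real where
    PC: "0 < Cp \<and> (\<forall>x. \<bar>x\<bar> \<le> 1 \<longrightarrow> \<bar>(poly P x)\<^sup>2 - (1 + x)\<bar> \<le> Cp * \<bar>x\<bar> ^ Suc (2 * k + 1))"
    using poly_sqrt_approx[of "2 * k + 1"] by (elim exE)
  have Cp0: "0 < Cp" using PC by simp
  have P2: "\<bar>(poly P x)\<^sup>2 - (1 + x)\<bar> \<le> Cp * \<bar>x\<bar> ^ (2 * k + 2)" if "\<bar>x\<bar> \<le> 1" for x
    using PC that by simp
  obtain M :: nat where M: "max (12 * (260 + 20 * (real (degree P) + 1))) (4 * Cp * 2 ^ (2 * k + 2)) \<le> real M"
    using real_arch_simple by blast
  define m where "m = real M"
  interpret ci_params P Cp m k j0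
  proof unfold_locales
    show "m \<in> \<nat>" by (simp add: m_def)
    show "12 * (260 + 20 * (real (degree P) + 1)) \<le> m" "4 * Cp * 2 ^ (2 * k + 2) \<le> m"
      using M unfolding m_def max.bounded_iff by (rule conjunct1, rule conjunct2)
  qed (rule P2 Cp0 k(1), assumption?)+
  define s where "s = 7 * k + 7 + j0"
  define L' where "L' = max 1 L"
  have L': "0 < L'" "L \<le> L'" by (auto simp: L'_def)
  have Q': "\<bar>Q x - Q y\<bar> \<le> 0 + L' * chord2 x y powr (\<beta> / 2)" for x y
    using Q[of x y] mult_right_mono[OF L'(2), of "chord2 x y powr (\<beta> / 2)"] by simp
  have "\<exists>B. \<forall>x. \<bar>pderiv_at i V0 x\<bar> \<le> B" "\<exists>B. \<forall>x. \<bar>pderiv_at i (pderiv_at j V0) x\<bar> \<le> B" for i j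
    using tp_bounded[OF tp_pderiv[OF V0]] tp_bounded[OF tp_pderiv[OF tp_pderiv[OF V0]]] by blast+
  then obtain B1' B2' where B': "\<And>i x. \<bar>pderiv_at i V0 x\<bar> \<le> B1' i" "\<And>i j x. \<bar>pderiv_at i (pderiv_at j V0) x\<bar> \<le> B2' i j" by metis
  define D where "D = max (max 1 (max (B1' 1) (B1' 2))) (max (max (B2' 1 1) (B2' 1 2)) (max (B2' 2 1) (B2' 2 2)))"
  have D1: "1 \<le> D" by (simp add: D_def)
  have D: "\<bar>pderiv_at i V0 x\<bar> \<le> D" "\<bar>pderiv_at i (pderiv_at j V0) x\<bar> \<le> D" for i j x
  proof -
    have "B1' i \<le> D" "B2' i j \<le> D" using exhaust_2[of i] exhaust_2[of j] by (auto simp: D_def)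
    then show "\<bar>pderiv_at i V0 x\<bar> \<le> D" "\<bar>pderiv_at i (pderiv_at j V0) x\<bar> \<le> D" using B' order_trans by blast+
  qed
  have chord_le: "chord2 x y \<le> 8" for x y
    using cos_ge_minus_one[of "x $ 1 - y $ 1"] cos_ge_minus_one[of "x $ 2 - y $ 2"] unfolding chord2_def by linarith
  define Bq where "Bq = \<bar>Q 0\<bar> + L' * 8 powr (\<beta> / 2)"
  have Bq: "\<bar>Q x\<bar> \<le> Bq" for x
  proof -
    have "\<bar>Q x - Q 0\<bar> \<le> L' * 8 powr (\<beta> / 2)"
    proof -
      have "chord2 x 0 powr (\<beta> / 2) \<le> 8 powr (\<beta> / 2)" using \<beta>0 by (intro powr_mono2 chord2_nonneg chord_le) auto
      then have "L' * chord2 x 0 powr (\<beta> / 2) \<le> L' * 8 powr (\<beta> / 2)" using L' by (intro mult_left_mono) auto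
      then show ?thesis using Q'[of x 0] by linarith
    qed
    then show ?thesis unfolding Bq_def by linarith
  qed
  have Bq0: "0 \<le> Bq" using Bq[of 0] by linarith
  \<comment> \<open>The initial coefficients deviate from \<open>r0\<^sup>2\<close> by at most
    \<open>Bq + 2 * D\<^sup>2\<close>; this \<open>r0\<close> makes that at most
    \<open>r0\<^sup>2 / m\<close>.\<close>
  define r0 where "r0 = m * (Bq + 2 * D\<^sup>2)"
  have D2: "D \<le> D\<^sup>2" using D1 by (simp add: self_le_power)
  have "1 * (Bq + 2 * D\<^sup>2) \<le> r0" unfolding r0_def using m Bq0 by (intro mult_right_mono) auto
  then have "Bq + 2 * D\<^sup>2 \<le> r0" by simp
  then have "D \<le> r0" using D1 D2 Bq0 by linarith
  then have r0: "D \<le> r0" "1 \<le> r0" "0 < r0" using D1 by auto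
  have r0m: "Bq + 2 * D\<^sup>2 \<le> r0\<^sup>2 / m"
  proof -
    have "m * (Bq + 2 * D\<^sup>2) * 1 \<le> r0 * r0" unfolding r0_def[symmetric] using r0 by (intro mult_left_mono) auto
    then show ?thesis using m by (simp add: field_simps power2_eq_square)
  qed
  \<comment> \<open>The admissible change of the pressure in the first stage; later ones shrink by
    \<open>(1 / m ^ k)\<^sup>2\<close> each.\<close>
  define K where "K = r0\<^sup>2 * (1 / m ^ k)\<^sup>2 / (4 * m)"
  have K: "0 < K" using r0 m m_power_ge by (simp add: K_def)
  \<comment> \<open>The base frequency dominates the degree and second derivatives of
    \<open>V0\<close>, makes the displacements at most \<open>\<eta>\<close>, and through the last
    entry makes the Jackson error \<open>21 * L' * h powr (- \<beta>)\<close> at most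
    \<open>K / 2\<close>.\<close>
  obtain h :: nat where h: "max (max (max 1 L0) D) (max (max (12 * r0 / \<eta>) (15300 * r0\<^sup>2 / \<eta>)) ((42 * L' / K) powr (1 / \<beta>))) \<le> real h"
    using real_arch_simple by blast
  have h': "1 \<le> real h" "L0 \<le> real h" "D \<le> real h" "12 * r0 / \<eta> \<le> real h" "15300 * r0\<^sup>2 / \<eta> \<le> real h" "(42 * L' / K) powr (1 / \<beta>) \<le> real h"
    using h by auto
  \<comment> \<open>The factor 2 is the degree \<open>2 * n\<close> of a Jackson polynomial:
    \<open>q n\<close> has precisely the degree allowed at stage \<open>n\<close>.\<close>
  define N0 where "N0 = 2 * real h"
  have N0: "1 \<le> N0" "N0 \<in> \<nat>" "L0 \<le> N0" "2 * L0 \<le> N0" "D \<le> N0" using h' Nats_mult[OF of_nat_in_Nats of_nat_in_Nats, of 2 h] by (auto simp: N0_def)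
  define n' where "n' n = h * (M ^ s) ^ n" for n
  have M0: "0 < M" using m by (simp add: m_def)
  have n'0: "0 < n' n" for n using h' M0 by (simp add: n'_def)
  have n'_real: "2 * real (n' n) = N0 * (m ^ s) ^ n" for n by (simp add: n'_def N0_def m_def)
  define q where "q n = jackson (n' n) (\<lambda>p. Q (fk_point (n' n) p))" for n
  have tq: "tp (N0 * (m ^ s) ^ n) (q n)" for n unfolding q_def n'_real[symmetric] by (rule tp_jackson)
  have qerr: "\<bar>q n x - Q x\<bar> \<le> K / 2 * ((1 / m ^ k)\<^sup>2) ^ n" for n x
  proof -
    have "\<bar>q n x - Q x\<bar> \<le> 0 + 0 + 21 * L' * real (n' n) powr (- 2 * (\<beta> / 2))"
      unfolding q_def by (rule jackson_estimate[OF n'0 _ _ _ Q']) (use \<beta> \<beta>0 L' in auto)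
    also have "\<dots> = 21 * L' * (real h powr (- \<beta>) * (m powr (- (\<beta> * real s))) ^ n)"
    proof -
      have "real (n' n) = real h * (m ^ s) ^ n" by (simp add: n'_def m_def)
      also have "\<dots> = real h * m powr (real s * real n)" using m by (simp add: powr_realpow flip: power_mult of_nat_mult)
      finally show ?thesis using m h' by (simp add: powr_mult powr_powr mult_ac flip: powr_realpow)
    qed
    also have "\<dots> \<le> 21 * L' * (K / (42 * L') * ((1 / m ^ k)\<^sup>2) ^ n)"
    proof (intro mult_left_mono mult_mono power_mono)
      have "42 * L' / K = ((42 * L' / K) powr (1 / \<beta>)) powr \<beta>" using \<beta>0 L' K by (simp add: powr_powr)
      also have "\<dots> \<le> real h powr \<beta>" using h' \<beta>0 by (intro powr_mono2) auto
      finally have "42 * L' / K \<le> real h powr \<beta>" .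
      then have "inverse (real h powr \<beta>) \<le> inverse (42 * L' / K)" using L' K by (intro le_imp_inverse_le) auto
      then show "real h powr (- \<beta>) \<le> K / (42 * L')" by (simp add: powr_minus)
      \<comment> \<open>The point where \<open>2 * k \<le> \<beta> * s\<close> enters: approximation
        of the pressure improves per stage at least as fast as the defect shrinks.\<close>
      have "m powr (- (\<beta> * real s)) \<le> m powr (- (2 * real k))" using k(3) m by (intro powr_mono) (auto simp: s_def)
      also have "\<dots> = inverse (m powr real (2 * k))" by (simp add: powr_minus)
      also have "m powr real (2 * k) = m ^ (2 * k)" using m by (intro powr_realpow)
      also have "inverse (m ^ (2 * k)) = (1 / m ^ k)\<^sup>2"
        by (simp add: power_even_eq power_divide inverse_eq_divide)
      finally show "m powr (- (\<beta> * real s)) \<le> (1 / m ^ k)\<^sup>2" .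
    qed (use L' K in auto)
    also have "\<dots> = K / 2 * ((1 / m ^ k)\<^sup>2) ^ n" using L' by simp
    finally show ?thesis .
  qed
  have qn: "btp (N0 * (m ^ (7 * k + 7 + j0)) ^ Suc n) ((r0 * (1 / m ^ k) ^ Suc n)\<^sup>2 / (4 * m)) (\<lambda>x. q (Suc n) x - q n x)" for n
    unfolding btp_def s_def[symmetric]
  proof (intro conjI allI)
    have "N0 * (m ^ s) ^ n \<le> N0 * (m ^ s) ^ Suc n"
      using N0 m_power_ge by (intro mult_left_mono power_increasing) auto
    then show "tp (N0 * (m ^ s) ^ Suc n) (\<lambda>x. q (Suc n) x - q n x)"
      by (intro tp_diff tq tp_mono[OF tq])
    fix x
    let ?z = "(1 / m ^ k)\<^sup>2"
    have "1 / m ^ k \<le> 1" "0 \<le> 1 / m ^ k" using m_power_ge[of k] by simp_all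
    then have z: "0 \<le> ?z" "?z \<le> 1" by (simp, intro power_le_one)
    have "?z ^ Suc n \<le> ?z ^ n" using z by (intro power_decreasing) auto
    then have "K / 2 * ?z ^ Suc n \<le> K / 2 * ?z ^ n" using K by (intro mult_left_mono) auto
    then have "\<bar>q (Suc n) x - q n x\<bar> \<le> K * ?z ^ n" using qerr[of "Suc n" x] qerr[of n x] by linarith
    also have "\<dots> = (r0 * (1 / m ^ k) ^ Suc n)\<^sup>2 / (4 * m)"
    proof -
      have "r0\<^sup>2 * a\<^sup>2 / (4 * m) * (a\<^sup>2) ^ n = (r0 * a ^ Suc n)\<^sup>2 / (4 * m)" for a
        by (simp add: power2_eq_square power_mult_distrib)
      then show ?thesis unfolding K_def .
    qed
    finally show "\<bar>q (Suc n) x - q n x\<bar> \<le> (r0 * (1 / m ^ k) ^ Suc n)\<^sup>2 / (4 * m)" .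
  qed
  have qlim: "(\<lambda>n. q n x) \<longlonglongrightarrow> Q x" for x
  proof -
    have "m \<le> m ^ k" using m_le_power[of k] k by simp
    then have "1 / m ^ k < 1" using m by simp
    then have "(1 / m ^ k)\<^sup>2 < 1" using m by (simp add: power_less_one_iff abs_square_less_1)
    then have "(\<lambda>n. K / 2 * ((1 / m ^ k)\<^sup>2) ^ n) \<longlonglongrightarrow> K / 2 * 0" by (intro tendsto_intros LIMSEQ_realpow_zero) auto
    then have lim0: "(\<lambda>n. K / 2 * ((1 / m ^ k)\<^sup>2) ^ n) \<longlonglongrightarrow> 0" unfolding mult_zero_right .
    have "(\<lambda>n. q n x - Q x) \<longlonglongrightarrow> 0"
      by (rule Lim_null_comparison[OF _ lim0]) (unfold real_norm_def, intro always_eventually allI qerr)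
    then show ?thesis by (simp add: LIM_zero_iff)
  qed
  \<comment> \<open>The coefficients of
    \<open>q 0 Id + r0\<^sup>2 H - \<nabla>V0 \<otimes> \<nabla>V0\<close>, with
    \<open>W = 0\<close>.\<close>
  define c0 where "c0 l = (if l = 3 then (\<lambda>x. r0\<^sup>2 - pderiv_at 1 V0 x * pderiv_at 2 V0 x)
    else if l = 1 then (\<lambda>x. r0\<^sup>2 + (q 0 x - pderiv_at 1 V0 x * pderiv_at 1 V0 x + pderiv_at 1 V0 x * pderiv_at 2 V0 x))
    else (\<lambda>x. r0\<^sup>2 + (q 0 x - pderiv_at 2 V0 x * pderiv_at 2 V0 x + pderiv_at 1 V0 x * pderiv_at 2 V0 x)))" for l :: nat
  have tVV: "tp N0 (\<lambda>x. pderiv_at i V0 x * pderiv_at j V0 x)" for i j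
    by (rule tp_mono[OF tp_mult[OF tp_pderiv[OF V0] tp_pderiv[OF V0]]]) (use N0 in auto)
  have bVV: "\<bar>pderiv_at i V0 x * pderiv_at j V0 x\<bar> \<le> D\<^sup>2" for i j x
    unfolding abs_mult power2_eq_square by (intro mult_mono D) (use D1 in auto)
  have bq0: "\<bar>q 0 x\<bar> \<le> Bq" for x unfolding q_def by (rule jackson_bound[OF n'0 Bq])
  have p0: "pderiv_at i (\<lambda>x. 0::real) x = 0" for i :: 2 and x by (rule pderiv_at_const)
  have S0: "stage (r0\<^sup>2) N0 r0 (q 0) V0 (\<lambda>i x. 0) c0"
    unfolding stage_def
  proof (intro conjI allI)
    show "tp N0 V0" by (rule tp_mono[OF V0]) (use N0 in auto)
    show "tp N0 (\<lambda>x. 0)" using N0 by (intro tp_const) auto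
    have "tp N0 (q 0)" using tq[of 0] by simp
    then show "tp N0 (c0 l)" for l
      unfolding c0_def using N0 by (auto intro!: tp_add tp_diff tVV tp_const)
    show "\<bar>c0 l x - r0\<^sup>2\<bar> \<le> r0\<^sup>2 / m" for l x
    proof -
      note bb = bVV[of 1 x 1] bVV[of 1 x 2] bVV[of 2 x 2] bq0[of x]
      have D20: "0 \<le> D\<^sup>2" by simp
      consider "l = 3" | "l = 1" | "l \<noteq> 3" "l \<noteq> 1" by blast
      then show ?thesis
        by cases (use bb[unfolded abs_le_iff] r0m Bq0 D20 in \<open>simp_all add: c0_def abs_le_iff\<close>)
    qed
    show "\<bar>pderiv_at i (pderiv_at j V0) x\<bar> \<le> m ^ k * r0 * N0" for i j x
    proof -
      have "1 * D \<le> (m ^ k * r0) * N0"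
      proof (rule mult_mono)
        have "1 * 1 \<le> m ^ k * r0" using m_power_ge[of k] m r0 by (intro mult_mono) auto
        then show "1 \<le> m ^ k * r0" by simp
      qed (use N0 D1 m_power_ge[of k] m r0 in auto)
      then show ?thesis using D(2)[of i j x] by simp
    qed
  qed (auto simp: mixed_form_def p0 c0_def)
  have G0: "\<bar>pderiv_at i V0 x\<bar> \<le> r0" for i x using D(1)[of i x] r0 by linarith
  have \<alpha>1: "\<alpha> \<le> 1" using \<alpha> by linarith
  obtain V W where VW: "mixed_solution \<alpha> Q (r0\<^sup>2) V W"
    "\<forall>x. \<bar>V x - V0 x\<bar> \<le> 12 * r0 / N0" "\<forall>i x. \<bar>W i x\<bar> \<le> 15300 * r0\<^sup>2 / N0"
    by (rule iteration[OF k(2) \<alpha>(1) \<alpha>1 N0(1,2) r0(3) S0 G0 qn qlim])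
  have small: "a / N0 \<le> \<eta>" if "a / \<eta> \<le> real h" "0 \<le> a" for a
  proof -
    have "a \<le> \<eta> * real h" using that \<eta> by (simp add: field_simps)
    also have "\<dots> \<le> \<eta> * N0" using \<eta> by (simp add: N0_def)
    finally show ?thesis using N0 by (simp add: field_simps)
  qed
  have "12 * r0 / N0 \<le> \<eta>" "15300 * r0\<^sup>2 / N0 \<le> \<eta>" using small[OF h'(4)] small[OF h'(5)] r0 by auto
  then have "\<forall>x. \<bar>V x - V0 x\<bar> \<le> \<eta>" "\<forall>i x. \<bar>W i x\<bar> \<le> \<eta>" using VW(2,3) order_trans by blast+
  with VW(1) that show thesis by blast
qed

section \<open>The weak formulation\<close>

lemma C_space_continuous: "\<phi> \<in> C_space k \<Longrightarrow> continuous_on UNIV \<phi>"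
  by (cases k) (auto intro: differentiable_imp_continuous_on)

lemma pderiv_at_support:
  assumes "x \<notin> closure {x. f x \<noteq> 0}" shows "pderiv_at i f x = 0"
proof -
  have "open (- closure {x. f x \<noteq> 0})" by auto
  then have "(f has_derivative (\<lambda>_. 0)) (at x)"
    by (rule has_derivative_transform_within_open[OF has_derivative_const[of 0]])
      (use assms closure_subset[of "{x. f x \<noteq> 0}"] in auto)
  then show ?thesis using pderiv_atI[of f "\<lambda>_. 0" x i] by simp
qed

lemma integrable_compact_support:
  fixes f :: "real^'n::finite \<Rightarrow> real"
  assumes "compact K" "continuous_on UNIV f" "\<And>x. x \<notin> K \<Longrightarrow> f x = 0"
  shows "integrable lborel f"
proof -
  have "integrable lborel (\<lambda>x. indicator K x *\<^sub>R f x)"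
    using assms by (intro borel_integrable_compact) (auto intro: continuous_on_subset)
  moreover have "(\<lambda>x. indicator K x *\<^sub>R f x) = f" by (rule ext) (use assms(3) in \<open>auto simp: indicator_def\<close>)
  ultimately show ?thesis by simp
qed

lemma has_real_derivative_line:
  fixes g :: "real^'n::finite \<Rightarrow> real"
  assumes g: "\<And>x. g differentiable (at x)"
  shows "((\<lambda>t. g (y + t *\<^sub>R axis l 1)) has_real_derivative pderiv_at l g (y + t *\<^sub>R axis l 1)) (at t)"
proof -
  let ?D = "frechet_derivative g (at (y + t *\<^sub>R axis l 1))"
  have D: "(g has_derivative ?D) (at (y + t *\<^sub>R axis l 1))" using g by (simp add: frechet_derivative_works)
  have "((\<lambda>t. y + t *\<^sub>R axis l 1) has_derivative (\<lambda>s. s *\<^sub>R axis l 1)) (at t)"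
    by (auto intro!: derivative_eq_intros)
  from diff_chain_at[OF this D]
  have "((\<lambda>t. g (y + t *\<^sub>R axis l 1)) has_derivative (\<lambda>s. ?D (s *\<^sub>R axis l 1))) (at t)"
    by (simp add: o_def)
  moreover have "?D (s *\<^sub>R axis l 1) = s * pderiv_at l g (y + t *\<^sub>R axis l 1)" for s
    using has_derivative_linear[OF D] by (simp add: pderiv_at_def linear_scale)
  ultimately show ?thesis by (simp add: has_field_derivative_def mult.commute[of _ "pderiv_at l g _"])
qed

text \<open>By translation invariance the difference quotients have integral zero, and they converge
  boundedly to the derivative.\<close>

lemma integral_pderiv_zero:
  fixes f :: "real^'n::finite \<Rightarrow> real"
  assumes K: "compact K" and f: "\<And>x. x \<notin> K \<Longrightarrow> f x = 0"
    and d: "\<And>x. f differentiable (at x)" and c: "\<And>i. continuous_on UNIV (pderiv_at i f)"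
  shows "integral\<^sup>L lborel (pderiv_at i f) = 0"
proof -
  let ?e = "axis i 1 :: real^'n"
  define h where "h n = 1 / real (Suc n)" for n
  have h: "0 < h n" "h n \<le> 1" for n by (auto simp: h_def)
  have cf: "continuous_on UNIV f" using d by (simp add: continuous_at_imp_continuous_on differentiable_imp_continuous_within)
  \<comment> \<open>The unit neighbourhood of \<open>K\<close> contains the supports of all
    difference quotients, since \<open>h n \<le> 1\<close>; it carries the dominating
    function.\<close>
  define K' where "K' = (\<Union>x\<in>K. cball x 1)"
  have K': "compact K'" and KK': "K \<subseteq> K'"
  proof -
    have "K' = {x + y |x y. x \<in> K \<and> y \<in> cball 0 1}"
    proof (intro set_eqI iffI)
      fix z assume "z \<in> K'"
      then obtain x where "x \<in> K" "dist x z \<le> 1" by (auto simp: K'_def)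
      then have "z = x + (z - x)" "x \<in> K" "z - x \<in> cball 0 1" by (auto simp: dist_norm norm_minus_commute)
      then show "z \<in> {x + y |x y. x \<in> K \<and> y \<in> cball 0 1}" by blast
    next
      fix z assume "z \<in> {x + y |x y. x \<in> K \<and> y \<in> cball 0 1}"
      then obtain x y where "z = x + y" "x \<in> K" "norm y \<le> 1" by auto
      then have "z \<in> cball x 1" "x \<in> K" by (auto simp: dist_norm)
      then show "z \<in> K'" by (auto simp: K'_def)
    qed
    then show "compact K'" using compact_sums[OF K compact_cball[of 0 1]] by simp
    show "K \<subseteq> K'" by (force simp: K'_def)
  qed
  have outside: "pderiv_at j f x = 0" if "x \<notin> K" for j x
  proof (rule pderiv_at_support)
    have "closure {x. f x \<noteq> 0} \<subseteq> K" using f K by (intro closure_minimal compact_imp_closed) auto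
    then show "x \<notin> closure {x. f x \<noteq> 0}" using that by auto
  qed
  have "\<exists>B. \<forall>x. \<bar>pderiv_at j f x\<bar> \<le> B" for j
  proof -
    have "bounded (pderiv_at j f ` K)"
      by (intro compact_imp_bounded compact_continuous_image K continuous_on_subset[OF c]) auto
    then obtain B where B: "0 < B" "\<And>x. x \<in> K \<Longrightarrow> \<bar>pderiv_at j f x\<bar> \<le> B" unfolding bounded_pos by auto
    then have "\<bar>pderiv_at j f x\<bar> \<le> B" for x using outside[of x j] by (cases "x \<in> K") auto
    then show ?thesis by blast
  qed
  then obtain B' where B': "\<And>j x. \<bar>pderiv_at j f x\<bar> \<le> B' j" by metis
  have "0 \<le> B' j" for j using B'[of j 0] by linarith
  then have "B' j \<le> sum B' UNIV" for j by (intro member_le_sum) auto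
  then have B: "\<bar>pderiv_at j f x\<bar> \<le> sum B' UNIV" for j x using B'[of j x] order_trans by blast
  define L where "L = real CARD('n) * sum B' UNIV"
  define s where "s n x = (f (x + h n *\<^sub>R ?e) - f x) / h n" for n x
  have s_bound: "\<bar>s n x\<bar> \<le> indicator K' x * L" for n x
  proof (cases "x \<in> K'")
    case True
    have "\<bar>f (x + h n *\<^sub>R ?e) - f x\<bar> \<le> L * norm (h n *\<^sub>R ?e)"
      using pderiv_lipschitz[OF d B, of "x + h n *\<^sub>R ?e" x] by (simp add: L_def)
    then show ?thesis using True h[of n] by (simp add: s_def abs_divide divide_le_eq norm_axis_1)
  next
    case False
    have "x + h n *\<^sub>R ?e \<notin> K"
    proof
      assume "x + h n *\<^sub>R ?e \<in> K"
      moreover have "x \<in> cball (x + h n *\<^sub>R ?e) 1" using h[of n] by (simp add: dist_norm norm_axis_1)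
      ultimately show False using False by (auto simp: K'_def)
    qed
    moreover have "x \<notin> K" using False KK' by auto
    ultimately show ?thesis using False by (simp add: s_def f)
  qed
  have int_s: "integral\<^sup>L lborel (s n) = 0" for n
  proof -
    have i1: "integrable lborel f" by (rule integrable_compact_support[OF K cf f])
    have fm: "f \<in> borel_measurable borel" using cf by (rule borel_measurable_continuous_onI)
    have "integrable (Measure_Space.distr lborel borel ((+) (h n *\<^sub>R ?e))) f = integrable lborel (\<lambda>x. f (h n *\<^sub>R ?e + x))"
      by (rule integrable_distr_eq) (auto simp: fm)
    then have i2: "integrable lborel (\<lambda>x. f (x + h n *\<^sub>R ?e))"
      using i1 unfolding lborel_distr_plus by (simp add: add.commute)
    have "integral\<^sup>L (Measure_Space.distr lborel borel ((+) (h n *\<^sub>R ?e))) f = integral\<^sup>L lborel (\<lambda>x. f (h n *\<^sub>R ?e + x))"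
      by (rule integral_distr) (auto simp: fm)
    then have "integral\<^sup>L lborel (\<lambda>x. f (x + h n *\<^sub>R ?e)) = integral\<^sup>L lborel f"
      unfolding lborel_distr_plus by (simp add: add.commute)
    then show ?thesis using i1 i2 unfolding s_def by simp
  qed
  have "(\<lambda>n. integral\<^sup>L lborel (s n)) \<longlonglongrightarrow> integral\<^sup>L lborel (pderiv_at i f)"
  proof (rule integral_dominated_convergence[where w = "\<lambda>x. indicator K' x * L"])
    show "pderiv_at i f \<in> borel_measurable lborel" using c by (simp add: borel_measurable_continuous_onI)
    show "s n \<in> borel_measurable lborel" for n unfolding s_def
      using h(1)[of n] by (simp, intro borel_measurable_continuous_onI continuous_intros continuous_on_compose2[OF cf]) auto
    show "integrable lborel (\<lambda>x. indicator K' x * L)"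
      using borel_integrable_compact[OF K', of "\<lambda>_. L"] by simp
    show "AE x in lborel. norm (s n x) \<le> indicator K' x * L" for n using s_bound by simp
    show "AE x in lborel. (\<lambda>n. s n x) \<longlonglongrightarrow> pderiv_at i f x"
    proof (rule AE_I2)
      fix x
      have "((\<lambda>t. f (x + t *\<^sub>R ?e)) has_real_derivative pderiv_at i f x) (at 0)"
        using has_real_derivative_line[OF d, of x i 0] by simp
      then have "((\<lambda>t. (f (x + t *\<^sub>R ?e) - f x) / t) \<longlongrightarrow> pderiv_at i f x) (at 0)"
        by (simp add: DERIV_def)
      moreover have "filterlim h (at 0) sequentially"
      proof (rule filterlim_atI)
        show "h \<longlonglongrightarrow> 0" using LIMSEQ_inverse_real_of_nat by (simp add: h_def[abs_def] inverse_eq_divide)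
        show "\<forall>\<^sub>F n in sequentially. h n \<noteq> 0"
          using h(1)[THEN less_imp_neq] by (intro always_eventually allI) (metis less_irrefl h(1))
      qed
      ultimately show "(\<lambda>n. s n x) \<longlonglongrightarrow> pderiv_at i f x" unfolding s_def by (rule filterlim_compose)
    qed
  qed
  then show ?thesis using int_s LIMSEQ_unique[OF _ tendsto_const] by fastforce
qed

section \<open>Symmetry of second derivatives and weak derivatives\<close>

lemma second_difference:
  fixes f :: "real^'n::finite \<Rightarrow> real"
  assumes h: "0 < h" and d: "\<And>x. f differentiable (at x)" and dd: "\<And>x. pderiv_at i f differentiable (at x)"
  obtains z where "norm (z - x) \<le> 2 * h"
    "f (x + h *\<^sub>R axis i 1 + h *\<^sub>R axis j 1) - f (x + h *\<^sub>R axis i 1) - f (x + h *\<^sub>R axis j 1) + f x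
      = h\<^sup>2 * pderiv_at j (pderiv_at i f) z"
proof -
  let ?a = "axis i 1 :: real^'n" and ?b = "axis j 1 :: real^'n"
  have line: "((\<lambda>t. g (y + t *\<^sub>R axis l 1)) has_real_derivative pderiv_at l g (y + t *\<^sub>R axis l 1)) (at t)"
    if g: "\<And>x. g differentiable (at x)" for g :: "real^'n \<Rightarrow> real" and y t l
    by (rule has_real_derivative_line[OF g])
  let ?\<phi> = "\<lambda>t. f (x + h *\<^sub>R ?b + t *\<^sub>R ?a) - f (x + t *\<^sub>R ?a)"
  have "(?\<phi> has_real_derivative pderiv_at i f (x + h *\<^sub>R ?b + t *\<^sub>R ?a) - pderiv_at i f (x + t *\<^sub>R ?a)) (at t)" for t
    by (intro DERIV_diff line d)
  from MVT2[OF h, of ?\<phi>, OF this] obtain t where t: "0 < t" "t < h"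
    "?\<phi> h - ?\<phi> 0 = h * (pderiv_at i f (x + h *\<^sub>R ?b + t *\<^sub>R ?a) - pderiv_at i f (x + t *\<^sub>R ?a))" by auto
  let ?\<psi> = "\<lambda>s. pderiv_at i f (x + t *\<^sub>R ?a + s *\<^sub>R ?b)"
  have "(?\<psi> has_real_derivative pderiv_at j (pderiv_at i f) (x + t *\<^sub>R ?a + s *\<^sub>R ?b)) (at s)" for s
    by (intro line dd)
  from MVT2[OF h, of ?\<psi>, OF this] obtain s where s: "0 < s" "s < h"
    "?\<psi> h - ?\<psi> 0 = h * pderiv_at j (pderiv_at i f) (x + t *\<^sub>R ?a + s *\<^sub>R ?b)" by auto
  have "norm (x + t *\<^sub>R ?a + s *\<^sub>R ?b - x) \<le> norm (t *\<^sub>R ?a) + norm (s *\<^sub>R ?b)"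
    using norm_triangle_ineq[of "t *\<^sub>R ?a" "s *\<^sub>R ?b"] by (simp add: add.assoc)
  also have "\<dots> \<le> 2 * h" using s t by (simp add: norm_axis_1)
  finally have n: "norm (x + t *\<^sub>R ?a + s *\<^sub>R ?b - x) \<le> 2 * h" .
  have e: "x + h *\<^sub>R ?b + t *\<^sub>R ?a = x + t *\<^sub>R ?a + h *\<^sub>R ?b" "x + h *\<^sub>R ?b + h *\<^sub>R ?a = x + h *\<^sub>R ?a + h *\<^sub>R ?b"
    by (simp_all add: algebra_simps)
  have "f (x + h *\<^sub>R ?a + h *\<^sub>R ?b) - f (x + h *\<^sub>R ?a) - f (x + h *\<^sub>R ?b) + f x = ?\<phi> h - ?\<phi> 0"
    unfolding e by simp
  also have "\<dots> = h * (pderiv_at i f (x + h *\<^sub>R ?b + t *\<^sub>R ?a) - pderiv_at i f (x + t *\<^sub>R ?a))" by (rule t(3))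
  also have "\<dots> = h * (?\<psi> h - ?\<psi> 0)" unfolding e by simp
  also have "\<dots> = h\<^sup>2 * pderiv_at j (pderiv_at i f) (x + t *\<^sub>R ?a + s *\<^sub>R ?b)"
    unfolding s(3) by (simp add: power2_eq_square)
  finally show thesis using n that by blast
qed

text \<open>The second difference is symmetric in \<open>i\<close> and \<open>j\<close>. By the mean
  value theorem both mixed derivatives take its normalized value at points within
  \<open>2 * h\<close> of \<open>x\<close>, which contradicts a gap of \<open>2 * e\<close> at
  \<open>x\<close> once both are continuous.\<close>

theorem pderiv_at_commute:
  fixes f :: "real^'n::finite \<Rightarrow> real"
  assumes d: "\<And>x. f differentiable (at x)" and dd: "\<And>i x. pderiv_at i f differentiable (at x)"
    and c: "\<And>i j. continuous_on UNIV (pderiv_at j (pderiv_at i f))"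
  shows "pderiv_at j (pderiv_at i f) x = pderiv_at i (pderiv_at j f) x"
proof (rule ccontr)
  let ?F = "pderiv_at j (pderiv_at i f)" and ?G = "pderiv_at i (pderiv_at j f)"
  assume ne: "?F x \<noteq> ?G x"
  define e where "e = \<bar>?F x - ?G x\<bar> / 2"
  have e: "0 < e" using ne by (simp add: e_def)
  obtain r1 where r1: "0 < r1" "\<And>z. dist z x < r1 \<Longrightarrow> dist (?F z) (?F x) < e"
    using c[of j i] e unfolding continuous_on_iff by (metis UNIV_I)
  obtain r2 where r2: "0 < r2" "\<And>z. dist z x < r2 \<Longrightarrow> dist (?G z) (?G x) < e"
    using c[of i j] e unfolding continuous_on_iff by (metis UNIV_I)
  define h where "h = min r1 r2 / 3"
  have h: "0 < h" "2 * h < r1" "2 * h < r2" using r1 r2 by (auto simp: h_def)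
  obtain z where z: "norm (z - x) \<le> 2 * h"
    "f (x + h *\<^sub>R axis i 1 + h *\<^sub>R axis j 1) - f (x + h *\<^sub>R axis i 1) - f (x + h *\<^sub>R axis j 1) + f x = h\<^sup>2 * ?F z"
    by (rule second_difference[OF h(1) d dd])
  obtain y where y: "norm (y - x) \<le> 2 * h"
    "f (x + h *\<^sub>R axis j 1 + h *\<^sub>R axis i 1) - f (x + h *\<^sub>R axis j 1) - f (x + h *\<^sub>R axis i 1) + f x = h\<^sup>2 * ?G y"
    by (rule second_difference[OF h(1) d dd])
  have swap: "x + h *\<^sub>R axis j 1 + h *\<^sub>R axis i 1 = x + h *\<^sub>R axis i 1 + h *\<^sub>R axis j 1" by (simp add: algebra_simps)
  have "h\<^sup>2 * ?F z = h\<^sup>2 * ?G y" using z(2) y(2)[unfolded swap] by linarith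
  then have "?F z = ?G y" using h by simp
  moreover have "dist (?F z) (?F x) < e" using z(1) h by (intro r1(2)) (simp add: dist_norm)
  moreover have "dist (?G y) (?G x) < e" using y(1) h by (intro r2(2)) (simp add: dist_norm)
  ultimately show False unfolding e_def dist_real_def by (smt (verit) field_sum_of_halves)
qed

text \<open>Weak symmetry of second derivatives. As \<open>f\<close> is only of class C1, one
  derivative is moved to the test function, where the two remaining ones commute.\<close>

lemma integral_pderiv_cross:
  fixes f \<phi> :: "real^'n::finite \<Rightarrow> real"
  assumes K: "compact K" and \<phi>0: "\<And>x. x \<notin> K \<Longrightarrow> \<phi> x = 0" and f: "f \<in> C_space 1" and \<phi>: "\<phi> \<in> C_space 2"
  shows "(\<integral>x. pderiv_at i f x * pderiv_at j \<phi> x \<partial>lborel) = (\<integral>x. pderiv_at j f x * pderiv_at i \<phi> x \<partial>lborel)"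
proof -
  have df: "f differentiable (at x)" and cf: "continuous_on UNIV (pderiv_at i f)" for i x
    using f by (auto simp: differentiable_on_def)
  have \<phi>': "\<phi> differentiable (at x)" "pderiv_at i \<phi> differentiable (at x)" "continuous_on UNIV (pderiv_at j (pderiv_at i \<phi>))" for i j x
    using \<phi> by (auto simp: differentiable_on_def numeral_2_eq_2)
  have cont: "continuous_on UNIV g" if "\<And>x. g differentiable (at x)" for g :: "real^'n \<Rightarrow> real"
    using that by (simp add: continuous_at_imp_continuous_on differentiable_imp_continuous_within)
  have out: "pderiv_at i \<phi> x = 0" if "x \<notin> K" for i x
  proof (rule pderiv_at_support)
    have "closure {x. \<phi> x \<noteq> 0} \<subseteq> K" using \<phi>0 K by (intro closure_minimal compact_imp_closed) auto
    then show "x \<notin> closure {x. \<phi> x \<noteq> 0}" using that by auto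
  qed
  have out2: "pderiv_at j (pderiv_at i \<phi>) x = 0" if "x \<notin> K" for i j x
  proof (rule pderiv_at_support)
    have "closure {x. pderiv_at i \<phi> x \<noteq> 0} \<subseteq> K" using out K by (intro closure_minimal compact_imp_closed) auto
    then show "x \<notin> closure {x. pderiv_at i \<phi> x \<noteq> 0}" using that by auto
  qed
  have key: "(\<integral>x. pderiv_at i f x * pderiv_at j \<phi> x \<partial>lborel) = - (\<integral>x. f x * pderiv_at i (pderiv_at j \<phi>) x \<partial>lborel)" for i j
  proof -
    let ?F = "\<lambda>x. f x * pderiv_at j \<phi> x"
    have p: "pderiv_at l ?F = (\<lambda>x. f x * pderiv_at l (pderiv_at j \<phi>) x + pderiv_at l f x * pderiv_at j \<phi> x)" for l
      using df \<phi>' by (auto intro!: pderiv_at_mult)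
    have "integral\<^sup>L lborel (pderiv_at i ?F) = 0"
    proof (rule integral_pderiv_zero[OF K])
      show "?F differentiable (at x)" for x using df \<phi>' by simp
      show "continuous_on UNIV (pderiv_at l ?F)" for l
        unfolding p by (intro continuous_intros cf \<phi>'(3) cont df \<phi>'(2))
    qed (simp add: out)
    moreover have "integrable lborel (\<lambda>x. f x * pderiv_at i (pderiv_at j \<phi>) x)"
      by (rule integrable_compact_support[OF K]) (auto simp: out2 intro!: continuous_on_mult cont[OF df] \<phi>'(3))
    moreover have "integrable lborel (\<lambda>x. pderiv_at i f x * pderiv_at j \<phi> x)"
      by (rule integrable_compact_support[OF K]) (auto simp: out intro!: continuous_on_mult cf cont[OF \<phi>'(2)])
    ultimately show ?thesis unfolding p by simp
  qed
  have "pderiv_at i (pderiv_at j \<phi>) x = pderiv_at j (pderiv_at i \<phi>) x" for x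
    by (rule pderiv_at_commute) (rule \<phi>')+
  then show ?thesis unfolding key by simp
qed

text \<open>Passing to the whole plane removes the boundary of \<open>\<Omega>\<close> from all
  integrations by parts.\<close>

lemma distr_eq_integral:
  assumes "\<And>x. x \<in> \<Omega> \<Longrightarrow> f x = F x" "\<And>x. x \<notin> \<Omega> \<Longrightarrow> \<psi> x = 0"
  shows "distr \<Omega> f \<psi> = (\<integral>x. F x * \<psi> x \<partial>lborel)"
  unfolding distr_def set_lebesgue_integral_def
proof (rule Bochner_Integration.integral_cong)
  show "indicator \<Omega> x *\<^sub>R (f x * \<psi> x) = F x * \<psi> x" for x
    using assms[of x] by (cases "x \<in> \<Omega>") auto
qed simp

text \<open>The cofactor computation in weak form. \<open>F\<close> is a continuous representative
  of the pressure on the plane; it has to agree with \<open>q\<close> only on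
  \<open>\<Omega>\<close>.\<close>

lemma solves_systemI:
  fixes v F q :: "real^2 \<Rightarrow> real" and W :: "2 \<Rightarrow> real^2 \<Rightarrow> real"
  assumes v: "v \<in> C_space 1" and W: "\<And>j. W j \<in> C_space 1" and F: "continuous_on UNIV F"
    and qF: "\<And>x. x \<in> \<Omega> \<Longrightarrow> q x = F x"
    and eq: "\<And>x. mixed_form v W 1 1 x = F x + 2 * C" "\<And>x. mixed_form v W 2 2 x = F x + 2 * C"
      "\<And>x. mixed_form v W 1 2 x = C"
  shows "solves_system \<Omega> q (perp_grad v) (curl (\<lambda>y. \<chi> j. W j y))"
  unfolding solves_system_def
proof (intro ballI)
  let ?u = "perp_grad v"
  fix \<phi> assume "\<phi> \<in> test_functions \<Omega>"
  define K where "K = closure {x. \<phi> x \<noteq> 0}"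
  have \<phi>: "\<phi> \<in> C_space k" and K: "compact K" "K \<subseteq> \<Omega>" for k
    using \<open>\<phi> \<in> test_functions \<Omega>\<close> by (auto simp: test_functions_def K_def)
  have \<phi>K: "\<phi> x = 0" if "x \<notin> K" for x using that closure_subset[of "{x. \<phi> x \<noteq> 0}"] by (auto simp: K_def)
  have out: "pderiv_at i \<phi> x = 0" if "x \<notin> K" for i x using pderiv_at_support that unfolding K_def .
  have out': "pderiv_at i \<phi> x = 0" if "x \<notin> \<Omega>" for i x using out that K by blast
  have c\<phi>: "continuous_on UNIV (pderiv_at i \<phi>)" and d\<phi>: "\<phi> differentiable (at x)" for i x
    using \<phi>[of 1] by (auto simp: differentiable_on_def)
  have cv: "continuous_on UNIV (pderiv_at i v)" and cW: "continuous_on UNIV (pderiv_at i (W j))" for i j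
    using v W by auto
  \<comment> \<open>\<open>S a j\<close> is minus the j-th weak derivative of \<open>a\<close>
    tested against \<open>\<phi>\<close>. The whole system becomes linear algebra in these
    numbers.\<close>
  define S where "S a j = (\<integral>x. a x * pderiv_at j \<phi> x \<partial>lborel)" for a j
  have int: "integrable lborel (\<lambda>x. a x * pderiv_at j \<phi> x)" if "continuous_on UNIV a" for a j
    by (rule integrable_compact_support[OF K(1)]) (auto intro!: continuous_intros that c\<phi> simp: out)
  have S_add: "S (\<lambda>x. a x + b x) j = S a j + S b j" if "continuous_on UNIV a" "continuous_on UNIV b" for a b j
    unfolding S_def using int[OF that(1), of j] int[OF that(2), of j] by (simp add: distrib_right)
  have S_diff: "S (\<lambda>x. a x - b x) j = S a j - S b j" if "continuous_on UNIV a" "continuous_on UNIV b" for a b j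
    unfolding S_def using int[OF that(1), of j] int[OF that(2), of j] by (simp add: left_diff_distrib)
  have S_cmult: "S (\<lambda>x. c * a x) j = c * S a j" for c a j
    unfolding S_def by (simp add: mult.assoc)
  \<comment> \<open>This is why the constant matrix \<open>C H\<close> disappears from the
    equation.\<close>
  have S_const: "S (\<lambda>x. c) j = 0" for c j
  proof -
    have "integral\<^sup>L lborel (pderiv_at j \<phi>) = 0" by (rule integral_pderiv_zero[OF K(1) \<phi>K d\<phi> c\<phi>])
    then show ?thesis unfolding S_def by simp
  qed
  have distr_S: "distr \<Omega> f (pderiv_at j \<phi>) = S F j" if "\<And>x. x \<in> \<Omega> \<Longrightarrow> f x = F x" for f F j
    unfolding S_def using that out' by (rule distr_eq_integral)
  have cross: "S (pderiv_at i f) j = S (pderiv_at j f) i" if "f \<in> C_space 1" for f i j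
    unfolding S_def by (rule integral_pderiv_cross[OF K(1) \<phi>K that \<phi>])
  have comp: "(\<lambda>y. (\<chi> j. W j y) $ i) = W i" for i by simp
  have g: "curl (\<lambda>y. \<chi> j. W j y) x = pderiv_at 1 (W 2) x - pderiv_at 2 (W 1) x" for x
    unfolding curl_def comp ..
  have u: "?u x $ 1 = - pderiv_at 2 v x" "?u x $ 2 = pderiv_at 1 v x" for x
    by (simp_all add: perp_grad_def)
  have Sg: "distr \<Omega> (curl (\<lambda>y. \<chi> j. W j y)) (pderiv_at j \<phi>) = S (pderiv_at 1 (W 2)) j - S (pderiv_at 2 (W 1)) j" for j
    unfolding S_diff[OF cW cW, symmetric] by (rule distr_S) (rule g)
  have Sq: "distr \<Omega> q (pderiv_at j \<phi>) = S F j" for j by (rule distr_S) (rule qF)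
  have S11: "distr \<Omega> (\<lambda>x. ?u x $ 1 * ?u x $ 1) (pderiv_at j \<phi>) = S F j - 2 * S (pderiv_at 2 (W 2)) j" for j
  proof -
    have "S F j - 2 * S (pderiv_at 2 (W 2)) j = S (\<lambda>x. (F x + 2 * C) - 2 * pderiv_at 2 (W 2) x) j"
      by (subst S_diff, (intro continuous_intros F cW)+) (subst S_add, (intro continuous_intros F)+, simp add: S_const S_cmult)
    also have "\<dots> = distr \<Omega> (\<lambda>x. ?u x $ 1 * ?u x $ 1) (pderiv_at j \<phi>)"
      by (rule distr_S[symmetric]) (use eq(2) in \<open>simp add: u mixed_form_def algebra_simps\<close>)
    finally show ?thesis by simp
  qed
  have S22: "distr \<Omega> (\<lambda>x. ?u x $ 2 * ?u x $ 2) (pderiv_at j \<phi>) = S F j - 2 * S (pderiv_at 1 (W 1)) j" for j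
  proof -
    have "S F j - 2 * S (pderiv_at 1 (W 1)) j = S (\<lambda>x. (F x + 2 * C) - 2 * pderiv_at 1 (W 1) x) j"
      by (subst S_diff, (intro continuous_intros F cW)+) (subst S_add, (intro continuous_intros F)+, simp add: S_const S_cmult)
    also have "\<dots> = distr \<Omega> (\<lambda>x. ?u x $ 2 * ?u x $ 2) (pderiv_at j \<phi>)"
      by (rule distr_S[symmetric]) (use eq(1) in \<open>simp add: u mixed_form_def algebra_simps\<close>)
    finally show ?thesis by simp
  qed
  have S12: "distr \<Omega> (\<lambda>x. ?u x $ a * ?u x $ b) (pderiv_at j \<phi>) = S (pderiv_at 1 (W 2)) j + S (pderiv_at 2 (W 1)) j"
    if "(a, b) = (1, 2) \<or> (a, b) = (2, 1)" for a b :: 2 and j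
  proof -
    have "S (pderiv_at 1 (W 2)) j + S (pderiv_at 2 (W 1)) j = S (\<lambda>x. (pderiv_at 1 (W 2) x + pderiv_at 2 (W 1) x) - C) j"
      by (subst S_diff, (intro continuous_intros cW)+) (subst S_add, (intro cW)+, simp add: S_const)
    also have "\<dots> = distr \<Omega> (\<lambda>x. ?u x $ a * ?u x $ b) (pderiv_at j \<phi>)"
    proof (rule distr_S[symmetric])
      fix x
      have "pderiv_at 1 v x * pderiv_at 2 v x + pderiv_at 1 (W 2) x + pderiv_at 2 (W 1) x = C"
        using eq(3)[of x] by (simp add: mixed_form_def)
      then show "?u x $ a * ?u x $ b = pderiv_at 1 (W 2) x + pderiv_at 2 (W 1) x - C"
        using that by (auto simp: u algebra_simps)
    qed
    finally show ?thesis by simp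
  qed
  have Su: "distr \<Omega> (\<lambda>x. ?u x $ 1) (pderiv_at j \<phi>) = - S (pderiv_at 2 v) j"
    "distr \<Omega> (\<lambda>x. ?u x $ 2) (pderiv_at j \<phi>) = S (pderiv_at 1 v) j" for j
  proof -
    have "distr \<Omega> (\<lambda>x. ?u x $ 1) (pderiv_at j \<phi>) = S (\<lambda>x. (-1) * pderiv_at 2 v x) j" by (rule distr_S) (simp add: u)
    then show "distr \<Omega> (\<lambda>x. ?u x $ 1) (pderiv_at j \<phi>) = - S (pderiv_at 2 v) j" unfolding S_cmult by simp
    show "distr \<Omega> (\<lambda>x. ?u x $ 2) (pderiv_at j \<phi>) = S (pderiv_at 1 v) j" by (rule distr_S) (rule u)
  qed
  \<comment> \<open>Symmetry is invoked three times: for \<open>v\<close> it gives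
    \<open>div u = 0\<close>, for the components of \<open>W\<close> it gives the two rows of the
    first equation.\<close>
  show "(\<forall>i. D_div (\<lambda>j. distr \<Omega> (\<lambda>x. ?u x $ i * ?u x $ j)) \<phi> - D_pderiv i (distr \<Omega> q) \<phi>
      = D_perp_grad (distr \<Omega> (curl (\<lambda>y. \<chi> j. W j y))) i \<phi>) \<and>
      D_div (\<lambda>j. distr \<Omega> (\<lambda>x. ?u x $ j)) \<phi> = 0"
    unfolding forall_2 D_div_def D_pderiv_def D_perp_grad_def sum_2
    using cross[OF v, of 1 2] cross[OF W[of 1], of 1 2] cross[OF W[of 2], of 1 2]
    by (simp add: S11 S22 S12 Su Sg Sq)
qed

section \<open>Hoelder spaces and rescaling\<close>

lemma C_holder_space_0I:
  "bounded (range f) \<Longrightarrow> (\<And>x y. norm (f x - f y) \<le> C * norm (x - y) powr \<alpha>) \<Longrightarrow> f \<in> C_holder_space 0 \<alpha>"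
  by auto

lemma C_holder_space_continuous:
  assumes f: "f \<in> C_holder_space 0 \<alpha>" and \<alpha>: "0 < \<alpha>" shows "continuous_on UNIV f"
proof -
  from f obtain C where C: "\<And>x y. norm (f x - f y) \<le> C * norm (x - y) powr \<alpha>" by auto
  have "(f \<longlongrightarrow> f x) (at x)" for x
  proof -
    have "((\<lambda>y. norm (y - x)) \<longlongrightarrow> 0) (at x)" by (auto intro!: tendsto_eq_intros)
    then have "((\<lambda>y. norm (y - x) powr \<alpha>) \<longlongrightarrow> 0) (at x)"
      by (rule tendsto_zero_powrI[OF _ tendsto_const]) (use \<alpha> in auto)
    then have "((\<lambda>y. C * norm (y - x) powr \<alpha>) \<longlongrightarrow> 0) (at x)" by (rule tendsto_mult_right_zero)
    then have "((\<lambda>y. f y - f x) \<longlongrightarrow> 0) (at x)"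
      by (rule Lim_null_comparison[rotated]) (use C in auto)
    then show ?thesis by (simp add: LIM_zero_iff)
  qed
  then show ?thesis by (simp add: continuous_on_def)
qed

lemma C_holder_space_diff:
  fixes f g :: "real^'n::finite \<Rightarrow> 'b::real_normed_vector"
  assumes "f \<in> C_holder_space 0 \<alpha>" "g \<in> C_holder_space 0 \<alpha>"
  shows "(\<lambda>x. f x - g x) \<in> C_holder_space 0 \<alpha>"
proof -
  from assms obtain A B where A: "\<And>x y. norm (f x - f y) \<le> A * norm (x - y) powr \<alpha>"
    and B: "\<And>x y. norm (g x - g y) \<le> B * norm (x - y) powr \<alpha>" by auto
  from assms obtain a b where a: "\<And>x. norm (f x) \<le> a" "\<And>x. norm (g x) \<le> b" by (auto simp: bounded_iff)
  show ?thesis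
  proof (rule C_holder_space_0I)
    show "bounded (range (\<lambda>x. f x - g x))"
      using a by (intro boundedI[of _ "a + b"]) (auto intro: order_trans[OF norm_triangle_ineq4] add_mono)
    fix x y
    have "f x - g x - (f y - g y) = (f x - f y) - (g x - g y)" by simp
    then have "norm (f x - g x - (f y - g y)) \<le> norm (f x - f y) + norm (g x - g y)" by (metis norm_triangle_ineq4)
    also have "\<dots> \<le> (A + B) * norm (x - y) powr \<alpha>" using A[of x y] B[of x y] by (simp add: distrib_right)
    finally show "norm (f x - g x - (f y - g y)) \<le> (A + B) * norm (x - y) powr \<alpha>" .
  qed
qed

lemma C_holder_space_vector:
  fixes f :: "real^'n::finite \<Rightarrow> real^'m::finite"
  assumes "\<And>i. (\<lambda>x. f x $ i) \<in> C_holder_space 0 \<alpha>"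
  shows "f \<in> C_holder_space 0 \<alpha>"
proof -
  have "\<exists>A. \<forall>x y. \<bar>f x $ i - f y $ i\<bar> \<le> A * norm (x - y) powr \<alpha>" "\<exists>a. \<forall>x. \<bar>f x $ i\<bar> \<le> a" for i
    using assms[of i] by (auto simp: bounded_iff)
  then obtain A a where A: "\<And>i x y. \<bar>f x $ i - f y $ i\<bar> \<le> A i * norm (x - y) powr \<alpha>" and a: "\<And>i x. \<bar>f x $ i\<bar> \<le> a i" by metis
  show ?thesis
  proof (rule C_holder_space_0I)
    show "bounded (range f)"
      using a by (intro boundedI[of _ "sum a UNIV"]) (auto intro!: order_trans[OF norm_le_l1_cart] sum_mono)
    fix x y
    have "norm (f x - f y) \<le> (\<Sum>i\<in>UNIV. \<bar>(f x - f y) $ i\<bar>)" by (rule norm_le_l1_cart)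
    also have "\<dots> \<le> (\<Sum>i\<in>UNIV. A i * norm (x - y) powr \<alpha>)" using A by (intro sum_mono) simp
    finally show "norm (f x - f y) \<le> sum A UNIV * norm (x - y) powr \<alpha>" by (simp add: sum_distrib_right)
  qed
qed

lemma C_holder_space_1_iff:
  "f \<in> C_holder_space 1 \<alpha> \<longleftrightarrow> bounded (range f) \<and> f differentiable_on UNIV \<and> (\<forall>i. pderiv_at i f \<in> C_holder_space 0 \<alpha>)"
  by simp

lemma C_holder_space_1_C_space: "f \<in> C_holder_space 1 \<alpha> \<Longrightarrow> 0 < \<alpha> \<Longrightarrow> f \<in> C_space 1"
  unfolding C_holder_space_1_iff by (auto simp del: C_holder_space.simps intro: C_holder_space_continuous)

text \<open>The scaling \<open>R * f (x / R)\<close> preserves gradients, so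
  \<open>mixed_form\<close> is transported unchanged from the torus to the size of
  \<open>\<Omega>\<close>.\<close>

lemma pderiv_at_rescale:
  fixes f :: "real^'n::finite \<Rightarrow> real"
  assumes R: "0 < R" and f: "\<And>x. f differentiable (at x)"
  shows "(\<lambda>x. R * f ((1 / R) *\<^sub>R x)) differentiable (at x)"
    and "pderiv_at i (\<lambda>x. R * f ((1 / R) *\<^sub>R x)) x = pderiv_at i f ((1 / R) *\<^sub>R x)"
proof -
  let ?D = "frechet_derivative f (at ((1 / R) *\<^sub>R x))"
  have D: "(f has_derivative ?D) (at ((1 / R) *\<^sub>R x))" using f by (simp add: frechet_derivative_works)
  have "((\<lambda>x. (1 / R) *\<^sub>R x) has_derivative (\<lambda>h. (1 / R) *\<^sub>R h)) (at x)" by (auto intro!: derivative_eq_intros)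
  from has_derivative_mult_right[OF diff_chain_at[OF this D], of R]
  have E: "((\<lambda>x. R * f ((1 / R) *\<^sub>R x)) has_derivative (\<lambda>h. R * ?D ((1 / R) *\<^sub>R h))) (at x)" by (simp add: o_def)
  then show "(\<lambda>x. R * f ((1 / R) *\<^sub>R x)) differentiable (at x)" by (rule differentiableI)
  show "pderiv_at i (\<lambda>x. R * f ((1 / R) *\<^sub>R x)) x = pderiv_at i f ((1 / R) *\<^sub>R x)"
    unfolding pderiv_atI[OF E] using R linear_scale[OF has_derivative_linear[OF D], of "1 / R" "axis i 1"]
    by (simp add: pderiv_at_def)
qed

lemma C_holder_space_1_rescale:
  fixes f :: "real^'n::finite \<Rightarrow> real"
  assumes R: "0 < R" and f: "f \<in> C_holder_space 1 \<alpha>"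
  shows "(\<lambda>x. R * f ((1 / R) *\<^sub>R x)) \<in> C_holder_space 1 \<alpha>"
proof -
  have d: "f differentiable (at x)" for x using f by (auto simp: differentiable_on_def)
  have "(\<lambda>x. pderiv_at i f ((1 / R) *\<^sub>R x)) \<in> C_holder_space 0 \<alpha>" for i
  proof -
    from f obtain C where C: "\<And>x y. norm (pderiv_at i f x - pderiv_at i f y) \<le> C * norm (x - y) powr \<alpha>" by auto metis
    from f obtain B where B: "\<And>x. norm (pderiv_at i f x) \<le> B" by (auto simp: bounded_iff) metis
    show ?thesis
    proof (rule C_holder_space_0I)
      show "bounded (range (\<lambda>x. pderiv_at i f ((1 / R) *\<^sub>R x)))" using B by (intro boundedI[of _ B]) auto
      show "norm (pderiv_at i f ((1 / R) *\<^sub>R x) - pderiv_at i f ((1 / R) *\<^sub>R y)) \<le> (C * (1 / R) powr \<alpha>) * norm (x - y) powr \<alpha>" for x y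
      proof -
        have "norm ((1 / R) *\<^sub>R x - (1 / R) *\<^sub>R y) = (1 / R) * norm (x - y)"
          using R by (simp add: scaleR_diff_right[symmetric])
        then have "norm ((1 / R) *\<^sub>R x - (1 / R) *\<^sub>R y) powr \<alpha> = (1 / R) powr \<alpha> * norm (x - y) powr \<alpha>"
          using R by (simp add: powr_divide)
        then show ?thesis using C[of "(1 / R) *\<^sub>R x" "(1 / R) *\<^sub>R y"] by (simp add: mult.assoc)
      qed
    qed
  qed
  moreover have "pderiv_at i (\<lambda>x. R * f ((1 / R) *\<^sub>R x)) = (\<lambda>x. pderiv_at i f ((1 / R) *\<^sub>R x))" for i
    using pderiv_at_rescale(2)[OF R d] by blast
  moreover have "bounded (range (\<lambda>x. R * f ((1 / R) *\<^sub>R x)))"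
  proof -
    from f obtain B where B: "\<And>x. \<bar>f x\<bar> \<le> B" by (auto simp: bounded_iff)
    then show ?thesis using R by (intro boundedI[of _ "R * B"]) (auto simp: abs_mult)
  qed
  moreover have "(\<lambda>x. R * f ((1 / R) *\<^sub>R x)) differentiable_on UNIV"
    using pderiv_at_rescale(1)[OF R d] by (auto intro: differentiable_at_imp_differentiable_on)
  ultimately show ?thesis unfolding C_holder_space_1_iff by (simp del: C_holder_space.simps)
qed

lemma pderiv_at_vec_lambda:
  fixes W :: "'m::finite \<Rightarrow> real^'n::finite \<Rightarrow> real"
  assumes "\<And>j. W j differentiable (at x)"
  shows "(\<lambda>y. \<chi> j. W j y) differentiable (at x)" and "pderiv_at i (\<lambda>y. \<chi> j. W j y) x = (\<chi> j. pderiv_at i (W j) x)"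
proof -
  have "((\<lambda>y. \<chi> j. W j y) has_derivative (\<lambda>h. \<chi> j. frechet_derivative (W j) (at x) h)) (at x)"
  proof (subst has_derivative_componentwise_within, intro ballI)
    fix b :: "real^'m" assume "b \<in> Basis"
    then obtain j where b: "b = axis j 1" by (auto simp: Basis_vec_def)
    show "((\<lambda>y. (\<chi> j. W j y) \<bullet> b) has_derivative (\<lambda>h. (\<chi> j. frechet_derivative (W j) (at x) h) \<bullet> b)) (at x)"
      using assms[of j] by (simp add: b inner_axis frechet_derivative_works)
  qed
  then show "(\<lambda>y. \<chi> j. W j y) differentiable (at x)" "pderiv_at i (\<lambda>y. \<chi> j. W j y) x = (\<chi> j. pderiv_at i (W j) x)"
    by (auto intro: differentiableI simp: pderiv_atI[of "\<lambda>y. \<chi> j. W j y"] pderiv_at_def[of _ "W _"])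
qed

lemma C_space_1_vec_lambda:
  fixes W :: "'m::finite \<Rightarrow> real^'n::finite \<Rightarrow> real"
  assumes "\<And>j. W j \<in> C_space 1" shows "(\<lambda>y. \<chi> j. W j y) \<in> C_space 1"
proof -
  have d: "W j differentiable (at x)" and c: "continuous_on UNIV (pderiv_at i (W j))" for i j x
    using assms[of j] by (auto simp: differentiable_on_def)
  have "pderiv_at i (\<lambda>y. \<chi> j. W j y) = (\<lambda>x. \<chi> j. pderiv_at i (W j) x)" for i
    using pderiv_at_vec_lambda(2)[of W, OF d] by blast
  then show ?thesis
    using pderiv_at_vec_lambda(1)[of W, OF d]
    by (auto intro!: differentiable_at_imp_differentiable_on continuous_on_vec_lambda c)
qed

section \<open>Periodization\<close>

text \<open>The arcsine is not Lipschitz at the endpoints 1 and -1, so its argument is first clamped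
  to \<open>[- sin 1, sin 1]\<close>. There the mean value theorem with
  \<open>cos z \<ge> cos 1 > 0\<close> yields the constant \<open>1 / cos 1\<close>.\<close>

lemma sin_left_inverse:
  obtains h :: "real \<Rightarrow> real" and c where "0 < c" "\<forall>t. \<bar>t\<bar> \<le> 1 \<longrightarrow> h (sin t) = t" "\<forall>s t. \<bar>h s - h t\<bar> \<le> c * \<bar>s - t\<bar>" "\<forall>s. \<bar>h s\<bar> \<le> 1"
proof -
  have pi: "1 < pi / 2" using pi_gt3 by linarith
  define \<kappa> where "\<kappa> u = max (- sin 1) (min (sin 1) u)" for u :: real
  define h where "h u = arcsin (\<kappa> u)" for u
  have s1: "0 \<le> sin (1::real)" using pi by (intro sin_ge_zero) auto
  have \<kappa>: "- sin 1 \<le> \<kappa> u" "\<kappa> u \<le> sin 1" "\<bar>\<kappa> u - \<kappa> v\<bar> \<le> \<bar>u - v\<bar>" for u v using s1 by (auto simp: \<kappa>_def)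
  have as: "arcsin (sin 1) = (1::real)" "arcsin (- sin 1) = (- 1::real)"
    using arcsin_sin[of 1] arcsin_sin[of "-1"] pi by auto
  have h1: "- 1 \<le> h u" "h u \<le> 1" "sin (h u) = \<kappa> u" for u
  proof -
    have b: "-1 \<le> \<kappa> u" "\<kappa> u \<le> 1" using \<kappa>(1,2)[of u] sin_le_one[of 1] by linarith+
    show "- 1 \<le> h u" unfolding h_def as(2)[symmetric] using \<kappa>[of u] b by (intro arcsin_le_arcsin) auto
    show "h u \<le> 1" unfolding h_def using arcsin_le_arcsin[of "\<kappa> u" "sin 1"] \<kappa>[of u] b as by auto
    show "sin (h u) = \<kappa> u" unfolding h_def using b by simp
  qed
  have c1: "0 < cos (1::real)" using pi by (intro cos_gt_zero) auto
  have sin_diff: "cos 1 * (t - s) \<le> sin t - sin s" if st: "-1 \<le> s" "s < t" "t \<le> 1" for s t :: real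
  proof -
    obtain z where z: "s < z" "z < t" "sin t - sin s = (t - s) * cos z"
      using MVT2[of s t sin cos] st(2) by auto
    have "cos 1 \<le> cos \<bar>z\<bar>" using z st pi by (intro cos_monotone_0_pi_le) auto
    then have "cos 1 \<le> cos z" by simp
    then show ?thesis using z st by (simp add: mult.commute mult_left_mono)
  qed
  have sd: "cos 1 * \<bar>t - s\<bar> \<le> \<bar>sin t - sin s\<bar>" if "-1 \<le> s" "s \<le> 1" "-1 \<le> t" "t \<le> 1" for s t :: real
    using sin_diff[of s t] sin_diff[of t s] that by (cases s t rule: linorder_cases) auto
  have "\<bar>h s - h t\<bar> \<le> (1 / cos 1) * \<bar>s - t\<bar>" for s t
  proof -
    have "cos 1 * \<bar>h s - h t\<bar> \<le> \<bar>\<kappa> s - \<kappa> t\<bar>" using sd[of "h t" "h s"] h1 by simp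
    also have "\<dots> \<le> \<bar>s - t\<bar>" by (rule \<kappa>)
    finally show ?thesis using c1 by (simp add: field_simps)
  qed
  moreover have "h (sin t) = t" if "\<bar>t\<bar> \<le> 1" for t
  proof -
    have "sin t \<le> sin 1" by (rule sin_monotone_2pi_le) (use that pi in linarith)+
    moreover have "sin (-1) \<le> sin t" by (rule sin_monotone_2pi_le) (use that pi in linarith)+
    ultimately have "\<kappa> (sin t) = sin t" by (simp add: \<kappa>_def)
    then show ?thesis unfolding h_def using that pi by (simp add: arcsin_sin)
  qed
  moreover have "\<bar>h s\<bar> \<le> 1" for s using h1[of s] by linarith
  ultimately show thesis using c1 that[of "1 / cos 1" h] by simp
qed

text \<open>The difference of sines is one coordinate of the chord between two points of the unit
  circle.\<close>

lemma sin_diff_chord: "(sin a - sin b)\<^sup>2 \<le> 2 - 2 * cos (a - b)" for a b :: real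
proof -
  have "2 - 2 * cos (a - b) = (sin a - sin b)\<^sup>2 + (cos a - cos b)\<^sup>2"
    using sin_cos_squared_add[of a] sin_cos_squared_add[of b] by (simp add: cos_diff power2_eq_square algebra_simps)
  then show ?thesis by simp
qed

text \<open>\<open>\<tau>\<close> depends on the sines of the coordinates only, so composing a
  function with it gives a periodic function. This agrees with the original one, up to scaling, on
  the box of half-width \<open>R\<close>. Its modulus is measured in the chordal distance.\<close>

lemma torus_retraction:
  assumes R: "0 < R"
  obtains \<tau> :: "real^2 \<Rightarrow> real^2" and c where "0 < c" "\<forall>x. (\<forall>i. \<bar>x $ i\<bar> \<le> R) \<longrightarrow> \<tau> ((1 / R) *\<^sub>R x) = x"
    "\<forall>x y. norm (\<tau> x - \<tau> y) \<le> c * sqrt (chord2 x y)" "\<forall>x. norm (\<tau> x) \<le> 2 * R"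
proof -
  obtain h :: "real \<Rightarrow> real" and c where h: "0 < c" "\<forall>t. \<bar>t\<bar> \<le> 1 \<longrightarrow> h (sin t) = t" "\<forall>s t. \<bar>h s - h t\<bar> \<le> c * \<bar>s - t\<bar>" "\<forall>s. \<bar>h s\<bar> \<le> 1"
    by (rule sin_left_inverse)
  define \<tau> :: "real^2 \<Rightarrow> real^2" where "\<tau> x = (\<chi> i. R * h (sin (x $ i)))" for x
  have "\<tau> ((1 / R) *\<^sub>R x) = x" if "\<forall>i. \<bar>x $ i\<bar> \<le> R" for x
  proof -
    have "\<bar>1 / R * x $ i\<bar> \<le> 1" for i using that R by (simp add: abs_mult)
    then have "h (sin (1 / R * x $ i)) = 1 / R * x $ i" for i using h(2) by blast
    then show ?thesis using R by (simp add: \<tau>_def vec_eq_iff)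
  qed
  moreover have "norm (\<tau> x - \<tau> y) \<le> (2 * R * c) * sqrt (chord2 x y)" for x y
  proof -
    have "norm (\<tau> x - \<tau> y) \<le> (\<Sum>i\<in>UNIV. \<bar>(\<tau> x - \<tau> y) $ i\<bar>)" by (rule norm_le_l1_cart)
    also have "\<dots> \<le> (\<Sum>i\<in>(UNIV::2 set). R * (c * sqrt (chord2 x y)))"
    proof (rule sum_mono)
      fix i :: 2
      have "(sin (x $ i) - sin (y $ i))\<^sup>2 \<le> chord2 x y"
        using exhaust_2[of i]
      proof
        assume i: "i = 1"
        show ?thesis unfolding i chord2_def using sin_diff_chord[of "x $ 1" "y $ 1"] cos_le_one[of "x $ 2 - y $ 2"] by linarith
      next
        assume i: "i = 2"
        show ?thesis unfolding i chord2_def using sin_diff_chord[of "x $ 2" "y $ 2"] cos_le_one[of "x $ 1 - y $ 1"] by linarith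
      qed
      then have s: "\<bar>sin (x $ i) - sin (y $ i)\<bar> \<le> sqrt (chord2 x y)" by (metis real_sqrt_abs real_sqrt_le_mono)
      have "\<bar>(\<tau> x - \<tau> y) $ i\<bar> = R * \<bar>h (sin (x $ i)) - h (sin (y $ i))\<bar>"
        using R by (simp add: \<tau>_def abs_mult flip: right_diff_distrib)
      also have "\<dots> \<le> R * (c * \<bar>sin (x $ i) - sin (y $ i)\<bar>)" using R h(3) by (intro mult_left_mono) auto
      also have "\<dots> \<le> R * (c * sqrt (chord2 x y))" using R h(1) s by (intro mult_left_mono) auto
      finally show "\<bar>(\<tau> x - \<tau> y) $ i\<bar> \<le> R * (c * sqrt (chord2 x y))" .
    qed
    finally show ?thesis by simp
  qed
  moreover have "norm (\<tau> x) \<le> 2 * R" for x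
  proof -
    have "norm (\<tau> x) \<le> (\<Sum>i\<in>UNIV. \<bar>\<tau> x $ i\<bar>)" by (rule norm_le_l1_cart)
    also have "\<dots> \<le> (\<Sum>i\<in>(UNIV::2 set). R * 1)"
      using R h(4) by (intro sum_mono) (simp add: \<tau>_def abs_mult)
    finally show ?thesis by simp
  qed
  ultimately show thesis using that[of "2 * R * c" \<tau>] R h(1) by simp
qed

section \<open>Density\<close>

text \<open>Rational coefficients on finite grids give countability; \<open>Pi\<^sub>E\<close> fixes
  the values off the grid so that each coefficient set is countable.\<close>

definition jackson_family :: "(real^2 \<Rightarrow> real) set" where
  "jackson_family = (\<Union>n\<in>{1..}. jackson n ` (Pi\<^sub>E (fk_grid n) (\<lambda>_. \<rat>)))"

lemma finite_fk_grid: "finite (fk_grid n)"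
  by (simp add: fk_grid_def)

lemma countable_jackson_family: "countable jackson_family"
  unfolding jackson_family_def
  by (intro countable_UN countable_image countable_PiE finite_fk_grid countable_rat) auto

lemma tp_jackson_family: "h \<in> jackson_family \<Longrightarrow> \<exists>L. tp L h"
  unfolding jackson_family_def using tp_jackson by fastforce

text \<open>Three thirds of \<open>\<delta>\<close>: rounding the node values to rationals, the
  oscillation of \<open>G\<close> at small scale, and the Jackson error. The hypothesis is uniform
  continuity in the chordal distance, written as an affine bound.\<close>

lemma jackson_family_dense:
  assumes G: "\<And>\<eta>. 0 < \<eta> \<Longrightarrow> \<exists>L\<ge>0. \<forall>x y. \<bar>G x - G y\<bar> \<le> \<eta> + L * chord2 x y" and \<delta>: "0 < \<delta>"
  obtains h where "h \<in> jackson_family" "\<forall>x. \<bar>h x - G x\<bar> \<le> \<delta>"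
proof -
  obtain L where L: "0 \<le> L" "\<And>x y. \<bar>G x - G y\<bar> \<le> \<delta> / 3 + L * chord2 x y" using G[of "\<delta> / 3"] \<delta> by auto
  \<comment> \<open>63 = 3 * 21, with 21 from \<open>jackson_estimate\<close>; the weaker rate
    \<open>1 / n\<close> is enough here.\<close>
  obtain n :: nat where n: "max 1 (63 * L / \<delta>) \<le> real n" using real_arch_simple by blast
  then have n1: "1 \<le> n" "63 * L / \<delta> \<le> real n" by auto
  have "\<exists>r\<in>\<rat>. \<bar>r - G (fk_point n q)\<bar> \<le> \<delta> / 3" for q
  proof -
    obtain r where "r \<in> \<rat>" "G (fk_point n q) - \<delta> / 3 < r" "r < G (fk_point n q)"
      using Rats_dense_in_real[of "G (fk_point n q) - \<delta> / 3" "G (fk_point n q)"] \<delta> by auto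
    then show ?thesis by (intro bexI[of _ r]) auto
  qed
  then obtain r where r: "\<And>q. r q \<in> \<rat>" "\<And>q. \<bar>r q - G (fk_point n q)\<bar> \<le> \<delta> / 3" by metis
  define c where "c = restrict r (fk_grid n)"
  have c: "c \<in> Pi\<^sub>E (fk_grid n) (\<lambda>_. \<rat>)" using r(1) by (auto simp: c_def)
  have "\<bar>jackson n c x - G x\<bar> \<le> \<delta>" for x
  proof -
    have "\<bar>jackson n c x - G x\<bar> \<le> \<delta> / 3 + \<delta> / 3 + 21 * L * real n powr (- 2 * 1)"
    proof (rule jackson_estimate)
      show "\<bar>G x - G y\<bar> \<le> \<delta> / 3 + L * chord2 x y powr 1" for x y using L(2)[of x y] chord2_nonneg[of x y] by simp
      show "\<bar>c q - G (fk_point n q)\<bar> \<le> \<delta> / 3" if "q \<in> fk_grid n" for q using r(2)[of q] that by (simp add: c_def)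
    qed (use n1 L in auto)
    also have "21 * L * real n powr (- 2 * 1) \<le> \<delta> / 3"
    proof -
      have "real n powr (- 2 * 1) \<le> real n powr (- 1)" using n1 by (intro powr_mono) auto
      then have "21 * L * real n powr (- 2 * 1) \<le> 21 * L * (1 / real n)"
        using L n1 by (intro mult_left_mono) (auto simp: powr_minus_divide)
      also have "\<dots> \<le> \<delta> / 3" using n1 \<delta> by (simp add: field_simps)
      finally show ?thesis .
    qed
    finally show ?thesis by simp
  qed
  moreover have "jackson n c \<in> jackson_family" unfolding jackson_family_def using c n1 by auto
  ultimately show thesis using that by blast
qed

text \<open>If \<open>\<tau> x\<close> and \<open>\<tau> y\<close> are close, uniform continuity on
  a ball gives \<open>\<eta>\<close>. Otherwise \<open>chord2\<close> is bounded below by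
  \<open>d\<^sup>2 / c\<^sup>2\<close>, and the linear term outweighs the trivial bound
  \<open>2 * B\<close>.\<close>

lemma periodization_modulus:
  fixes F :: "real^2 \<Rightarrow> real"
  assumes F: "continuous_on UNIV F" and c: "0 < c"
    and \<tau>: "\<And>x y. norm (\<tau> x - \<tau> y) \<le> c * sqrt (chord2 x y)" "\<And>x. norm (\<tau> x) \<le> M" and \<eta>: "0 < \<eta>"
  shows "\<exists>L\<ge>0. \<forall>x y. \<bar>F (\<tau> x) - F (\<tau> y)\<bar> \<le> \<eta> + L * chord2 x y"
proof -
  have "uniformly_continuous_on (cball 0 M) F"
    by (intro compact_uniformly_continuous continuous_on_subset[OF F]) auto
  then obtain d where d: "0 < d" "\<And>a b. a \<in> cball 0 M \<Longrightarrow> b \<in> cball 0 M \<Longrightarrow> dist b a < d \<Longrightarrow> dist (F b) (F a) < \<eta>"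
    using \<eta> unfolding uniformly_continuous_on_def by metis
  have "bounded (F ` cball 0 M)"
    by (intro compact_imp_bounded compact_continuous_image continuous_on_subset[OF F]) auto
  then obtain B where B: "0 < B" "\<And>a. a \<in> cball 0 M \<Longrightarrow> \<bar>F a\<bar> \<le> B" unfolding bounded_pos by auto
  define L where "L = 2 * B * c\<^sup>2 / d\<^sup>2"
  have "\<bar>F (\<tau> x) - F (\<tau> y)\<bar> \<le> \<eta> + L * chord2 x y" for x y
  proof (cases "dist (\<tau> x) (\<tau> y) < d")
    case True
    then have "dist (F (\<tau> x)) (F (\<tau> y)) < \<eta>" using \<tau>(2) by (intro d(2)) auto
    moreover have "0 \<le> L * chord2 x y" using B chord2_nonneg[of x y] by (simp add: L_def)
    ultimately show ?thesis by (simp add: dist_real_def)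
  next
    case False
    have "d \<le> c * sqrt (chord2 x y)" using False \<tau>(1)[of x y] by (simp add: dist_norm)
    then have "d\<^sup>2 \<le> (c * sqrt (chord2 x y))\<^sup>2" using d by (intro power_mono) auto
    also have "\<dots> = c\<^sup>2 * chord2 x y" using chord2_nonneg[of x y] by (simp add: power_mult_distrib)
    finally have "1 \<le> c\<^sup>2 * chord2 x y / d\<^sup>2" using d by (simp add: field_simps)
    then have "2 * B * 1 \<le> 2 * B * (c\<^sup>2 * chord2 x y / d\<^sup>2)" using B by (intro mult_left_mono) auto
    then have "2 * B \<le> L * chord2 x y" by (simp add: L_def)
    moreover have "\<bar>F (\<tau> x)\<bar> \<le> B" "\<bar>F (\<tau> y)\<bar> \<le> B" using \<tau>(2) B by auto
    ultimately show ?thesis using \<eta> by linarith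
  qed
  moreover have "0 \<le> L" using B by (simp add: L_def)
  ultimately show ?thesis by blast
qed

lemma C_holder_space_const_0: "(\<lambda>x. 0) \<in> C_holder_space 0 \<alpha>"
  by (auto intro!: exI[of _ 0])

section \<open>Transfer to the domain and enumeration of the solutions\<close>

lemma rescaled_solution:
  fixes q F v0 :: "real^2 \<Rightarrow> real"
  assumes R: "0 < R" and \<alpha>: "0 < \<alpha>" and S: "mixed_solution \<alpha> Q C V W"
    and Q: "\<And>x. x \<in> \<Omega> \<Longrightarrow> Q ((1 / R) *\<^sub>R x) = q x"
    and V: "\<forall>x. \<bar>V x - v0 x\<bar> \<le> \<eta>" and W: "\<forall>i x. \<bar>W i x\<bar> \<le> \<eta>"
  obtains v w where "v \<in> C_holder_space 1 \<alpha>" "w \<in> C_space 1" "perp_grad v \<in> C_holder_space 0 \<alpha>"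
    "curl w \<in> C_holder_space 0 \<alpha>" "solves_system \<Omega> q (perp_grad v) (curl w)"
    "\<forall>x. \<bar>v x - R * v0 ((1 / R) *\<^sub>R x)\<bar> \<le> R * \<eta>" "\<forall>x. norm (w x) \<le> 2 * R * \<eta>"
proof -
  define v where "v x = R * V ((1 / R) *\<^sub>R x)" for x
  define Wr where "Wr j x = R * W j ((1 / R) *\<^sub>R x)" for j x
  define w where "w y = (\<chi> j. Wr j y)" for y
  have VW: "V \<in> C_holder_space 1 \<alpha>" "W j \<in> C_holder_space 1 \<alpha>" for j using S by (auto simp: mixed_solution_def)
  have d: "V differentiable (at x)" "W j differentiable (at x)" for j x
    using VW(1) VW(2)[of j] by (auto simp: differentiable_on_def)
  have v: "v \<in> C_holder_space 1 \<alpha>" unfolding v_def by (rule C_holder_space_1_rescale[OF R VW(1)])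
  have Wr: "Wr j \<in> C_holder_space 1 \<alpha>" for j unfolding Wr_def by (rule C_holder_space_1_rescale[OF R VW(2)])
  have v1: "v \<in> C_space 1" and Wr1: "Wr j \<in> C_space 1" for j using C_holder_space_1_C_space v Wr \<alpha> by blast+
  have pv: "pderiv_at i v x = pderiv_at i V ((1 / R) *\<^sub>R x)" for i x
    unfolding v_def by (rule pderiv_at_rescale(2)[OF R d(1)])
  have pW: "pderiv_at i (Wr j) x = pderiv_at i (W j) ((1 / R) *\<^sub>R x)" for i j x
    unfolding Wr_def by (rule pderiv_at_rescale(2)[OF R d(2)])
  have mix: "mixed_form v Wr i j x = mixed_form V W i j ((1 / R) *\<^sub>R x)" for i j x
    unfolding mixed_form_def pv pW ..
  have hp: "pderiv_at i v \<in> C_holder_space 0 \<alpha>" "pderiv_at i (Wr j) \<in> C_holder_space 0 \<alpha>" for i j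
    using v Wr[of j] unfolding C_holder_space_1_iff by blast+
  \<comment> \<open>The pressure on the whole plane is read off from the (1,1) entry of the
    equation, which also shows its continuity.\<close>
  have cF: "continuous_on UNIV (\<lambda>x. mixed_form v Wr 1 1 x - 2 * C)"
    unfolding mixed_form_def by (intro continuous_intros C_holder_space_continuous[OF hp(1) \<alpha>] C_holder_space_continuous[OF hp(2) \<alpha>])
  have sol: "solves_system \<Omega> q (perp_grad v) (curl w)"
    unfolding w_def
  proof (rule solves_systemI[OF v1 Wr1 cF])
    show "q x = mixed_form v Wr 1 1 x - 2 * C" if "x \<in> \<Omega>" for x
      using S Q[OF that] by (simp add: mix mixed_solution_def)
  qed (use S in \<open>simp_all add: mix mixed_solution_def\<close>)
  have "(\<lambda>x. perp_grad v x $ i) \<in> C_holder_space 0 \<alpha>" for i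
  proof -
    have "(\<lambda>x. 0 - pderiv_at 2 v x) \<in> C_holder_space 0 \<alpha>" "(\<lambda>x. pderiv_at 1 v x) \<in> C_holder_space 0 \<alpha>"
      using C_holder_space_diff[OF C_holder_space_const_0 hp(1)] hp(1) by auto
    then show ?thesis using exhaust_2[of i] by (auto simp: perp_grad_def simp del: C_holder_space.simps)
  qed
  then have u: "perp_grad v \<in> C_holder_space 0 \<alpha>" by (rule C_holder_space_vector)
  have comp: "(\<lambda>y. w y $ i) = Wr i" for i by (simp add: w_def)
  have g: "curl w \<in> C_holder_space 0 \<alpha>"
    unfolding curl_def[abs_def] comp by (rule C_holder_space_diff[OF hp(2) hp(2)])
  have w1: "w \<in> C_space 1" unfolding w_def by (rule C_space_1_vec_lambda[OF Wr1])
  have "\<forall>x. \<bar>v x - R * v0 ((1 / R) *\<^sub>R x)\<bar> \<le> R * \<eta>"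
    using V R by (simp add: v_def abs_mult flip: right_diff_distrib)
  moreover have "\<forall>x. norm (w x) \<le> 2 * R * \<eta>"
  proof
    fix x
    have "norm (w x) \<le> (\<Sum>i\<in>UNIV. \<bar>w x $ i\<bar>)" by (rule norm_le_l1_cart)
    also have "\<dots> \<le> (\<Sum>i\<in>(UNIV::2 set). R * \<eta>)"
      using W R by (intro sum_mono) (simp add: w_def Wr_def abs_mult)
    finally show "norm (w x) \<le> 2 * R * \<eta>" by simp
  qed
  ultimately show thesis by (rule that[OF v w1 u g sol])
qed

lemma norm0_le: "\<Omega> \<noteq> {} \<Longrightarrow> (\<And>x. x \<in> closure \<Omega> \<Longrightarrow> norm (f x) \<le> B) \<Longrightarrow> norm0 \<Omega> f \<le> B"
  unfolding norm0_def by (rule cSUP_least) (auto simp: closure_eq_empty)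

theorem corollary4p1:
  fixes \<Omega> :: "(real^2) set" and q :: "real^2 \<Rightarrow> real" and \<beta> \<epsilon> :: real
  assumes "open \<Omega>" and "connected \<Omega>" and "\<Omega> \<noteq> {}" and "bounded \<Omega>"
    and "0 < \<beta>" and "\<beta> < 1" and "q \<in> C_holder_bar 0 \<beta> \<Omega>"
    and "\<epsilon> > 0"
  shows "\<forall>\<alpha>. 0 < \<alpha> \<and> \<alpha> < min (1/7) (\<beta>/2) \<longrightarrow>
    (\<exists>(u :: nat \<Rightarrow> real^2 \<Rightarrow> real^2) (g :: nat \<Rightarrow> real^2 \<Rightarrow> real)
       (v :: nat \<Rightarrow> real^2 \<Rightarrow> real) (w :: nat \<Rightarrow> real^2 \<Rightarrow> real^2).
       (\<forall>n\<ge>1.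
          u n \<in> C_holder_bar 0 \<alpha> \<Omega> \<and> g n \<in> C_holder_bar 0 \<alpha> \<Omega> \<and>
          solves_system \<Omega> q (u n) (g n) \<and>
          v n \<in> C_holder_bar 1 \<alpha> \<Omega> \<and> w n \<in> C_bar 1 \<Omega> \<and>
          (\<forall>x\<in>\<Omega>. u n x = perp_grad (v n) x) \<and>
          (\<forall>x\<in>\<Omega>. g n x = curl (w n) x) \<and>
          norm0 \<Omega> (w n) < \<epsilon>) \<and>
       dense_in_C0_bar \<Omega> (v ` {1..}))"
proof (intro allI impI, goal_cases)
  case (1 \<alpha>)
  then have \<alpha>: "0 < \<alpha>" "\<alpha> < 1/7" "\<alpha> < \<beta> / 2" by auto
  obtain F where F: "F \<in> C_holder_space 0 \<beta>" "\<forall>x\<in>closure \<Omega>. q x = F x"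
    using assms(7) by (auto simp: C_holder_bar_def simp del: C_holder_space.simps)
  obtain Cq where Cq: "\<And>x y. \<bar>F x - F y\<bar> \<le> Cq * norm (x - y) powr \<beta>" using F(1) by auto
  define L where "L = max 0 Cq"
  have L: "0 \<le> L" "\<bar>F x - F y\<bar> \<le> L * norm (x - y) powr \<beta>" for x y
    using order_trans[OF Cq mult_right_mono[of Cq L]] by (auto simp: L_def)
  have "bounded (closure \<Omega>)" using assms(4) by (rule bounded_closure)
  then obtain R where R: "0 < R" "\<And>x. x \<in> closure \<Omega> \<Longrightarrow> norm x \<le> R" unfolding bounded_pos by auto
  obtain \<tau> :: "real^2 \<Rightarrow> real^2" and c where \<tau>: "0 < c" "\<forall>x. (\<forall>i. \<bar>x $ i\<bar> \<le> R) \<longrightarrow> \<tau> ((1 / R) *\<^sub>R x) = x"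
    "\<forall>x y. norm (\<tau> x - \<tau> y) \<le> c * sqrt (chord2 x y)" "\<forall>x. norm (\<tau> x) \<le> 2 * R"
    by (rule torus_retraction[OF R(1)])
  have \<tau>R: "\<tau> ((1 / R) *\<^sub>R x) = x" if "x \<in> closure \<Omega>" for x
    using \<tau>(2) order_trans[OF component_le_norm_cart R(2)[OF that]] by blast
  define Q where "Q y = F (\<tau> y)" for y
  \<comment> \<open>\<open>chord2\<close> is a squared distance, so the Hoelder exponent
    \<open>\<beta>\<close> turns into \<open>\<beta> / 2\<close>.\<close>
  have Q: "\<bar>Q x - Q y\<bar> \<le> (L * c powr \<beta>) * chord2 x y powr (\<beta> / 2)" for x y
  proof -
    have "norm (\<tau> x - \<tau> y) powr \<beta> \<le> (c * sqrt (chord2 x y)) powr \<beta>"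
      using \<tau>(3) assms(5) by (intro powr_mono2) auto
    also have "\<dots> = c powr \<beta> * chord2 x y powr (\<beta> / 2)"
      using \<tau>(1) chord2_nonneg[of x y] by (simp add: powr_mult powr_half_sqrt[symmetric] powr_powr)
    finally have "L * norm (\<tau> x - \<tau> y) powr \<beta> \<le> L * (c powr \<beta> * chord2 x y powr (\<beta> / 2))"
      using L(1) by (rule mult_left_mono)
    then show ?thesis using L(2)[of "\<tau> x" "\<tau> y"] by (simp add: Q_def mult.assoc)
  qed
  define PP where "PP h j p \<longleftrightarrow> fst p \<in> C_holder_space 1 \<alpha> \<and> snd p \<in> C_space 1 \<and>
     perp_grad (fst p) \<in> C_holder_space 0 \<alpha> \<and> curl (snd p) \<in> C_holder_space 0 \<alpha> \<and>
     solves_system \<Omega> q (perp_grad (fst p)) (curl (snd p)) \<and>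
     (\<forall>x. \<bar>fst p x - R * h ((1 / R) *\<^sub>R x)\<bar> \<le> 1 / real (Suc j)) \<and> (\<forall>x. norm (snd p x) \<le> \<epsilon> / 2)"
    for h and j :: nat and p :: "(real^2 \<Rightarrow> real) \<times> (real^2 \<Rightarrow> real^2)"
  have ex: "\<exists>p. PP h j p" if h: "h \<in> jackson_family" for h j
  proof -
    obtain L0 where L0: "tp L0 h" using tp_jackson_family[OF h] by blast
    \<comment> \<open>After rescaling, the displacement of \<open>v\<close> is at most
      \<open>1 / (j + 1)\<close> and the norm of \<open>w\<close> at most
      \<open>\<epsilon> / 2\<close>, which leaves room for the strict inequality of the
      supremum.\<close>
    define \<eta> where "\<eta> = min (1 / (R * real (Suc j))) (\<epsilon> / (4 * R))"
    have \<eta>: "0 < \<eta>" using R assms(8) by (simp add: \<eta>_def)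
    have \<eta>1: "R * \<eta> \<le> 1 / real (Suc j)"
    proof -
      have "R * \<eta> \<le> R * (1 / (R * real (Suc j)))" using R by (intro mult_left_mono) (auto simp: \<eta>_def)
      then show ?thesis using R by simp
    qed
    have \<eta>2: "2 * R * \<eta> \<le> \<epsilon> / 2"
    proof -
      have "2 * R * \<eta> \<le> 2 * R * (\<epsilon> / (4 * R))" using R by (intro mult_left_mono) (auto simp: \<eta>_def)
      then show ?thesis using R by simp
    qed
    obtain C V W where VW: "mixed_solution \<alpha> Q C V W" "\<forall>x. \<bar>V x - h x\<bar> \<le> \<eta>" "\<forall>i x. \<bar>W i x\<bar> \<le> \<eta>"
      by (rule torus_solution[OF \<alpha> less_imp_le[OF assms(6)] Q L0 \<eta>])
    have QR: "Q ((1 / R) *\<^sub>R x) = q x" if "x \<in> \<Omega>" for x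
      using \<tau>R[of x] F(2) closure_subset[of \<Omega>] that by (auto simp: Q_def)
    obtain v w where vw: "v \<in> C_holder_space 1 \<alpha>" "w \<in> C_space 1" "perp_grad v \<in> C_holder_space 0 \<alpha>"
      "curl w \<in> C_holder_space 0 \<alpha>" "solves_system \<Omega> q (perp_grad v) (curl w)"
      "\<forall>x. \<bar>v x - R * h ((1 / R) *\<^sub>R x)\<bar> \<le> R * \<eta>" "\<forall>x. norm (w x) \<le> 2 * R * \<eta>"
      by (rule rescaled_solution[OF R(1) \<alpha>(1) VW(1) QR VW(2,3)])
    have "PP h j (v, w)" unfolding PP_def fst_conv snd_conv
      using vw(1-5) order_trans[OF vw(6)[rule_format] \<eta>1] order_trans[OF vw(7)[rule_format] \<eta>2] by blast
    then show ?thesis by blast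
  qed
  \<comment> \<open>Each starting function is paired with every accuracy index, so that the
    enumeration contains arbitrarily close solutions for each of them.\<close>
  define E where "E = jackson_family \<times> (UNIV :: nat set)"
  define e where "e = from_nat_into E"
  \<comment> \<open>\<open>from_nat_into\<close> enumerates all of \<open>E\<close> only if
    \<open>E\<close> is nonempty; density applied to the zero function supplies a member.\<close>
  have "jackson_family \<noteq> {}"
  proof -
    have "\<exists>L\<ge>0. \<forall>x y :: real^2. \<bar>0 - 0 :: real\<bar> \<le> \<eta> + L * chord2 x y" if "0 < \<eta>" for \<eta>
      using that by (intro exI[of _ 0]) auto
    from jackson_family_dense[of "\<lambda>_. 0" 1, OF this] show ?thesis by auto
  qed
  then have E: "countable E" "E \<noteq> {}" using countable_jackson_family by (auto simp: E_def)
  have range_e: "range e = E" unfolding e_def using E by simp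
  have "\<forall>n. \<exists>p. PP (fst (e n)) (snd (e n)) p"
  proof
    fix n have "e n \<in> E" using range_e by blast
    then show "\<exists>p. PP (fst (e n)) (snd (e n)) p" using ex by (auto simp: E_def)
  qed
  from choice[OF this] obtain p where p: "\<forall>n. PP (fst (e n)) (snd (e n)) (p n)" by (elim exE)
  \<comment> \<open>The enumeration starts at 0, the required sequence at 1.\<close>
  define v where "v n = fst (p (n - 1))" for n
  define w where "w n = snd (p (n - 1))" for n
  have props: "v n \<in> C_holder_space 1 \<alpha>" "w n \<in> C_space 1" "perp_grad (v n) \<in> C_holder_space 0 \<alpha>"
    "curl (w n) \<in> C_holder_space 0 \<alpha>" "solves_system \<Omega> q (perp_grad (v n)) (curl (w n))"
    "norm (w n x) \<le> \<epsilon> / 2" for n x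
    using p[rule_format, of "n - 1"] unfolding PP_def v_def w_def by blast+
  have approx: "\<bar>v (Suc n) x - R * fst (e n) ((1 / R) *\<^sub>R x)\<bar> \<le> 1 / real (Suc (snd (e n)))" for n x
    using p[rule_format, of n] unfolding PP_def v_def by simp
  have bar: "f \<in> C_holder_bar k \<alpha> \<Omega>" if "f \<in> C_holder_space k \<alpha>" for f :: "real^2 \<Rightarrow> 'b::real_normed_vector" and k
    using that by (auto simp: C_holder_bar_def simp del: C_holder_space.simps)
  have bar': "f \<in> C_bar k \<Omega>" if "f \<in> C_space k" for f :: "real^2 \<Rightarrow> 'b::real_normed_vector" and k
    using that by (auto simp: C_bar_def simp del: C_space.simps)
  have w\<epsilon>: "norm0 \<Omega> (w n) < \<epsilon>" for n
    using norm0_le[OF assms(3), of "w n" "\<epsilon> / 2"] props(6) assms(8) by force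
  have dense: "dense_in_C0_bar \<Omega> (v ` {1..})"
    unfolding dense_in_C0_bar_def
  proof (intro conjI ballI allI impI)
    have "v n \<in> C_space 0" for n
      using C_space_continuous[OF C_holder_space_1_C_space[OF props(1) \<alpha>(1)]] by simp
    then show "v ` {1..} \<subseteq> C_bar 0 \<Omega>" using bar' by blast
  next
    fix f :: "real^2 \<Rightarrow> real" and \<delta> :: real assume f: "f \<in> C_bar 0 \<Omega>" and \<delta>: "0 < \<delta>"
    obtain F0 where F0: "continuous_on UNIV F0" "\<forall>x\<in>closure \<Omega>. f x = F0 x" using f by (auto simp: C_bar_def)
    \<comment> \<open>The target is divided by \<open>R\<close> because rescaling multiplies the
      approximant by \<open>R\<close> again.\<close>
    have cF0: "continuous_on UNIV (\<lambda>z. F0 z / R)" using F0(1) R by (intro continuous_intros) auto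
    have \<delta>R: "0 < \<delta> / (4 * R)" using \<delta> R by simp
    obtain h where h: "h \<in> jackson_family" "\<forall>x. \<bar>h x - F0 (\<tau> x) / R\<bar> \<le> \<delta> / (4 * R)"
      by (rule jackson_family_dense[OF periodization_modulus[OF cF0 \<tau>(1) \<tau>(3)[rule_format] \<tau>(4)[rule_format]] \<delta>R])
    obtain j :: nat where j: "4 / \<delta> \<le> real j" using real_arch_simple by blast
    then have "4 / \<delta> \<le> real (Suc j)" by simp
    then have j': "1 / real (Suc j) \<le> \<delta> / 4" using \<delta> by (simp add: field_simps)
    have "(h, j) \<in> range e" unfolding range_e E_def using h by simp
    then obtain n where n: "e n = (h, j)" by auto
    have "norm (f x - v (Suc n) x) \<le> \<delta> / 2" if x: "x \<in> closure \<Omega>" for x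
    proof -
      let ?y = "(1 / R) *\<^sub>R x"
      have "\<bar>R * h ?y - f x\<bar> = R * \<bar>h ?y - F0 (\<tau> ?y) / R\<bar>"
      proof -
        have "R * h ?y - f x = R * (h ?y - F0 (\<tau> ?y) / R)" using R \<tau>R[OF x] F0(2) x by (simp add: right_diff_distrib)
        then show ?thesis using R by (simp add: abs_mult)
      qed
      also have "\<dots> \<le> R * (\<delta> / (4 * R))" using h(2) R by (intro mult_left_mono) auto
      also have "\<dots> = \<delta> / 4" using R by simp
      finally have "\<bar>R * h ?y - f x\<bar> \<le> \<delta> / 4" .
      moreover have "\<bar>v (Suc n) x - R * h ?y\<bar> \<le> \<delta> / 4" using approx[of n x] j' n by simp
      ultimately show ?thesis unfolding real_norm_def by linarith
    qed
    then have "norm0 \<Omega> (\<lambda>x. f x - v (Suc n) x) \<le> \<delta> / 2" by (rule norm0_le[OF assms(3)])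
    then show "\<exists>h\<in>v ` {1..}. norm0 \<Omega> (\<lambda>x. f x - h x) < \<delta>" using \<delta> by (intro bexI[of _ "v (Suc n)"]) auto
  qed
  show ?case
    by (rule exI[of _ "\<lambda>n. perp_grad (v n)"], rule exI[of _ "\<lambda>n. curl (w n)"], rule exI[of _ v], rule exI[of _ w])
      (intro conjI allI impI ballI refl dense bar bar' props w\<epsilon>)
qed

end
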